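(* Let $C>0$ and $h\in\mathbb{R}$, let $\overline{\Sigma}_{C,h}$ be the compactification of the common level set $\Sigma_{C,h}=\{\mathcal{H}=h,\ \mathcal{C}=C\}$, and let $\pi:\overline{\Sigma}_{C,h}\to S^2_C$ be the projection. Then $\overline{\Sigma}_{C,h}$ is homeomorphic to one of the following manifolds: 1. $S^1\times S^2$, if $\pi:\overline{\Sigma}_{C,h}\to S^2_C$ is surjective or its image is the sphere $S^2_C$ minus two open disks; 2. $(S^1\times S^2)\#(S^1\times S^2)\#(S^1\times S^2)$, if the image of $\pi:\overline{\Sigma}_{C,h}\to S^2_C$ is the sphere $S^2_C$ minus four open disks, where $M\# N$ denotes the connected sum of the manifolds $M$ and $N$.
   Context: On $\mathbb{R}^5$ with coordinates $(\xi,p,m_1,m_2,m_3)$ consider $$\mathcal{H}=\tfrac12\left(m_1^2+m_2^2-2m_1p+2p^2+\xi(-2-2m_2m_3+m_3^2\xi)+m_3^2(1+\xi^2)\right),\qquad \mathcal{C}=m_1^2+m_2^2+m_3^2$$ (the reduced Hamiltonian and the Casimir of the equal-mass two-body problem on $S^2$ with cotangent potential). For $C>0$ and $h\in\mathbb{R}$ put $\Sigma_{C,h}=\{\mathcal{H}=h,\ \mathcal{C}=C\}\subset\mathbb{R}^5$, and let $S^2_C=\{m_1^2+m_2^2+m_3^2=C\}\subset\mathbb{R}^3$, so that $\Sigma_{C,h}\subset\mathbb{R}^2\times S^2_C$ with $(\xi,p)\in\mathbb{R}^2$. Over each point $(m_1,m_2,0)$ of the equator $\{m_3=0\}$ of $S^2_C$,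 the fibre of $\Sigma_{C,h}\to S^2_C$ is the parabola $C-2m_1p+2p^2-2\xi=2h$ in the $(\xi,p)$-plane. The compactification $\overline{\Sigma}_{C,h}$ is obtained by adding one point to each of these parabolas, as follows. Embed the $(\xi,p)$-plane in the unit sphere $S^2=\{x^2+y^2+z^2=1\}$ by inverse stereographic projection from $N=(0,0,1)$, i.e. $\xi=\frac{x}{1-z}$, $p=\frac{y}{1-z}$, and regard $\Sigma_{C,h}$ as a subset of $S^2\times S^2_C$. Then $$\overline{\Sigma}_{C,h}=\Sigma_{C,h}\cup\left(\{N\}\times\{m\in S^2_C: m_3=0\}\right)\subset S^2\times S^2_C$$ with the subspace topology. The map $\pi:\overline{\Sigma}_{C,h}\to S^2_C$ is the restriction of the projection $S^2\times S^2_C\to S^2_C$.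
   Formalization: That one of the cases occurs, and S^1×S^2 when π is surjective, are claimed only if (H,C) has rank 2 along Σ_{C,h}; at critical levels (e.g. C=4, h=2) the space is not a manifold and the claim fails. The removed open disks have disjoint closed disks as closures. *)

theory Defs
  imports "HOL-Analysis.Analysis"
begin

section \<open>The level sets and their compactification\<close>

text \<open>
  A point of \<open>\<real>\<^sup>5\<close> is written \<open>((\<xi>, p), m)\<close> with \<open>m = (m\<^sub>1, m\<^sub>2, m\<^sub>3)\<close>, so that the factor
  \<open>(\<real> \<times> \<real>)\<close> is the \<open>(\<xi>, p)\<close>-plane.
\<close>

definition hamiltonian :: "(real \<times> real) \<times> (real^3) \<Rightarrow> real" where
  "hamiltonian = (\<lambda>((\<xi>, p), m).
     1/2 * ((m$1)^2 + (m$2)^2 - 2 * m$1 * p + 2 * p^2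
            + \<xi> * (- 2 - 2 * m$2 * m$3 + (m$3)^2 * \<xi>) + (m$3)^2 * (1 + \<xi>^2)))"

definition casimir :: "real^3 \<Rightarrow> real" where
  "casimir m = (m$1)^2 + (m$2)^2 + (m$3)^2"

definition casimir_sphere :: "real \<Rightarrow> (real^3) set" where
  "casimir_sphere C = {m. casimir m = C}"

definition level_set :: "real \<Rightarrow> real \<Rightarrow> ((real \<times> real) \<times> (real^3)) set" where
  "level_set C h = {x. hamiltonian x = h \<and> casimir (snd x) = C}"

text \<open>
  At a critical level the closure need not be a manifold: if \<open>C \<ge> 2\<close> and \<open>h = C / 2\<close>, then the
  projection to \<open>S\<^sup>2\<^sub>C\<close> is surjective, but its fibres over the points with \<open>m\<^sub>1 = 0\<close>,
  \<open>m\<^sub>2 m\<^sub>3 = -1\<close> degenerate to single points, at which the level set is a cone over a torus.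
\<close>

definition regular_level :: "real \<Rightarrow> real \<Rightarrow> bool" where
  "regular_level C h \<longleftrightarrow>
     (\<forall>x\<in>level_set C h. \<exists>D.
        ((\<lambda>x. (hamiltonian x, casimir (snd x))) has_derivative D) (at x) \<and> surj D)"

definition north_pole :: "real^3" where
  "north_pole = axis 3 1"

text \<open>Stereographic projection from the north pole; only used away from that point.\<close>

definition stereographic :: "real^3 \<Rightarrow> real \<times> real" where
  "stereographic q = (q$1 / (1 - q$3), q$2 / (1 - q$3))"

definition compactified_level :: "real \<Rightarrow> real \<Rightarrow> ((real^3) \<times> (real^3)) set" where
  "compactified_level C h =
     {(q, m). q \<in> sphere 0 1 - {north_pole} \<and> (stereographic q, m) \<in> level_set C h}
     \<union> {north_pole} \<times> {m \<in> casimir_sphere C. m$3 = 0}"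

text \<open>
  The open disks are the interiors \<open>e i ` ball 0 1\<close> of pairwise disjoint embedded closed disks
  \<open>e i ` cball 0 1\<close> (a continuous injection of a compact disk is an embedding), so that what
  remains is a surface whose boundary consists of \<open>k\<close> disjoint circles.
\<close>

definition minus_open_disks :: "nat \<Rightarrow> (real^3) set \<Rightarrow> (real^3) set \<Rightarrow> bool" where
  "minus_open_disks k S A \<longleftrightarrow>
     (\<exists>e :: nat \<Rightarrow> real^2 \<Rightarrow> real^3.
        (\<forall>i<k. continuous_on (cball 0 1) (e i) \<and> inj_on (e i) (cball 0 1)
               \<and> e i ` cball 0 1 \<subseteq> S)
        \<and> disjoint_family_on (\<lambda>i. e i ` cball 0 1) {..<k}
        \<and> A = S - (\<Union>i<k. e i ` ball 0 1))"


section \<open>Connected sums of 3-manifolds\<close>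

definition disjoint_sum :: "'a topology \<Rightarrow> 'b topology \<Rightarrow> ('a + 'b) topology" where
  "disjoint_sum X Y = topology (\<lambda>U. openin X (Inl -` U) \<and> openin Y (Inr -` U))"

lemma openin_disjoint_sum:
  "openin (disjoint_sum X Y) U \<longleftrightarrow> openin X (Inl -` U) \<and> openin Y (Inr -` U)"
proof -
  have "istopology (\<lambda>U. openin X (Inl -` U) \<and> openin Y (Inr -` U))"
    unfolding istopology_def by (auto simp: vimage_Union)
  then show ?thesis
    by (simp add: disjoint_sum_def)
qed

lemma topspace_disjoint_sum: "topspace (disjoint_sum X Y) = topspace X <+> topspace Y"
proof (rule subset_antisym)
  have "openin (disjoint_sum X Y) (topspace X <+> topspace Y)"
    by (simp add: openin_disjoint_sum vimage_def Plus_def image_iff)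
  then show "topspace X <+> topspace Y \<subseteq> topspace (disjoint_sum X Y)"
    by (rule openin_subset)
  have "openin X (Inl -` topspace (disjoint_sum X Y))" "openin Y (Inr -` topspace (disjoint_sum X Y))"
    using openin_disjoint_sum[of X Y] openin_topspace[of "disjoint_sum X Y"] by blast+
  then have "Inl -` topspace (disjoint_sum X Y) \<subseteq> topspace X"
    "Inr -` topspace (disjoint_sum X Y) \<subseteq> topspace Y"
    by (simp_all add: openin_subset)
  then show "topspace (disjoint_sum X Y) \<subseteq> topspace X <+> topspace Y"
    by (smt (verit) InlI InrI subsetD subsetI sum.exhaust vimageI2)
qed

definition chart3 :: "'a topology \<Rightarrow> (real^3 \<Rightarrow> 'a) \<Rightarrow> bool" where
  "chart3 X \<phi> \<longleftrightarrow> embedding_map euclidean X \<phi> \<and> openin X (range \<phi>)"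

text \<open>
  \<open>Z\<close> is a connected sum of the 3-manifolds \<open>X\<close> and \<open>Y\<close>: the open unit balls of a chart \<open>\<phi>\<close> of \<open>X\<close>
  and of a chart \<open>\<psi>\<close> of \<open>Y\<close> are removed, and the two boundary spheres are identified via
  \<open>\<phi> u \<sim> \<psi> u\<close>. Since the charts are defined on all of \<open>\<real>\<^sup>3\<close>, the removed balls are tame; since any
  homeomorphism of the unit sphere extends radially to \<open>\<real>\<^sup>3\<close> and can be absorbed into \<open>\<psi>\<close>, no
  generality is lost by this gluing map. For oriented connected summands the choice of the charts
  matters only through their orientation behaviour, and not at all if one summand admits an
  orientation-reversing self-homeomorphism, as \<open>S\<^sup>1 \<times> S\<^sup>2\<close> does.
\<close>

definition is_connected_sum :: "'a topology \<Rightarrow> 'b topology \<Rightarrow> 'c topology \<Rightarrow> bool" where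
  "is_connected_sum X Y Z \<longleftrightarrow>
     (\<exists>\<phi> \<psi> q.
        chart3 X \<phi> \<and> chart3 Y \<psi> \<and>
        (let P = disjoint_sum (subtopology X (topspace X - \<phi> ` ball 0 1))
                              (subtopology Y (topspace Y - \<psi> ` ball 0 1));
             G = {(Inl (\<phi> u), Inr (\<psi> u)) | u. u \<in> sphere 0 1}
         in quotient_map P Z q \<and>
            (\<forall>a\<in>topspace P. \<forall>b\<in>topspace P. q a = q b \<longleftrightarrow> (a, b) \<in> Id \<union> G \<union> G\<inverse>)))"

definition S1xS2 :: "((real^2) \<times> (real^3)) topology" where
  "S1xS2 = top_of_set (sphere 0 1 \<times> sphere 0 1)"

end

theory Submission
  imports Defs
begin

text \<open>
  Write \<open>m = (x, y, z)\<close> and \<open>P = 2p - x\<close>, \<open>X = 2z\<^sup>2\<xi> - (1 + yz)\<close>. Completing squares turns the fibre over \<open>m\<close>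
  into \<open>z\<^sup>2P\<^sup>2 + X\<^sup>2 = F(m)\<close> with \<open>F = (1 + yz)\<^sup>2 + x\<^sup>2z\<^sup>2 - (2C - 4h)z\<^sup>2\<close>, so the image of \<open>\<pi>\<close> is \<open>F \<ge> 0\<close>, the
  fibres are circles where \<open>F > 0\<close> and points where \<open>F = 0\<close>. A projective coordinate trivialises the circles
  also across the equator, whence the compactified level is \<open>{(v, m). |v|\<^sup>2 = F(m)}\<close> with \<open>v \<in> \<real>\<^sup>2\<close>. As \<open>F\<close>
  depends only on \<open>u = (y, z)\<close> and \<open>x\<^sup>2 = E(u) = C - |u|\<^sup>2\<close>, this is \<open>{(v, x, u). |v|\<^sup>2 = F(u), x\<^sup>2 = E(u)}\<close>
  over the region \<open>E, F \<ge> 0\<close> of the plane, which is star-shaped around \<open>0\<close>: its boundary is cut into arcs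
  on which \<open>E\<close> and \<open>F\<close> vanish alternately, and the number of arcs determines the topological type.
  On the great circle \<open>x = 0\<close> the condition \<open>F < 0\<close> reads \<open>|f| < \<surd>(2C - 4h)\<close> for a function \<open>f\<close> that is
  unimodal on the upper half, so that there are \<open>0\<close>, \<open>4\<close> or \<open>8\<close> arcs unless the level is critical. Four arcs
  give a square, that is \<open>S\<^sup>1 \<times> S\<^sup>2\<close>. Eight arcs also arise from a strip with three holes; cutting the strip
  between two holes cuts the manifold along a 2-sphere, which exhibits the connected sum.
\<close>

subsection \<open>Quotients of a standard space\<close>

text \<open>No homeomorphism between the manifolds is inverted by hand, which would be awkward where
  circles shrink to points: two spaces are compared as images of one compact space under maps with
  the same fibres, and compactness makes the inverses continuous. The hypotheses concern only the
  image of \<pi>, so the number of arcs has to be recovered from it. The removed disks are the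
  components of the complement, and their number separates the cases 0, 2 and 4. The marginal levels
  show up in two ways. Either the image is the whole sphere although the level is singular, which is
  why regularity is demanded there; or two of four disks touch, and the meeting closures contradict
  disjoint closed disks. Arcs come in antipodal pairs because F is invariant under \<open>m\<close>
  to \<open>-m\<close>. The strip replaces the true region because cutting wants a collar on which
  the manifold is exactly a product of a round sphere and an interval. Its slanted ends are
  themselves the balls that close up a cut, so that a capped strip is again a strip.\<close>

lemma homeomorphic_space_same_fibres:
  fixes q :: "'k::topological_space \<Rightarrow> 'a::metric_space" and q' :: "'k \<Rightarrow> 'b::metric_space"
  assumes K: "compact K" and q: "continuous_on K q" and q': "continuous_on K q'"
    and eq: "\<And>a b. a \<in> K \<Longrightarrow> b \<in> K \<Longrightarrow> q a = q b \<longleftrightarrow> q' a = q' b"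
  shows "top_of_set (q ` K) homeomorphic_space top_of_set (q' ` K)"
proof -
  \<comment> \<open>A continuous surjection from a compact onto a Hausdorff space is closed, hence a
    quotient map, and the other map descends along it. Exchanging \<open>q\<close> and
    \<open>q'\<close> then yields the inverse.\<close>
  have *: "\<exists>g. continuous_map (top_of_set (q ` K)) (top_of_set (q' ` K)) g \<and> (\<forall>x\<in>K. g (q x) = q' x)"
    if q: "continuous_on K q" and q': "continuous_on K q'"
      and eq: "\<And>a b. a \<in> K \<Longrightarrow> b \<in> K \<Longrightarrow> q a = q b \<Longrightarrow> q' a = q' b"
    for q :: "'k \<Rightarrow> 'c::metric_space" and q' :: "'k \<Rightarrow> 'd::metric_space"
  proof -
    have cm: "continuous_map (top_of_set K) (top_of_set (q ` K)) q"
      "continuous_map (top_of_set K) (top_of_set (q' ` K)) q'"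
      using q q' by auto
    have "Hausdorff_space (top_of_set (q ` K))"
      by (rule Hausdorff_space_subtopology[OF Hausdorff_space_euclidean])
    then have "closed_map (top_of_set K) (top_of_set (q ` K)) q"
      using K cm by (intro continuous_imp_closed_map) (auto simp: compact_space_subtopology)
    then have quot: "quotient_map (top_of_set K) (top_of_set (q ` K)) q"
      using cm by (intro continuous_closed_imp_quotient_map) auto
    have compat: "q' x = q' y" if "x \<in> topspace (top_of_set K)" "y \<in> topspace (top_of_set K)" "q x = q y" for x y
      by (rule eq) (use that in auto)
    show ?thesis
    proof (rule quotient_map_lift_exists[OF quot cm(2) compat])
      fix g assume g: "continuous_map (top_of_set (q ` K)) (top_of_set (q' ` K)) g"
        "\<And>x. x \<in> topspace (top_of_set K) \<Longrightarrow> g (q x) = q' x"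
      show ?thesis
        by (intro exI[of _ g] conjI ballI g) simp
    qed
  qed
  obtain g where g: "continuous_map (top_of_set (q ` K)) (top_of_set (q' ` K)) g" "\<forall>x\<in>K. g (q x) = q' x"
    using *[OF q q'] eq by blast
  obtain g' where g': "continuous_map (top_of_set (q' ` K)) (top_of_set (q ` K)) g'" "\<forall>x\<in>K. g' (q' x) = q x"
    using *[OF q' q] eq by blast
  have "homeomorphic_maps (top_of_set (q ` K)) (top_of_set (q' ` K)) g g'"
    using g g' by (auto simp: homeomorphic_maps_def)
  then show ?thesis
    unfolding homeomorphic_space_def by blast
qed

text \<open>
  A point \<open>(e, \<sigma>, \<rho>, t)\<close> of \<open>S\<^sup>1 \<times> S\<^sup>0 \<times> D\<close> has polar coordinates \<open>\<rho>\<close> and \<open>t\<close> in the disc \<open>D\<close>, with \<open>t\<close> normalised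
  so that the boundary circle consists of \<open>n\<close> arcs of length \<open>1\<close>, told apart by the sign of \<open>sin (\<pi>t)\<close>.
  Over the arcs with \<open>sin (\<pi>t) \<le> 0\<close> the factor \<open>S\<^sup>1\<close> is collapsed, over the others \<open>S\<^sup>0\<close>.
\<close>

definition pattern_space :: "nat \<Rightarrow> ((real^2) \<times> real \<times> real \<times> real) set" where
  "pattern_space n = sphere 0 1 \<times> {-1, 1} \<times> {0..1} \<times> {0..real n}"

definition pattern_eq :: "nat \<Rightarrow> (real^2) \<times> real \<times> real \<times> real \<Rightarrow> (real^2) \<times> real \<times> real \<times> real \<Rightarrow> bool" where
  "pattern_eq n = (\<lambda>(e, \<sigma>, \<rho>, t) (e', \<sigma>', \<rho>', t').
     \<rho> = \<rho>' \<and> (\<rho> = 0 \<or> t = t' \<or> {t, t'} = {0, real n}) \<and>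
     (e = e' \<or> \<rho> = 1 \<and> sin (pi * t) \<le> 0) \<and> (\<sigma> = \<sigma>' \<or> \<rho> = 1 \<and> sin (pi * t) \<ge> 0))"

definition realizes :: "nat \<Rightarrow> 'w::metric_space set \<Rightarrow> bool" where
  "realizes n W \<longleftrightarrow> (\<exists>q. continuous_on (pattern_space n) q \<and> q ` pattern_space n = W \<and>
     (\<forall>a\<in>pattern_space n. \<forall>b\<in>pattern_space n. q a = q b \<longleftrightarrow> pattern_eq n a b))"

lemma compact_pattern_space: "compact (pattern_space n)"
  unfolding pattern_space_def by (intro compact_Times) auto

lemma realizes_homeomorphic:
  assumes "realizes n W" "realizes n W'"
  shows "top_of_set W homeomorphic_space top_of_set W'"
proof -
  obtain q where q: "continuous_on (pattern_space n) q" "q ` pattern_space n = W"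
    "\<forall>a\<in>pattern_space n. \<forall>b\<in>pattern_space n. q a = q b \<longleftrightarrow> pattern_eq n a b"
    using assms(1) unfolding realizes_def by blast
  obtain q' where q': "continuous_on (pattern_space n) q'" "q' ` pattern_space n = W'"
    "\<forall>a\<in>pattern_space n. \<forall>b\<in>pattern_space n. q' a = q' b \<longleftrightarrow> pattern_eq n a b"
    using assms(2) unfolding realizes_def by blast
  have "q a = q b \<longleftrightarrow> q' a = q' b" if "a \<in> pattern_space n" "b \<in> pattern_space n" for a b
    using that q(3) q'(3) by blast
  from homeomorphic_space_same_fibres[OF compact_pattern_space q(1) q'(1) this]
  show ?thesis
    by (simp only: q(2) q'(2))
qed

lemma realizes_compact:
  assumes "realizes n W"
  shows "compact W"
  using assms compact_pattern_space compact_continuous_image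
  unfolding realizes_def by blast

text \<open>The gauge \<open>N\<close> supplies polar coordinates
  \<open>u = \<rho> *\<^sub>R \<gamma> t\<close> on a region that only has to be star-shaped. Over
  such a point \<open>v\<close> is \<open>sqrt (F u)\<close> times \<open>e\<close> and
  \<open>x\<close> is \<open>sqrt (E u)\<close> times \<open>\<sigma>\<close>, so the circle or the
  sign is forgotten exactly where the square root vanishes; at the corners, where the sine is 0,
  both are. \<open>J\<close> repackages the coordinates so that the result applies to the space at
  hand.\<close>

lemma realizes_gauge:
  fixes N F E :: "'p::real_normed_vector \<Rightarrow> real" and \<gamma> :: "real \<Rightarrow> 'p"
    and J :: "(real^2) \<times> real \<times> 'p \<Rightarrow> 'w::metric_space"
  assumes N0: "\<And>u. u \<noteq> 0 \<Longrightarrow> N u > 0" and hom: "\<And>r u. r \<ge> 0 \<Longrightarrow> N (r *\<^sub>R u) = r * N u"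
    and \<gamma>c: "continuous_on {0..real n} \<gamma>" and \<gamma>im: "\<gamma> ` {0..real n} = {u. N u = 1}"
    and \<gamma>inj: "\<And>t t'. t \<in> {0..real n} \<Longrightarrow> t' \<in> {0..real n} \<Longrightarrow> \<gamma> t = \<gamma> t' \<longleftrightarrow> t = t' \<or> {t, t'} = {0, real n}"
    and Fc: "continuous_on {u. N u \<le> 1} F" and Ec: "continuous_on {u. N u \<le> 1} E"
    and FE: "\<And>u. N u < 1 \<Longrightarrow> F u > 0 \<and> E u > 0"
    and F: "\<And>t. t \<in> {0..real n} \<Longrightarrow> F (\<gamma> t) \<ge> 0 \<and> (F (\<gamma> t) = 0 \<longleftrightarrow> sin (pi * t) \<le> 0)"
    and E: "\<And>t. t \<in> {0..real n} \<Longrightarrow> E (\<gamma> t) \<ge> 0 \<and> (E (\<gamma> t) = 0 \<longleftrightarrow> sin (pi * t) \<ge> 0)"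
    and Jc: "continuous_on {(v, x, u). N u \<le> 1 \<and> (norm v)\<^sup>2 = F u \<and> x\<^sup>2 = E u} J"
    and Jinj: "inj_on J {(v, x, u). N u \<le> 1 \<and> (norm v)\<^sup>2 = F u \<and> x\<^sup>2 = E u}"
  shows "realizes n (J ` {(v, x, u). N u \<le> 1 \<and> (norm v)\<^sup>2 = F u \<and> x\<^sup>2 = E u})"
proof -
  define V where "V = {(v, x, u). N u \<le> 1 \<and> (norm (v::real^2))\<^sup>2 = F u \<and> x\<^sup>2 = E u}"
  define K where "K = pattern_space n"
  note K_eq = K_def
  note K_def = K_eq[unfolded pattern_space_def]
  define pt where "pt = (\<lambda>\<rho> t. \<rho> *\<^sub>R \<gamma> t)"
  define q where "q = (\<lambda>(e::real^2, \<sigma>, \<rho>, t). (sqrt (F (pt \<rho> t)) *\<^sub>R e, \<sigma> * sqrt (E (pt \<rho> t)), pt \<rho> t))"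
  have N1: "N (\<gamma> t) = 1" if "t \<in> {0..real n}" for t
    using \<gamma>im that by blast
  have Npt: "N (pt \<rho> t) = \<rho>" if "\<rho> \<in> {0..1}" "t \<in> {0..real n}" for \<rho> t
    using hom[of \<rho> "\<gamma> t"] N1[OF that(2)] that by (simp add: pt_def)
  have Fpos: "F (pt \<rho> t) \<ge> 0 \<and> (F (pt \<rho> t) = 0 \<longleftrightarrow> \<rho> = 1 \<and> sin (pi * t) \<le> 0)
      \<and> E (pt \<rho> t) \<ge> 0 \<and> (E (pt \<rho> t) = 0 \<longleftrightarrow> \<rho> = 1 \<and> sin (pi * t) \<ge> 0)"
    if "\<rho> \<in> {0..1}" "t \<in> {0..real n}" for \<rho> t
  proof (cases "\<rho> = 1")
    case True
    then show ?thesis using F[OF that(2)] E[OF that(2)] by (simp add: pt_def)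
  next
    case False
    then have "N (pt \<rho> t) < 1" using Npt[OF that] that by auto
    from FE[OF this] False show ?thesis by auto
  qed
  have pteq: "pt \<rho> t = pt \<rho>' t' \<longleftrightarrow> \<rho> = \<rho>' \<and> (\<rho> = 0 \<or> t = t' \<or> {t, t'} = {0, real n})"
    if "\<rho> \<in> {0..1}" "t \<in> {0..real n}" "\<rho>' \<in> {0..1}" "t' \<in> {0..real n}" for \<rho> t \<rho>' t'
  proof -
    have "\<rho> = \<rho>'" if "pt \<rho> t = pt \<rho>' t'"
      using Npt that \<open>\<rho> \<in> {0..1}\<close> \<open>t \<in> {0..real n}\<close> \<open>\<rho>' \<in> {0..1}\<close> \<open>t' \<in> {0..real n}\<close> by metis
    then show ?thesis
      using \<gamma>inj[OF that(2,4)] by (auto simp: pt_def)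
  qed
  have ptc: "continuous_on K (\<lambda>(e, \<sigma>, \<rho>, t). pt \<rho> t)"
    unfolding pt_def K_def case_prod_beta
    by (intro continuous_intros continuous_on_compose2[OF \<gamma>c]) auto
  have ptP: "(\<lambda>(e::real^2, \<sigma>::real, \<rho>, t). pt \<rho> t) ` K \<subseteq> {u. N u \<le> 1}"
    using Npt by (auto simp: K_def)
  have Fptc: "continuous_on K (\<lambda>(e, \<sigma>, \<rho>, t). F (pt \<rho> t))"
    and Eptc: "continuous_on K (\<lambda>(e, \<sigma>, \<rho>, t). E (pt \<rho> t))"
    using continuous_on_compose2[OF Fc ptc ptP] continuous_on_compose2[OF Ec ptc ptP]
    by (simp_all add: case_prod_beta)
  have qc: "continuous_on K q"
    using ptc Fptc Eptc unfolding q_def case_prod_beta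
    by (intro continuous_intros) auto
  have qV: "q ` K = V"
  proof (intro equalityI subsetI)
    fix w assume "w \<in> q ` K"
    then obtain e \<sigma> \<rho> t where *: "(e, \<sigma>, \<rho>, t) \<in> K" "w = q (e, \<sigma>, \<rho>, t)" by auto
    then have "\<rho> \<in> {0..1}" "t \<in> {0..real n}" "norm e = 1" "\<sigma>\<^sup>2 = 1"
      by (auto simp: K_def)
    then show "w \<in> V"
      using * Fpos Npt by (auto simp: V_def q_def power_mult_distrib)
  next
    fix w assume "w \<in> V"
    then obtain v x u where w: "w = (v, x, u)" "N u \<le> 1" "(norm v)\<^sup>2 = F u" "x\<^sup>2 = E u"
      by (auto simp: V_def)
    \<comment> \<open>The radius is the gauge value. At the origin every angle serves, and 0 is
      taken.\<close>
    have "\<exists>\<rho> t. \<rho> \<in> {0..1} \<and> t \<in> {0..real n} \<and> pt \<rho> t = u"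
    proof (cases "u = 0")
      case True
      then show ?thesis by (intro exI[of _ 0]) (auto simp: pt_def intro!: exI[of _ 0])
    next
      case False
      then have "N ((1 / N u) *\<^sub>R u) = 1" using N0[OF False] hom[of "1 / N u" u] by simp
      then have "(1 / N u) *\<^sub>R u \<in> \<gamma> ` {0..real n}" using \<gamma>im by auto
      then obtain t where "t \<in> {0..real n}" "\<gamma> t = (1 / N u) *\<^sub>R u" by auto
      then show ?thesis using N0[OF False] w(2)
        by (intro exI[of _ "N u"] exI[of _ t]) (auto simp: pt_def)
    qed
    then obtain \<rho> t where pt: "\<rho> \<in> {0..1}" "t \<in> {0..real n}" "pt \<rho> t = u" by blast
    have "\<exists>e. norm e = 1 \<and> sqrt (F u) *\<^sub>R e = v"
    proof (cases "v = 0")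
      case True
      then show ?thesis using w(3) by (auto intro!: exI[of _ "axis 1 1"])
    next
      case False
      then show ?thesis using w(3)[symmetric]
        by (intro exI[of _ "v /\<^sub>R norm v"]) auto
    qed
    moreover have "\<exists>\<sigma>\<in>{-1, 1}. \<sigma> * sqrt (E u) = x"
      using w(4)[symmetric] by (cases "x \<ge> 0") (auto simp: abs_if)
    ultimately obtain e \<sigma> where e: "norm e = 1" "sqrt (F u) *\<^sub>R e = v" "\<sigma> \<in> {-1, 1}" "\<sigma> * sqrt (E u) = x"
      by blast
    have "(e, \<sigma>, \<rho>, t) \<in> K" "q (e, \<sigma>, \<rho>, t) = w"
      using e pt by (simp_all add: K_def q_def w)
    then show "w \<in> q ` K"
      by blast
  qed
  have qeq: "q (e, \<sigma>, \<rho>, t) = q (e', \<sigma>', \<rho>', t') \<longleftrightarrow>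
           \<rho> = \<rho>' \<and> (\<rho> = 0 \<or> t = t' \<or> {t, t'} = {0, real n}) \<and>
           (e = e' \<or> \<rho> = 1 \<and> sin (pi * t) \<le> 0) \<and> (\<sigma> = \<sigma>' \<or> \<rho> = 1 \<and> sin (pi * t) \<ge> 0)"
    if "(e, \<sigma>, \<rho>, t) \<in> K" "(e', \<sigma>', \<rho>', t') \<in> K" for e \<sigma> \<rho> t e' \<sigma>' \<rho>' t'
  proof -
    have mem: "\<rho> \<in> {0..1}" "t \<in> {0..real n}" "\<rho>' \<in> {0..1}" "t' \<in> {0..real n}"
      using that by (auto simp: K_def)
    have "q (e, \<sigma>, \<rho>, t) = q (e', \<sigma>', \<rho>', t') \<longleftrightarrow> pt \<rho> t = pt \<rho>' t' \<and> (e = e' \<or> F (pt \<rho> t) = 0) \<and> (\<sigma> = \<sigma>' \<or> E (pt \<rho> t) = 0)"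
      by (auto simp: q_def)
    then show ?thesis
      using Fpos[OF mem(1,2)] pteq[OF mem] by auto
  qed
  show ?thesis
    unfolding realizes_def V_def[symmetric]
  proof (intro exI[of _ "J \<circ> q"] conjI ballI)
    show "continuous_on (pattern_space n) (J \<circ> q)"
      using qV Jc by (intro continuous_on_compose qc[unfolded K_eq]) (simp add: V_def K_eq)
    show "(J \<circ> q) ` pattern_space n = J ` V"
      by (simp only: image_comp[symmetric] qV[unfolded K_eq])
    fix a b
    assume k: "a \<in> pattern_space n" "b \<in> pattern_space n"
    then have "q a \<in> V" "q b \<in> V" using qV K_eq by blast+
    then have "(J \<circ> q) a = (J \<circ> q) b \<longleftrightarrow> q a = q b"
      using inj_on_eq_iff[OF Jinj[folded V_def]] by simp
    also have "\<dots> \<longleftrightarrow> pattern_eq n a b"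
      using k qeq unfolding K_eq by (cases a; cases b) (simp add: pattern_eq_def)
    finally show "(J \<circ> q) a = (J \<circ> q) b \<longleftrightarrow> pattern_eq n a b" .
  qed
qed

subsection \<open>Connected sums from embedded pieces\<close>

text \<open>A connected sum seen from inside \<open>Z\<close>: the punctured summands are mapped in
  injectively, cover \<open>Z\<close> and overlap exactly in the common boundary sphere. This form
  avoids the disjoint union and can be transported along homeomorphisms of each of the three
  spaces.\<close>

definition sum_data ::
  "'a topology \<Rightarrow> 'b topology \<Rightarrow> 'c topology \<Rightarrow> (real^3 \<Rightarrow> 'a) \<Rightarrow> (real^3 \<Rightarrow> 'b) \<Rightarrow> ('a \<Rightarrow> 'c) \<Rightarrow> ('b \<Rightarrow> 'c) \<Rightarrow> bool" where
  "sum_data X Y Z \<phi> \<psi> i j \<longleftrightarrow>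
     chart3 X \<phi> \<and> chart3 Y \<psi> \<and>
     continuous_map (subtopology X (topspace X - \<phi> ` ball 0 1)) Z i \<and>
     continuous_map (subtopology Y (topspace Y - \<psi> ` ball 0 1)) Z j \<and>
     inj_on i (topspace X - \<phi> ` ball 0 1) \<and> inj_on j (topspace Y - \<psi> ` ball 0 1) \<and>
     i ` (topspace X - \<phi> ` ball 0 1) \<union> j ` (topspace Y - \<psi> ` ball 0 1) = topspace Z \<and>
     (\<forall>a\<in>topspace X - \<phi> ` ball 0 1. \<forall>b\<in>topspace Y - \<psi> ` ball 0 1.
        i a = j b \<longleftrightarrow> (\<exists>u\<in>sphere 0 1. a = \<phi> u \<and> b = \<psi> u))"

lemma openin_imp_vimage_eq: "openin T (g -` U) \<Longrightarrow> {x \<in> topspace T. g x \<in> U} = g -` U"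
  using openin_subset by fastforce

lemma compact_space_disjoint_sum:
  assumes "compact_space X" "compact_space Y"
  shows "compact_space (disjoint_sum X Y)"
proof -
  have "continuous_map X (disjoint_sum X Y) Inl"
    unfolding continuous_map_def topspace_disjoint_sum openin_disjoint_sum
    by (auto simp: openin_imp_vimage_eq)
  moreover have "continuous_map Y (disjoint_sum X Y) Inr"
    unfolding continuous_map_def topspace_disjoint_sum openin_disjoint_sum
    by (auto simp: openin_imp_vimage_eq)
  ultimately have "compactin (disjoint_sum X Y) (Inl ` topspace X \<union> Inr ` topspace Y)"
    using assms by (intro compactin_Un image_compactin) (auto simp: compact_space_def)
  then show ?thesis
    by (simp add: compact_space_def topspace_disjoint_sum Plus_def)
qed

text \<open>A chart is open onto its range, and the range is open in \<open>X\<close>. Closedness is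
  what keeps the punctured summands compact.\<close>

lemma closedin_chart_complement:
  assumes "chart3 X \<phi>"
  shows "closedin X (topspace X - \<phi> ` ball 0 1)"
proof -
  have "homeomorphic_map euclidean (subtopology X (range \<phi>)) \<phi>"
    using assms by (simp add: chart3_def embedding_map_def)
  then have "openin (subtopology X (range \<phi>)) (\<phi> ` ball 0 1)"
    using homeomorphic_imp_open_map open_map_def by (metis open_ball open_openin)
  then have "openin X (\<phi> ` ball 0 1)"
    using assms openin_trans_full unfolding chart3_def by metis
  then show ?thesis by blast
qed

text \<open>The disjoint union of the punctured summands is compact and \<open>Z\<close> is
  Hausdorff, so the continuous surjection assembled from \<open>i\<close> and \<open>j\<close> is
  automatically a quotient map. Injectivity of both leaves only the identifications across the two
  summands.\<close>

lemma is_connected_sumI: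
  assumes XY: "compact_space X" "compact_space Y" and Z: "Hausdorff_space Z"
    and "sum_data X Y Z \<phi> \<psi> i j"
  shows "is_connected_sum X Y Z"
proof -
  define X' where "X' = topspace X - \<phi> ` ball 0 1"
  define Y' where "Y' = topspace Y - \<psi> ` ball 0 1"
  have chart: "chart3 X \<phi>" "chart3 Y \<psi>"
    and i: "continuous_map (subtopology X X') Z i" "inj_on i X'"
    and j: "continuous_map (subtopology Y Y') Z j" "inj_on j Y'"
    and im: "i ` X' \<union> j ` Y' = topspace Z"
    and eq: "\<And>a b. a \<in> X' \<Longrightarrow> b \<in> Y' \<Longrightarrow> i a = j b \<longleftrightarrow> (\<exists>u\<in>sphere 0 1. a = \<phi> u \<and> b = \<psi> u)"
    using assms(4) unfolding sum_data_def X'_def Y'_def by auto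
  define P where "P = disjoint_sum (subtopology X X') (subtopology Y Y')"
  have sub: "X' \<subseteq> topspace X" "Y' \<subseteq> topspace Y" by (auto simp: X'_def Y'_def)
  then have tsub: "topspace (subtopology X X') = X'" "topspace (subtopology Y Y') = Y'" by auto
  have top: "topspace P = X' <+> Y'"
    by (simp only: P_def topspace_disjoint_sum tsub)
  define q where "q = case_sum i j"
  have "closedin X X'" "closedin Y Y'"
    using closedin_chart_complement chart by (auto simp: X'_def Y'_def)
  then have "compact_space P"
    unfolding P_def using XY
    by (intro compact_space_disjoint_sum compact_space_subtopology closedin_compact_space)
  moreover have "continuous_map P Z q"
  proof -
    have "openin P {x \<in> topspace P. q x \<in> U}" if "openin Z U" for U
    proof -
      have "Inl -` {x \<in> topspace P. q x \<in> U} = {x \<in> topspace (subtopology X X'). i x \<in> U}"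
        "Inr -` {x \<in> topspace P. q x \<in> U} = {x \<in> topspace (subtopology Y Y'). j x \<in> U}"
        unfolding tsub by (auto simp: top q_def)
      then show ?thesis
        using that i(1) j(1) unfolding P_def openin_disjoint_sum continuous_map by metis
    qed
    moreover have "q \<in> topspace P \<rightarrow> topspace Z"
      using im by (auto simp: top q_def)
    ultimately show ?thesis by (simp add: continuous_map_def)
  qed
  moreover have "q ` topspace P = topspace Z"
    unfolding im[symmetric] by (simp add: top q_def Plus_def image_Un image_image)
  ultimately have "quotient_map P Z q"
    using Z by (intro continuous_imp_quotient_map)
  moreover have "q a = q b \<longleftrightarrow> (a, b) \<in> Id \<union> {(Inl (\<phi> u), Inr (\<psi> u)) | u. u \<in> sphere 0 1} \<union> {(Inl (\<phi> u), Inr (\<psi> u)) | u. u \<in> sphere 0 1}\<inverse>"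
    if "a \<in> topspace P" "b \<in> topspace P" for a b
  proof (cases a; cases b)
    fix x y assume "a = Inl x" "b = Inl y"
    then show ?thesis using i(2) that by (auto simp: top q_def inj_on_def)
  next
    fix x y assume "a = Inr x" "b = Inr y"
    then show ?thesis using j(2) that by (auto simp: top q_def inj_on_def)
  next
    fix x y assume ab: "a = Inl x" "b = Inr y"
    then have "x \<in> X'" "y \<in> Y'" using that by (auto simp: top)
    from eq[OF this] show ?thesis using ab by (auto simp: q_def)
  next
    fix y x assume ab: "a = Inr y" "b = Inl x"
    then have "x \<in> X'" "y \<in> Y'" using that by (auto simp: top)
    from eq[OF this] show ?thesis using ab by (auto simp: q_def)
  qed
  ultimately show ?thesis
    unfolding is_connected_sum_def Let_def using chart
    unfolding P_def X'_def Y'_def by blast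
qed

lemma chart3_homeomorphic:
  assumes "homeomorphic_map X X' h" "chart3 X \<phi>"
  shows "chart3 X' (h \<circ> \<phi>)"
proof -
  have "embedding_map euclidean X' (h \<circ> \<phi>)"
    using assms embedding_map_compose surjective_embedding_map unfolding chart3_def by blast
  moreover have "openin X' (h ` range \<phi>)"
    using assms homeomorphic_imp_open_map unfolding chart3_def open_map_def by blast
  ultimately show ?thesis
    by (simp add: chart3_def image_comp)
qed

lemma inverse_image_complement:
  assumes "f ` T = T'" "\<And>x. x \<in> T \<Longrightarrow> g (f x) = x" "S \<subseteq> T"
  shows "g ` (T' - f ` S) = T - S"
proof -
  have "inj_on f T"
    using assms(2) by (rule inj_on_inverseI)
  then have "T' - f ` S = f ` (T - S)"
    using assms(1,3) by (simp add: inj_on_image_set_diff[where C = T])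
  then show ?thesis
    using assms(2) by (simp add: image_image)
qed

text \<open>The pieces obtained by cutting are subsets of a strip, while the theorem speaks of
  \<open>S1xS2\<close> and of the compactified level. Conjugating charts and embeddings by the three
  homeomorphisms bridges this gap.\<close>

lemma sum_data_homeomorphic:
  assumes "sum_data X Y Z \<phi> \<psi> i j"
    and "X homeomorphic_space X'" "Y homeomorphic_space Y'" "Z homeomorphic_space Z'"
  shows "\<exists>\<phi> \<psi> i j. sum_data X' Y' Z' \<phi> \<psi> i j"
proof -
  obtain f f' where f: "homeomorphic_maps X X' f f'" using assms(2) unfolding homeomorphic_space_def by blast
  obtain g g' where g: "homeomorphic_maps Y Y' g g'" using assms(3) unfolding homeomorphic_space_def by blast
  obtain k k' where k: "homeomorphic_maps Z Z' k k'" using assms(4) unfolding homeomorphic_space_def by blast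
  define A where "A = topspace X - \<phi> ` ball 0 1"
  define B where "B = topspace Y - \<psi> ` ball 0 1"
  define A' where "A' = topspace X' - (f \<circ> \<phi>) ` ball 0 1"
  define B' where "B' = topspace Y' - (g \<circ> \<psi>) ` ball 0 1"
  have chart: "chart3 X \<phi>" "chart3 Y \<psi>"
    and i: "continuous_map (subtopology X A) Z i" "inj_on i A"
    and j: "continuous_map (subtopology Y B) Z j" "inj_on j B"
    and im: "i ` A \<union> j ` B = topspace Z"
    and eq: "\<And>a b. a \<in> A \<Longrightarrow> b \<in> B \<Longrightarrow> i a = j b \<longleftrightarrow> (\<exists>u\<in>sphere 0 1. a = \<phi> u \<and> b = \<psi> u)"
    using assms(1) unfolding sum_data_def A_def B_def by auto
  have r: "range \<phi> \<subseteq> topspace X" "range \<psi> \<subseteq> topspace Y"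
    using chart openin_subset unfolding chart3_def by blast+
  have f1: "f ` topspace X = topspace X'" "f' ` topspace X' = topspace X"
      "\<And>x. x \<in> topspace X \<Longrightarrow> f' (f x) = x" "\<And>x. x \<in> topspace X' \<Longrightarrow> f (f' x) = x"
    using f unfolding homeomorphic_maps_def continuous_map_def by (auto simp: Pi_iff image_iff) metis+
  have g1: "g ` topspace Y = topspace Y'" "g' ` topspace Y' = topspace Y"
      "\<And>x. x \<in> topspace Y \<Longrightarrow> g' (g x) = x" "\<And>x. x \<in> topspace Y' \<Longrightarrow> g (g' x) = x"
    using g unfolding homeomorphic_maps_def continuous_map_def by (auto simp: Pi_iff image_iff) metis+
  have k1: "k ` topspace Z = topspace Z'" "\<And>x. x \<in> topspace Z \<Longrightarrow> k' (k x) = x"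
    using k unfolding homeomorphic_maps_def continuous_map_def by (auto simp: Pi_iff image_iff) metis+
  have "\<phi> ` ball 0 1 \<subseteq> topspace X" "\<psi> ` ball 0 1 \<subseteq> topspace Y"
    using r by auto
  from inverse_image_complement[OF f1(1,3) this(1)] inverse_image_complement[OF g1(1,3) this(2)]
  have "f' ` A' = A" "g' ` B' = B"
    unfolding A_def A'_def B_def B'_def image_comp[symmetric] by simp_all
  then have A': "f' ` A' = A" "A' \<subseteq> topspace X'" "A \<subseteq> topspace X"
    and B': "g' ` B' = B" "B' \<subseteq> topspace Y'" "B \<subseteq> topspace Y"
    by (simp_all add: A_def A'_def B_def B'_def)
  have iA: "i ` A \<subseteq> topspace Z" "j ` B \<subseteq> topspace Z" using im by auto
  have "sum_data X' Y' Z' (f \<circ> \<phi>) (g \<circ> \<psi>) (k \<circ> i \<circ> f') (k \<circ> j \<circ> g')"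
    unfolding sum_data_def A'_def[symmetric] B'_def[symmetric]
  proof (intro conjI ballI)
    show "chart3 X' (f \<circ> \<phi>)" "chart3 Y' (g \<circ> \<psi>)"
      using chart f g chart3_homeomorphic homeomorphic_map_maps by blast+
    have "continuous_map (subtopology X' A') (subtopology X A) f'"
      using f A' by (auto simp: homeomorphic_maps_def continuous_map_in_subtopology continuous_map_from_subtopology)
    then show "continuous_map (subtopology X' A') Z' (k \<circ> i \<circ> f')"
      using i(1) k unfolding homeomorphic_maps_def by (metis continuous_map_compose)
    have "continuous_map (subtopology Y' B') (subtopology Y B) g'"
      using g B' by (auto simp: homeomorphic_maps_def continuous_map_in_subtopology continuous_map_from_subtopology)
    then show "continuous_map (subtopology Y' B') Z' (k \<circ> j \<circ> g')"
      using j(1) k unfolding homeomorphic_maps_def by (metis continuous_map_compose)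
    have "inj_on k (topspace Z)" "inj_on f' (topspace X')" "inj_on g' (topspace Y')"
      using f1 g1 k1 by (metis inj_on_inverseI)+
    then show "inj_on (k \<circ> i \<circ> f') A'" "inj_on (k \<circ> j \<circ> g') B'"
      using A' B' iA i(2) j(2)
      by (auto intro!: comp_inj_on simp: inj_on_subset image_comp[symmetric])
    show "(k \<circ> i \<circ> f') ` A' \<union> (k \<circ> j \<circ> g') ` B' = topspace Z'"
      using k1(1) im A'(1) B'(1) by (metis image_Un image_comp)
    fix a b assume ab: "a \<in> A'" "b \<in> B'"
    then have ab': "f' a \<in> A" "g' b \<in> B" using A' B' by blast+
    have "(k \<circ> i \<circ> f') a = (k \<circ> j \<circ> g') b \<longleftrightarrow> i (f' a) = j (g' b)"
      using ab' iA \<open>inj_on k (topspace Z)\<close> by (auto simp: inj_on_def)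
    also have "\<dots> \<longleftrightarrow> (\<exists>u\<in>sphere 0 1. f' a = \<phi> u \<and> g' b = \<psi> u)"
      using eq[OF ab'] .
    also have "\<dots> \<longleftrightarrow> (\<exists>u\<in>sphere 0 1. a = (f \<circ> \<phi>) u \<and> b = (g \<circ> \<psi>) u)"
    proof -
      have "a \<in> topspace X'" "b \<in> topspace Y'" using ab A' B' by auto
      then have "f' a = \<phi> u \<longleftrightarrow> a = f (\<phi> u)" "g' b = \<psi> u \<longleftrightarrow> b = g (\<psi> u)" for u
        using f1(3,4) g1(3,4) r by (metis rangeI subsetD)+
      then show ?thesis by simp
    qed
    finally show "(k \<circ> i \<circ> f') a = (k \<circ> j \<circ> g') b \<longleftrightarrow> (\<exists>u\<in>sphere 0 1. a = (f \<circ> \<phi>) u \<and> b = (g \<circ> \<psi>) u)" .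
  qed
  then show ?thesis by blast
qed

text \<open>The theorem prescribes the type that carries the intermediate summand, so a space built
  elsewhere has to be carried over. The pullback topology along a left inverse does this without any
  structure on the target type.\<close>

lemma homeomorphic_copy:
  fixes f :: "'a \<Rightarrow> 'b" and X :: "'a topology"
  assumes "inj f"
  shows "\<exists>M :: 'b topology. X homeomorphic_space M"
proof -
  define g where "g = inv f"
  define M where "M = pullback_topology (f ` topspace X) g X"
  have gf: "g (f x) = x" for x using assms by (simp add: g_def)
  have "continuous_map X M f"
    unfolding M_def by (rule continuous_map_pullback') (auto simp: gf o_def)
  moreover have "continuous_map M X g"
    using continuous_map_pullback[of X X id] by (simp add: M_def)
  ultimately have "homeomorphic_maps X M f g"
    by (auto simp: homeomorphic_maps_def gf M_def topspace_pullback_topology)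
  then show ?thesis unfolding homeomorphic_space_def by blast
qed

subsection \<open>Cutting along a sphere\<close>

lemma norm_square_vec3: "(norm (u :: real^3))\<^sup>2 = (u$1)\<^sup>2 + (u$2)\<^sup>2 + (u$3)\<^sup>2"
  unfolding power2_norm_eq_inner inner_vec_def by (simp add: sum_3 power2_eq_square)

text \<open>A ball attached along the slice \<open>s = c\<close>, drawn as a paraboloid and not as a
  hemisphere because a strip with a slanted end has exactly this set over that end. The sign
  \<open>\<epsilon>\<close> tells on which side the ball bulges out.\<close>

definition cap :: "real \<Rightarrow> real \<Rightarrow> ((real^3) \<times> real \<times> real) set" where
  "cap \<epsilon> c = {(u, s, X). 0 \<le> \<epsilon> * (s - c) \<and> \<epsilon> * (s - c) = 1 - (norm u)\<^sup>2 \<and> X = (u$3)\<^sup>2}"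

definition capped :: "real \<Rightarrow> real \<Rightarrow> ((real^3) \<times> real \<times> real) set \<Rightarrow> ((real^3) \<times> real \<times> real) set" where
  "capped \<epsilon> c \<Omega> = {(u, s, X) \<in> \<Omega>. \<epsilon> * (s - c) \<le> 0} \<union> cap \<epsilon> c"

text \<open>The unit ball parametrises the cap. The exterior is pushed into the collar by
  compressing a radius \<open>m \<ge> 1\<close> to the depth \<open>\<delta> * (1 - 1 / m)\<close>,
  which stays below \<open>\<delta>\<close>. The clamps merge both halves into one continuous
  formula.\<close>

definition cap_chart :: "real \<Rightarrow> real \<Rightarrow> real \<Rightarrow> real^3 \<Rightarrow> (real^3) \<times> real \<times> real" where
  "cap_chart \<epsilon> c \<delta> u = (let m = max 1 (norm u) in
     ((1 / m) *\<^sub>R u, c + \<epsilon> * (1 - (min 1 (norm u))\<^sup>2 - \<delta> * (1 - 1 / m)), (u$3 / m)\<^sup>2))"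

lemma cap_chart_inside: "norm u \<le> 1 \<Longrightarrow> cap_chart \<epsilon> c \<delta> u = (u, c + \<epsilon> * (1 - (norm u)\<^sup>2), (u$3)\<^sup>2)"
  by (simp add: cap_chart_def max_absorb1 min_absorb2)

lemma cap_chart_outside:
  "norm u \<ge> 1 \<Longrightarrow> cap_chart \<epsilon> c \<delta> u = ((1 / norm u) *\<^sub>R u, c - \<epsilon> * \<delta> * (1 - 1 / norm u), (u$3 / norm u)\<^sup>2)"
  by (simp add: cap_chart_def max_absorb2 min_absorb1 Let_def algebra_simps)

lemma continuous_cap_chart: "continuous_on UNIV (cap_chart \<epsilon> c \<delta>)"
proof -
  have "max 1 (norm u) \<noteq> 0" for u :: "real^3" by linarith
  then show ?thesis
    unfolding cap_chart_def Let_def by (intro continuous_intros) auto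
qed

text \<open>By \<open>H\<close> the set is, around the slice, the product of the unit sphere and an
  interval, which provides the collar. The chart covers the cap together with this collar, a set cut
  out by an open condition on \<open>s\<close>, and has an explicit continuous inverse.\<close>

lemma cap_chart:
  assumes \<epsilon>: "\<epsilon> = 1 \<or> \<epsilon> = -1" and \<delta>: "\<delta> > 0"
    and H: "\<And>u s X. \<bar>s - c\<bar> < \<delta> \<Longrightarrow> (u, s, X) \<in> \<Omega> \<longleftrightarrow> norm u = 1 \<and> X = (u$3)\<^sup>2"
  shows "chart3 (top_of_set (capped \<epsilon> c \<Omega>)) (cap_chart \<epsilon> c \<delta>)"
    and "cap_chart \<epsilon> c \<delta> ` ball 0 1 = {(u, s, X) \<in> capped \<epsilon> c \<Omega>. \<epsilon> * (s - c) > 0}"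
proof -
  define \<phi> where "\<phi> = cap_chart \<epsilon> c \<delta>"
  define R where "R = {(u, s, X) \<in> capped \<epsilon> c \<Omega>. \<epsilon> * (s - c) > -\<delta>}"
  \<comment> \<open>The radius is recovered from the depth \<open>t = \<epsilon> * (c - s)\<close>
    as \<open>\<delta> / (\<delta> - t)\<close>. On the cap the depth is clamped to 0, so that
    \<open>u\<close> is left alone.\<close>
  define g where "g = (\<lambda>(u::real^3, s, X::real). (\<delta> / (\<delta> - max 0 (\<epsilon> * (c - s)))) *\<^sub>R u)"
  have \<epsilon>2: "\<epsilon> * (\<epsilon> * t) = t" "\<epsilon> * \<epsilon> = 1" "\<bar>\<epsilon> * t\<bar> = \<bar>t\<bar>" for t using \<epsilon> by auto
  have into: "\<phi> u \<in> R \<and> g (\<phi> u) = u" for u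
  proof (cases "norm u \<le> 1")
    case True
    have "(norm u)\<^sup>2 \<le> 1" using True by (simp add: power_le_one)
    moreover have "\<phi> u = (u, c + \<epsilon> * (1 - (norm u)\<^sup>2), (u$3)\<^sup>2)"
      using cap_chart_inside[OF True] by (simp add: \<phi>_def)
    moreover have "\<epsilon> * (c - (c + \<epsilon> * (1 - (norm u)\<^sup>2))) = (norm u)\<^sup>2 - 1"
      using \<epsilon>2(1)[of "1 - (norm u)\<^sup>2"] by (simp add: algebra_simps)
    ultimately show ?thesis
      using \<epsilon> \<delta> by (elim disjE) (auto simp: R_def capped_def cap_def g_def max_absorb1)
  next
    case False
    define m where "m = norm u"
    have m: "m > 1" using False by (simp add: m_def)
    define t where "t = \<delta> * (1 - 1 / m)"
    have \<phi>u: "\<phi> u = ((1 / m) *\<^sub>R u, c - \<epsilon> * t, (u$3 / m)\<^sup>2)"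
      using cap_chart_outside False by (simp add: \<phi>_def m_def t_def)
    have t: "0 \<le> t" "t < \<delta>"
      using m \<delta> by (auto simp: t_def field_simps)
    have "\<bar>(c - \<epsilon> * t) - c\<bar> < \<delta>"
      using t \<epsilon>2(3)[of t] by simp
    from H[OF this, of "(1 / m) *\<^sub>R u" "(u$3 / m)\<^sup>2"] have "\<phi> u \<in> \<Omega>"
      using m by (simp add: \<phi>u) (simp add: m_def)
    then have "\<phi> u \<in> R"
      using t \<epsilon> unfolding R_def capped_def \<phi>u by auto
    moreover have "g (\<phi> u) = u"
    proof -
      have "\<delta> / (\<delta> - t) = m"
        using m \<delta> by (simp add: t_def field_simps)
      moreover have "max 0 (\<epsilon> * (c - (c - \<epsilon> * t))) = t"
        using t \<epsilon> by auto
      moreover have "m *\<^sub>R ((1 / m) *\<^sub>R u) = u" using m by simp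
      ultimately show ?thesis
        unfolding \<phi>u g_def by (simp only: split_conv)
    qed
    ultimately show ?thesis by simp
  qed
  have onto: "\<phi> (g w) = w" if "w \<in> R" for w
  proof -
    obtain u s X where w: "w = (u, s, X)" by (cases w)
    have gt: "\<epsilon> * (s - c) > -\<delta>" and "(u, s, X) \<in> capped \<epsilon> c \<Omega>" using that by (auto simp: R_def w)
    then consider "(u, s, X) \<in> \<Omega>" "\<epsilon> * (s - c) \<le> 0" | "(u, s, X) \<in> cap \<epsilon> c"
      by (auto simp: capped_def)
    then show ?thesis
    proof cases
      case 1
      define t where "t = \<epsilon> * (c - s)"
      have t: "0 \<le> t" "t < \<delta>" "s = c - \<epsilon> * t" using 1(2) gt \<epsilon>2(1)[of "c - s"] by (auto simp: t_def algebra_simps)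
      have "\<bar>s - c\<bar> < \<delta>" using t \<epsilon>2(3)[of t] by simp
      with H 1 have u: "norm u = 1" "X = (u$3)\<^sup>2" by auto
      define k where "k = \<delta> / (\<delta> - t)"
      have k: "k \<ge> 1" "\<delta> * (1 - 1 / k) = t" using t \<delta> by (simp_all add: k_def field_simps)
      have g: "g w = k *\<^sub>R u" using t(1) by (simp add: g_def w t_def k_def max_absorb2)
      have n: "norm (g w) = k" using k by (simp add: g u)
      have "\<phi> (g w) = ((1 / k) *\<^sub>R g w, c - \<epsilon> * \<delta> * (1 - 1 / k), (g w $ 3 / k)\<^sup>2)"
        using cap_chart_outside[of "g w" \<epsilon> c \<delta>] k(1) by (simp add: \<phi>_def n)
      also have "\<dots> = (u, c - \<epsilon> * t, (u$3)\<^sup>2)"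
        using k(1) by (simp add: g mult.assoc k(2))
      finally show ?thesis using t(3) u by (simp add: w)
    next
      case 2
      then have c: "0 \<le> \<epsilon> * (s - c)" "\<epsilon> * (s - c) = 1 - (norm u)\<^sup>2" "X = (u$3)\<^sup>2" by (auto simp: cap_def)
      then have "(norm u)\<^sup>2 \<le> 1\<^sup>2" by simp
      then have n: "norm u \<le> 1" by (rule power2_le_imp_le) simp
      have "max 0 (\<epsilon> * (c - s)) = 0" using c(1) by (simp add: algebra_simps)
      then have g: "g w = u" using \<delta> by (simp add: g_def w)
      have "c + \<epsilon> * (1 - (norm u)\<^sup>2) = s" using \<epsilon>2(1)[of "s - c"] c(2) by simp
      then show ?thesis unfolding g using cap_chart_inside[OF n] c(3) by (simp add: \<phi>_def w)
    qed
  qed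
  have range: "range \<phi> = R"
    using into onto by (metis (no_types, lifting) image_subset_iff rangeI subsetI subset_antisym)
  have "R = capped \<epsilon> c \<Omega> \<inter> {w. \<epsilon> * (fst (snd w) - c) > -\<delta>}"
    by (auto simp: R_def)
  moreover have "open {w :: (real^3) \<times> real \<times> real. \<epsilon> * (fst (snd w) - c) > -\<delta>}"
    by (intro open_Collect_less continuous_intros)
  ultimately have opn: "openin (top_of_set (capped \<epsilon> c \<Omega>)) R"
    by (auto simp: openin_open)
  have "continuous_on R g"
    unfolding g_def case_prod_beta
    using \<delta> by (intro continuous_intros) (auto simp: R_def algebra_simps max_def)
  moreover have "continuous_map euclidean (top_of_set R) \<phi>"
    using into continuous_cap_chart by (auto simp: continuous_map_in_subtopology \<phi>_def)
  ultimately have "homeomorphic_maps euclidean (top_of_set R) \<phi> g"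
    using into onto by (auto simp: homeomorphic_maps_def)
  then have "homeomorphic_map euclidean (subtopology (top_of_set (capped \<epsilon> c \<Omega>)) (range \<phi>)) \<phi>"
    using opn openin_subset[OF opn] by (auto simp: range homeomorphic_map_maps subtopology_subtopology Int_absorb1)
  then show "chart3 (top_of_set (capped \<epsilon> c \<Omega>)) (cap_chart \<epsilon> c \<delta>)"
    using opn by (simp add: chart3_def embedding_map_def range flip: \<phi>_def)
  show "cap_chart \<epsilon> c \<delta> ` ball 0 1 = {(u, s, X) \<in> capped \<epsilon> c \<Omega>. \<epsilon> * (s - c) > 0}"
  proof (intro equalityI subsetI)
    fix w assume "w \<in> cap_chart \<epsilon> c \<delta> ` ball 0 1"
    then obtain u where u: "norm u < 1" "w = \<phi> u" by (auto simp: \<phi>_def)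
    then have "(norm u)\<^sup>2 < 1" by (simp add: abs_square_less_1)
    then show "w \<in> {(u, s, X) \<in> capped \<epsilon> c \<Omega>. \<epsilon> * (s - c) > 0}"
      using into[of u] cap_chart_inside[of u \<epsilon> c \<delta>] u \<epsilon> by (elim disjE) (auto simp: \<phi>_def R_def)
  next
    fix w assume *: "w \<in> {(u, s, X) \<in> capped \<epsilon> c \<Omega>. \<epsilon> * (s - c) > 0}"
    then obtain u s X where w: "w = (u, s, X)" "(u, s, X) \<in> cap \<epsilon> c" "\<epsilon> * (s - c) > 0"
      by (auto simp: capped_def)
    have "\<epsilon> * (s - c) > -\<delta>" using w(3) \<delta> by linarith
    then have "w \<in> R" using *[unfolded w(1)] unfolding R_def w(1) by blast
    have "max 0 (\<epsilon> * (c - s)) = 0" using w(3) by (simp add: algebra_simps)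
    then have "g w = u" using \<delta> by (simp add: g_def w)
    moreover have "(norm u)\<^sup>2 < 1" using w by (auto simp: cap_def)
    then have "norm u < 1" by (simp add: abs_square_less_1)
    ultimately show "w \<in> cap_chart \<epsilon> c \<delta> ` ball 0 1"
      using onto[OF \<open>w \<in> R\<close>] by (metis \<phi>_def image_eqI mem_ball_0)
  qed
qed

lemma compact_capped:
  assumes "compact \<Omega>" and \<epsilon>: "\<epsilon> = 1 \<or> \<epsilon> = -1"
  shows "compact (capped \<epsilon> c \<Omega>)"
proof -
  \<comment> \<open>Inside the closed unit ball the collar depth does not enter the chart, so its
    value 1 is an arbitrary choice.\<close>
  have "cap \<epsilon> c = cap_chart \<epsilon> c 1 ` cball 0 1"
  proof (intro equalityI subsetI)
    fix w assume "w \<in> cap \<epsilon> c"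
    then obtain u s X where w: "w = (u, s, X)" "0 \<le> \<epsilon> * (s - c)" "\<epsilon> * (s - c) = 1 - (norm u)\<^sup>2" "X = (u$3)\<^sup>2"
      by (auto simp: cap_def)
    then have "(norm u)\<^sup>2 \<le> 1\<^sup>2" by simp
    then have n: "norm u \<le> 1" by (rule power2_le_imp_le) simp
    moreover have "c + \<epsilon> * (1 - (norm u)\<^sup>2) = s" using \<epsilon> w(3) by auto
    ultimately show "w \<in> cap_chart \<epsilon> c 1 ` cball 0 1"
      using cap_chart_inside[OF n] w by (metis image_eqI mem_cball_0)
  next
    fix w assume "w \<in> cap_chart \<epsilon> c 1 ` cball 0 1"
    then obtain u where u: "norm u \<le> 1" "w = cap_chart \<epsilon> c 1 u" by auto
    then have "(norm u)\<^sup>2 \<le> 1" by (simp add: power_le_one)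
    then show "w \<in> cap \<epsilon> c"
      using u \<epsilon> by (auto simp: cap_def cap_chart_inside)
  qed
  then have "compact (cap \<epsilon> c)"
    using continuous_cap_chart continuous_on_subset by (metis compact_cball compact_continuous_image subset_UNIV)
  moreover have "capped \<epsilon> c \<Omega> = (\<Omega> \<inter> {w. \<epsilon> * (fst (snd w) - c) \<le> 0}) \<union> cap \<epsilon> c"
    by (auto simp: capped_def)
  moreover have "closed {w :: (real^3) \<times> real \<times> real. \<epsilon> * (fst (snd w) - c) \<le> 0}"
    by (intro closed_Collect_le continuous_intros)
  ultimately show ?thesis
    using assms(1) by (simp add: compact_Int_closed compact_Un)
qed

text \<open>Removing the open caps leaves the parts \<open>s \<le> c\<close> and
  \<open>s \<ge> c\<close>. Both charts send a unit vector to the same point of the slice, and by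
  \<open>H\<close> these points are the whole slice, so the gluing is the union inside the original
  set.\<close>

lemma capped_sum_data:
  assumes \<delta>: "\<delta> > 0"
    and H: "\<And>u s X. \<bar>s - c\<bar> < \<delta> \<Longrightarrow> (u, s, X) \<in> \<Omega> \<longleftrightarrow> norm u = 1 \<and> X = (u$3)\<^sup>2"
  shows "\<exists>\<phi> \<psi> i j. sum_data (top_of_set (capped 1 c \<Omega>)) (top_of_set (capped (-1) c \<Omega>)) (top_of_set \<Omega>) \<phi> \<psi> i j"
proof -
  define L where "L = {(u, s, X) \<in> \<Omega>. s \<le> c}"
  define R where "R = {(u, s, X) \<in> \<Omega>. s \<ge> c}"
  have H': "(u, c, X) \<in> \<Omega> \<longleftrightarrow> norm u = 1 \<and> X = (u$3)\<^sup>2" for u X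
    using H[of c] \<delta> by simp
  have on_cap: "(u, s, X) \<in> \<Omega>" if "(u, s, X) \<in> cap \<epsilon> c" "s = c" for u s X \<epsilon>
    using that norm_ge_zero[of u] by (auto simp: cap_def H' power2_eq_1_iff)
  have ball: "cap_chart 1 c \<delta> ` ball 0 1 = {(u, s, X) \<in> capped 1 c \<Omega>. 1 * (s - c) > 0}"
    "cap_chart (-1) c \<delta> ` ball 0 1 = {(u, s, X) \<in> capped (-1) c \<Omega>. -1 * (s - c) > 0}"
    by (rule cap_chart(2)[OF _ \<delta> H]; simp)+
  have L: "capped 1 c \<Omega> - cap_chart 1 c \<delta> ` ball 0 1 = L"
    unfolding ball(1) using on_cap by (auto simp: capped_def L_def cap_def)
  have R: "capped (-1) c \<Omega> - cap_chart (-1) c \<delta> ` ball 0 1 = R"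
    unfolding ball(2) using on_cap by (auto simp: capped_def R_def cap_def)
  have sub: "L \<subseteq> capped 1 c \<Omega>" "R \<subseteq> capped (-1) c \<Omega>" "L \<subseteq> \<Omega>" "R \<subseteq> \<Omega>"
    by (auto simp: L_def R_def capped_def)
  have "sum_data (top_of_set (capped 1 c \<Omega>)) (top_of_set (capped (-1) c \<Omega>)) (top_of_set \<Omega>)
          (cap_chart 1 c \<delta>) (cap_chart (-1) c \<delta>) id id"
    unfolding sum_data_def topspace_euclidean_subtopology L R
  proof (intro conjI ballI)
    show "chart3 (top_of_set (capped 1 c \<Omega>)) (cap_chart 1 c \<delta>)"
      "chart3 (top_of_set (capped (-1) c \<Omega>)) (cap_chart (-1) c \<delta>)"
      by (rule cap_chart(1)[OF _ \<delta> H]; simp)+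
    show "continuous_map (subtopology (top_of_set (capped 1 c \<Omega>)) L) (top_of_set \<Omega>) id"
      "continuous_map (subtopology (top_of_set (capped (-1) c \<Omega>)) R) (top_of_set \<Omega>) id"
      using sub by (auto simp: subtopology_subtopology Int_absorb1)
    show "id ` L \<union> id ` R = \<Omega>" by (auto simp: L_def R_def)
    fix a b assume ab: "a \<in> L" "b \<in> R"
    show "id a = id b \<longleftrightarrow> (\<exists>u\<in>sphere 0 1. a = cap_chart 1 c \<delta> u \<and> b = cap_chart (-1) c \<delta> u)" (is "_ \<longleftrightarrow> ?r")
    proof
      assume "id a = id b"
      then obtain u X where "a = (u, c, X)" "b = a" "a \<in> \<Omega>" using ab by (auto simp: L_def R_def)
      then show ?r using H' by (intro bexI[of _ u]) (auto simp: cap_chart_inside)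
    next
      assume ?r
      then show "id a = id b" by (auto simp: cap_chart_inside)
    qed
  qed auto
  then show ?thesis by blast
qed

text \<open>
  Over a strip with base coordinate \<open>s\<close> and height \<open>X\<close>, the two functions \<open>u\<^sub>1\<^sup>2 + u\<^sub>2\<^sup>2\<close> and \<open>u\<^sub>3\<^sup>2\<close> vanish on
  complementary parts of the boundary: the first on the slanted top and where \<open>\<eta> \<le> 0\<close> on the bottom (a hole),
  the second where \<open>\<eta> \<ge> 0\<close> on the bottom. Where \<open>\<eta> = 1\<close> and the top is flat, the slices are unit spheres.
\<close>

definition trapezoid :: "real \<Rightarrow> real \<Rightarrow> real \<Rightarrow> real" where
  "trapezoid a b s = min 1 (min (s - a + 1) (b + 1 - s))"

definition handlebody :: "real \<Rightarrow> real \<Rightarrow> (real \<Rightarrow> real) \<Rightarrow> ((real^3) \<times> real \<times> real) set" where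
  "handlebody a b \<eta> = {(u, s, X). 0 \<le> X \<and> X \<le> trapezoid a b s \<and>
     (u$1)\<^sup>2 + (u$2)\<^sup>2 = (trapezoid a b s - X) * min 1 (X + max 0 (\<eta> s)) \<and> (u$3)\<^sup>2 = X + max 0 (- \<eta> s)}"

text \<open>Beyond \<open>c\<close> the new strip has a slanted roof and profile 1. There its
  equations amount to \<open>|u|^2 = 1 - |s - c|\<close> and \<open>X = (u$3)^2\<close>, which
  describe the cap. Capping therefore just shortens the strip.\<close>

lemma capped_handlebody:
  assumes "a \<le> c" "c \<le> b" "\<eta> c = 1"
  shows "\<lbrakk>\<And>s. s \<le> c \<Longrightarrow> \<eta>' s = \<eta> s; \<And>s. s \<ge> c \<Longrightarrow> \<eta>' s = 1\<rbrakk> \<Longrightarrow> capped 1 c (handlebody a b \<eta>) = handlebody a c \<eta>'"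
    and "\<lbrakk>\<And>s. s \<ge> c \<Longrightarrow> \<eta>' s = \<eta> s; \<And>s. s \<le> c \<Longrightarrow> \<eta>' s = 1\<rbrakk> \<Longrightarrow> capped (-1) c (handlebody a b \<eta>) = handlebody c b \<eta>'"
proof -
  \<comment> \<open>The cut-off at 1 in \<open>handlebody\<close> makes the factor exactly 1
    wherever the profile is 1; this exactness lets the slices be round and the ends agree with the
    caps.\<close>
  have m: "min 1 (X + max 0 1) = (1::real)" if "X \<ge> 0" for X using that by simp
  show "capped 1 c (handlebody a b \<eta>) = handlebody a c \<eta>'"
    if e: "\<And>s. s \<le> c \<Longrightarrow> \<eta>' s = \<eta> s" "\<And>s. s \<ge> c \<Longrightarrow> \<eta>' s = 1"
  proof (intro equalityI subsetI; clarify)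
    fix u s X assume "(u, s, X) \<in> capped 1 c (handlebody a b \<eta>)"
    then consider "(u, s, X) \<in> handlebody a b \<eta>" "s \<le> c" | "(u, s, X) \<in> cap 1 c"
      by (auto simp: capped_def)
    then show "(u, s, X) \<in> handlebody a c \<eta>'"
    proof cases
      case 1
      then have "trapezoid a c s = trapezoid a b s" using assms by (auto simp: trapezoid_def)
      then show ?thesis using 1 e by (simp add: handlebody_def)
    next
      case 2
      then have "trapezoid a c s = c + 1 - s" "s \<ge> c" using assms by (auto simp: trapezoid_def cap_def)
      moreover have "s - c = 1 - ((u$1)\<^sup>2 + (u$2)\<^sup>2 + (u$3)\<^sup>2)"
        using 2 by (simp add: cap_def norm_square_vec3)
      then have "(u$3)\<^sup>2 \<le> c + 1 - s"
        using zero_le_power2[of "u$1"] zero_le_power2[of "u$2"] by linarith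
      ultimately show ?thesis using 2 e(2)[of s]
        by (auto simp: handlebody_def cap_def norm_square_vec3 m)
    qed
  next
    fix u s X assume *: "(u, s, X) \<in> handlebody a c \<eta>'"
    show "(u, s, X) \<in> capped 1 c (handlebody a b \<eta>)"
    proof (cases "s \<le> c")
      case True
      then have "trapezoid a c s = trapezoid a b s" using assms by (auto simp: trapezoid_def)
      then show ?thesis using * e True by (simp add: handlebody_def capped_def)
    next
      case False
      then have "trapezoid a c s = c + 1 - s" using assms by (auto simp: trapezoid_def)
      then show ?thesis using * e(2)[of s] False
        by (auto simp: handlebody_def cap_def capped_def norm_square_vec3 m)
    qed
  qed
  show "capped (-1) c (handlebody a b \<eta>) = handlebody c b \<eta>'"
    if e: "\<And>s. s \<ge> c \<Longrightarrow> \<eta>' s = \<eta> s" "\<And>s. s \<le> c \<Longrightarrow> \<eta>' s = 1"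
  proof (intro equalityI subsetI; clarify)
    fix u s X assume "(u, s, X) \<in> capped (-1) c (handlebody a b \<eta>)"
    then consider "(u, s, X) \<in> handlebody a b \<eta>" "s \<ge> c" | "(u, s, X) \<in> cap (-1) c"
      by (auto simp: capped_def)
    then show "(u, s, X) \<in> handlebody c b \<eta>'"
    proof cases
      case 1
      then have "trapezoid c b s = trapezoid a b s" using assms by (auto simp: trapezoid_def)
      then show ?thesis using 1 e by (simp add: handlebody_def)
    next
      case 2
      then have "trapezoid c b s = s - c + 1" "s \<le> c" using assms by (auto simp: trapezoid_def cap_def)
      moreover have "c - s = 1 - ((u$1)\<^sup>2 + (u$2)\<^sup>2 + (u$3)\<^sup>2)"
        using 2 by (simp add: cap_def norm_square_vec3)
      then have "(u$3)\<^sup>2 \<le> s - c + 1"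
        using zero_le_power2[of "u$1"] zero_le_power2[of "u$2"] by linarith
      ultimately show ?thesis using 2 e(2)[of s]
        by (auto simp: handlebody_def cap_def norm_square_vec3 m)
    qed
  next
    fix u s X assume *: "(u, s, X) \<in> handlebody c b \<eta>'"
    show "(u, s, X) \<in> capped (-1) c (handlebody a b \<eta>)"
    proof (cases "s \<ge> c")
      case True
      then have "trapezoid c b s = trapezoid a b s" using assms by (auto simp: trapezoid_def)
      then show ?thesis using * e True by (simp add: handlebody_def capped_def)
    next
      case False
      then have "trapezoid c b s = s - c + 1" using assms by (auto simp: trapezoid_def)
      then show ?thesis using * e(2)[of s] False
        by (auto simp: handlebody_def cap_def capped_def norm_square_vec3 m)
    qed
  qed
qed

lemma handlebody_neck:
  assumes "\<bar>s - c\<bar> < \<delta>" "a \<le> c - \<delta>" "c + \<delta> \<le> b" "\<eta> s = 1"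
  shows "(u, s, X) \<in> handlebody a b \<eta> \<longleftrightarrow> norm u = 1 \<and> X = (u$3)\<^sup>2"
proof -
  have t: "trapezoid a b s = 1" using assms by (auto simp: trapezoid_def)
  have n: "norm u = 1 \<longleftrightarrow> (u$1)\<^sup>2 + (u$2)\<^sup>2 + (u$3)\<^sup>2 = 1"
    using norm_square_vec3[of u] by (smt (verit) norm_ge_zero one_power2 power2_eq_iff_nonneg)
  have m: "min 1 (X + 1) = 1" if "X \<ge> 0" using that by simp
  show ?thesis
    unfolding n handlebody_def using assms(4) t m
    by (auto simp: min_def add_nonneg_nonneg) (smt (verit) zero_le_power2)+
qed

section \<open>Piecewise linear parametrisations with prescribed values at the integers\<close>

primrec pl :: "(nat \<Rightarrow> real) \<Rightarrow> nat \<Rightarrow> real \<Rightarrow> real" where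
  "pl \<alpha> 0 t = \<alpha> 0"
| "pl \<alpha> (Suc n) t = pl \<alpha> n t + (\<alpha> (Suc n) - \<alpha> n) * max 0 (min 1 (t - real n))"

text \<open>The interpolation is a sum of clamped ramps, constant outside \<open>[0, n]\<close>, so
  continuity needs no pasting at the breakpoints.\<close>

lemma continuous_on_pl: "continuous_on A (pl \<alpha> n)"
  by (induction n) (auto intro!: continuous_intros)

lemma pl_right: "t \<ge> real n \<Longrightarrow> pl \<alpha> n t = \<alpha> n"
  by (induction n) (auto simp: max_def min_def)

lemma pl_left: "t \<le> real n \<Longrightarrow> pl \<alpha> (Suc n) t = pl \<alpha> n t"
  by (simp add: max_def min_def)

lemma pl_affine:
  "i < n \<Longrightarrow> 0 \<le> r \<Longrightarrow> r \<le> 1 \<Longrightarrow> pl \<alpha> n (real i + r) = \<alpha> i + r * (\<alpha> (Suc i) - \<alpha> i)"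
proof (induction n)
  case (Suc n)
  show ?case
  proof (cases "i = n")
    case True
    then show ?thesis using Suc.prems pl_right[of n "real n + r" \<alpha>] by (simp add: min_absorb2 mult.commute)
  next
    case False
    then have "i < n" "real i + r \<le> real n" using Suc.prems by auto
    then show ?thesis using pl_left Suc by metis
  qed
qed simp

lemma pl_at: "i \<le> n \<Longrightarrow> pl \<alpha> n (real i) = \<alpha> i"
  using pl_affine[of i n 0 \<alpha>] pl_right[of n "real n" \<alpha>] by (cases "i = n") auto

lemma pl_strict_mono:
  "(\<And>i. i < n \<Longrightarrow> \<alpha> i < \<alpha> (Suc i)) \<Longrightarrow> 0 \<le> s \<Longrightarrow> s < t \<Longrightarrow> t \<le> real n \<Longrightarrow> pl \<alpha> n s < pl \<alpha> n t"
proof (induction n arbitrary: s t)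
  case (Suc n)
  have *: "\<alpha> n < \<alpha> (Suc n)" using Suc.prems(1) by simp
  consider "t \<le> real n" | "s \<ge> real n" | "s < real n" "real n < t" by linarith
  then show ?case
  proof cases
    case 1
    then show ?thesis using Suc.IH[of s t] Suc.prems pl_left[of t n \<alpha>] pl_left[of s n \<alpha>] by fastforce
  next
    case 2
    then show ?thesis using Suc.prems * by (simp add: pl_right)
  next
    case 3
    have "pl \<alpha> (Suc n) s = pl \<alpha> n s" using 3 pl_left by simp
    also have "\<dots> < pl \<alpha> n (real n)" using Suc.IH[of s "real n"] Suc.prems 3 by fastforce
    also have "\<dots> = \<alpha> n" by (simp add: pl_at)
    also have "\<dots> \<le> pl \<alpha> (Suc n) t" using 3 * by (simp add: pl_right)
    finally show ?thesis .
  qed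
qed simp

lemma pl_inj:
  assumes "\<And>i. i < n \<Longrightarrow> \<alpha> i < \<alpha> (Suc i)" "s \<in> {0..real n}" "t \<in> {0..real n}" "pl \<alpha> n s = pl \<alpha> n t"
  shows "s = t"
  using pl_strict_mono[of n \<alpha> s t] pl_strict_mono[of n \<alpha> t s] assms by (metis atLeastAtMost_iff less_irrefl linorder_neqE_linordered_idom)

lemma pl_image:
  assumes "\<And>i. i < n \<Longrightarrow> \<alpha> i < \<alpha> (Suc i)"
  shows "pl \<alpha> n ` {0..real n} = {\<alpha> 0..\<alpha> n}"
proof (intro equalityI subsetI)
  have e: "pl \<alpha> n 0 = \<alpha> 0" "pl \<alpha> n (real n) = \<alpha> n" using pl_at[of 0 n \<alpha>] pl_at[of n n \<alpha>] by auto
  fix x assume "x \<in> pl \<alpha> n ` {0..real n}"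
  then obtain t where "t \<in> {0..real n}" "x = pl \<alpha> n t" by auto
  then show "x \<in> {\<alpha> 0..\<alpha> n}"
    using pl_strict_mono[where n = n and \<alpha> = \<alpha>, OF assms, of 0 t] pl_strict_mono[where n = n and \<alpha> = \<alpha>, OF assms, of t "real n"] e
    by (cases "t = 0"; cases "t = real n") auto
next
  have e: "pl \<alpha> n 0 = \<alpha> 0" "pl \<alpha> n (real n) = \<alpha> n" using pl_at[of 0 n \<alpha>] pl_at[of n n \<alpha>] by auto
  fix x assume "x \<in> {\<alpha> 0..\<alpha> n}"
  then show "x \<in> pl \<alpha> n ` {0..real n}"
    using IVT'[of "pl \<alpha> n" 0 x "real n"] continuous_on_pl e by auto
qed

text \<open>Integers are the corners of the boundary circle, where \<open>sin (pi * t)\<close>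
  vanishes and both coordinates collapse; inside an arc its sign is constant and only one of them
  does.\<close>

lemma unit_interval_cases:
  assumes "t \<in> {0..real n}"
  obtains i where "i \<le> n" "t = real i" | i r where "i < n" "0 < r" "r < 1" "t = real i + r"
proof (cases "t = of_int \<lfloor>t\<rfloor>")
  case True
  then have "t = real (nat \<lfloor>t\<rfloor>)" using assms by auto
  then show ?thesis using assms that(1)[of "nat \<lfloor>t\<rfloor>"] by auto
next
  case False
  have "t \<ge> 0" using assms by simp
  then have f: "real (nat \<lfloor>t\<rfloor>) = of_int \<lfloor>t\<rfloor>" by simp
  have "of_int \<lfloor>t\<rfloor> \<le> t" "t < of_int \<lfloor>t\<rfloor> + 1" by linarith+
  moreover from this False have "of_int \<lfloor>t\<rfloor> < t" by linarith
  ultimately have "real (nat \<lfloor>t\<rfloor>) < real n" using assms f by auto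
  then have "nat \<lfloor>t\<rfloor> < n" by simp
  then show ?thesis
    using that(2)[of "nat \<lfloor>t\<rfloor>" "t - of_int \<lfloor>t\<rfloor>"] f False \<open>of_int \<lfloor>t\<rfloor> \<le> t\<close> \<open>t < of_int \<lfloor>t\<rfloor> + 1\<close> by auto
qed

lemma sin_pi_unit_interval:
  assumes "0 < r" "r < 1"
  shows "even i \<Longrightarrow> sin (pi * (real i + r)) > 0" "odd i \<Longrightarrow> sin (pi * (real i + r)) < 0"
proof -
  have "sin (pi * (real i + r)) = (-1) ^ i * sin (pi * r)"
    using sin_npi[of i] cos_npi[of i] by (simp add: distrib_left sin_add mult.commute)
  moreover have "sin (pi * r) > 0" using assms by (intro sin_gt_zero) auto
  ultimately show "even i \<Longrightarrow> sin (pi * (real i + r)) > 0" "odd i \<Longrightarrow> sin (pi * (real i + r)) < 0"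
    by auto
qed

lemma sin_pi_nat: "sin (pi * real i) = 0"
  using sin_npi[of i] by (simp add: mult.commute)

section \<open>Vectors by coordinates, and the product of spheres over a square\<close>

lemma norm_square_vec2: "(norm (u :: real^2))\<^sup>2 = (u$1)\<^sup>2 + (u$2)\<^sup>2"
  unfolding power2_norm_eq_inner inner_vec_def by (simp add: sum_2 power2_eq_square)

lemma continuous_on_vec2:
  fixes A :: "'a::t2_space set"
  assumes "continuous_on A f" "continuous_on A g"
  shows "continuous_on A (\<lambda>x. vector [f x, g x] :: real^2)"
  unfolding continuous_on_componentwise[of A "\<lambda>x. vector [f x, g x] :: real^2"]
  using assms by (auto simp: Basis_vec_def inner_axis forall_2)

lemma continuous_on_vec3:
  fixes A :: "'a::t2_space set"
  assumes "continuous_on A f" "continuous_on A g" "continuous_on A h"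
  shows "continuous_on A (\<lambda>x. vector [f x, g x, h x] :: real^3)"
  unfolding continuous_on_componentwise[of A "\<lambda>x. vector [f x, g x, h x] :: real^3"]
  using assms by (auto simp: Basis_vec_def inner_axis forall_3)

text \<open>With \<open>(x, s)\<close> on the circle and \<open>(v, t)\<close> on the 2-sphere one
  has \<open>x^2 = 1 - s^2\<close> and \<open>|v|^2 = 1 - t^2\<close>. So the base is the square of
  points \<open>(s, t)\<close> with maximum norm at most 1, and its four sides are alternately of
  the kind \<open>|s| = 1\<close>, where \<open>x\<close> vanishes, and \<open>|t| = 1\<close>,
  where \<open>v\<close> vanishes.\<close>

lemma realizes_S1xS2:
  "realizes 4 ((sphere 0 1 :: (real^2) set) \<times> (sphere 0 1 :: (real^3) set))"
proof -
  \<comment> \<open>A circuit of the boundary of the square, one side per unit of time, starting at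
    \<open>(1, -1)\<close>: right side upwards, top, left side, bottom. Arcs with even number thus
    lie on \<open>|s| = 1\<close>.\<close>
  define A where "A = (\<lambda>t::real. max (-1) (min 1 (2 * \<bar>t - 5/2\<bar> - 2)))"
  define B where "B = (\<lambda>t::real. max (-1) (min 1 (2 - 2 * \<bar>t - 3/2\<bar>)))"
  define N where "N = (\<lambda>(s::real, t::real). max \<bar>s\<bar> \<bar>t\<bar>)"
  define F where "F = (\<lambda>(s::real, t::real). 1 - t\<^sup>2)"
  define E where "E = (\<lambda>(s::real, t::real). 1 - s\<^sup>2)"
  define J where "J = (\<lambda>(v::real^2, x::real, s::real, t::real). (vector [x, s] :: real^2, vector [v$1, v$2, t] :: real^3))"
  define V where "V = {(v, x, u). N u \<le> 1 \<and> (norm (v::real^2))\<^sup>2 = F u \<and> x\<^sup>2 = E u}"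
  have AB: "\<bar>A t\<bar> \<le> 1 \<and> \<bar>B t\<bar> \<le> 1" for t by (auto simp: A_def B_def)
  have sq: "1 - c\<^sup>2 \<ge> 0 \<and> (1 - c\<^sup>2 = 0 \<longleftrightarrow> \<bar>c\<bar> = 1)" if "\<bar>c\<bar> \<le> 1" for c :: real
    using that abs_square_le_1[of c] abs_square_eq_1[of c] by (auto simp: power2_eq_1_iff)
  have sgn: "(\<bar>B t\<bar> = 1 \<longleftrightarrow> sin (pi * t) \<le> 0) \<and> (\<bar>A t\<bar> = 1 \<longleftrightarrow> sin (pi * t) \<ge> 0)"
    if "t \<in> {0..real 4}" for t
    using that
  proof (cases rule: unit_interval_cases)
    case (1 i)
    then have "i = 0 \<or> i = 1 \<or> i = 2 \<or> i = 3 \<or> i = 4" by auto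
    then have "\<bar>A t\<bar> = 1 \<and> \<bar>B t\<bar> = 1" using 1 by (auto simp: A_def B_def)
    then show ?thesis using 1 sin_pi_nat[of i] by simp
  next
    case (2 i r)
    then consider "i = 0" | "i = 1" | "i = 2" | "i = 3" by linarith
    then show ?thesis
    proof cases
      case 1
      then have "\<bar>A t\<bar> = 1 \<and> \<bar>B t\<bar> \<noteq> 1" using 2 by (auto simp: A_def B_def max_def min_def abs_if)
      then show ?thesis using sin_pi_unit_interval(1)[of r i] 2 1 by simp
    next
      case 2
      then have "\<bar>A t\<bar> \<noteq> 1 \<and> \<bar>B t\<bar> = 1" using \<open>t = real i + r\<close> \<open>0 < r\<close> \<open>r < 1\<close> by (auto simp: A_def B_def max_def min_def abs_if)
      then show ?thesis using sin_pi_unit_interval(2)[of r i] \<open>t = real i + r\<close> \<open>0 < r\<close> \<open>r < 1\<close> 2 by simp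
    next
      case 3
      then have "\<bar>A t\<bar> = 1 \<and> \<bar>B t\<bar> \<noteq> 1" using 2 by (auto simp: A_def B_def max_def min_def abs_if)
      then show ?thesis using sin_pi_unit_interval(1)[of r i] 2 3 by simp
    next
      case 4
      then have "\<bar>A t\<bar> \<noteq> 1 \<and> \<bar>B t\<bar> = 1" using 2 by (auto simp: A_def B_def max_def min_def abs_if)
      then show ?thesis using sin_pi_unit_interval(2)[of r i] 2 4 by simp
    qed
  qed
  have N1: "max \<bar>A t\<bar> \<bar>B t\<bar> = 1" if "t \<in> {0..real 4}" for t
    using sgn[OF that] AB[of t] by linarith
  have onto: "\<exists>r\<in>{0..real 4}. A r = s \<and> B r = t" if "max \<bar>s\<bar> \<bar>t\<bar> = 1" for s t
  proof -
    have st: "-1 \<le> s" "s \<le> 1" "-1 \<le> t" "t \<le> 1" using that by (auto simp: abs_le_iff)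
    have "\<bar>s\<bar> = 1 \<or> \<bar>t\<bar> = 1" using that by linarith
    then have "s = 1 \<or> t = 1 \<or> s = -1 \<or> t = -1" by linarith
    \<comment> \<open>The witnesses below invert the circuit on the respective side.\<close>
    then consider "s = 1" | "t = 1" | "s = -1" | "t = -1" by blast
    then show ?thesis
    proof cases
      case 1 then show ?thesis using st by (intro bexI[of _ "(t+1)/2"]) (auto simp: A_def B_def max_def min_def abs_if add_divide_distrib)
    next
      case 2 then show ?thesis using st by (intro bexI[of _ "(3-s)/2"]) (auto simp: A_def B_def max_def min_def abs_if diff_divide_distrib)
    next
      case 3 then show ?thesis using st by (intro bexI[of _ "(5-t)/2"]) (auto simp: A_def B_def max_def min_def abs_if diff_divide_distrib)
    next
      case 4 then show ?thesis using st by (intro bexI[of _ "(7+s)/2"]) (auto simp: A_def B_def max_def min_def abs_if add_divide_distrib)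
    qed
  qed
  have "realizes 4 (J ` V)"
    unfolding V_def
  proof (rule realizes_gauge[where \<gamma> = "\<lambda>t. (A t, B t)"])
    show "N u > 0" if "u \<noteq> 0" for u using that by (cases u) (auto simp: N_def zero_prod_def max_def)
    show "N (r *\<^sub>R u) = r * N u" if "r \<ge> 0" for r u
      using that by (cases u) (auto simp: N_def abs_mult max_mult_distrib_left)
    show "continuous_on {0..real 4} (\<lambda>t. (A t, B t))"
      unfolding A_def B_def by (intro continuous_intros)
    show "(\<lambda>t. (A t, B t)) ` {0..real 4} = {u. N u = 1}"
    proof (intro equalityI subsetI)
      fix u assume "u \<in> {u. N u = 1}"
      then have "max \<bar>fst u\<bar> \<bar>snd u\<bar> = 1" by (simp add: N_def case_prod_beta)
      from onto[OF this] show "u \<in> (\<lambda>t. (A t, B t)) ` {0..real 4}" by (cases u) auto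
    next
      fix u assume "u \<in> (\<lambda>t. (A t, B t)) ` {0..real 4}"
      then show "u \<in> {u. N u = 1}" using N1 by (auto simp: N_def)
    qed
    show "(A t, B t) = (A t', B t') \<longleftrightarrow> t = t' \<or> {t, t'} = {0, real 4}"
      if "t \<in> {0..real 4}" "t' \<in> {0..real 4}" for t t'
    proof
      assume "(A t, B t) = (A t', B t')"
      then have "A t = A t'" "B t = B t'" by auto
      then have "t = t' \<or> t = 0 \<and> t' = 4 \<or> t = 4 \<and> t' = 0"
        using that unfolding A_def B_def
        by (auto simp: max_def min_def abs_if split: if_splits)
      then show "t = t' \<or> {t, t'} = {0, real 4}" by auto
    next
      assume "t = t' \<or> {t, t'} = {0, real 4}"
      then have "t = t' \<or> t = 0 \<and> t' = 4 \<or> t = 4 \<and> t' = 0" by (auto simp: doubleton_eq_iff)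
      then show "(A t, B t) = (A t', B t')" by (auto simp: A_def B_def)
    qed
    show "continuous_on {u. N u \<le> 1} F" "continuous_on {u. N u \<le> 1} E"
      unfolding F_def E_def case_prod_beta by (intro continuous_intros)+
    show "F u > 0 \<and> E u > 0" if "N u < 1" for u
      using that by (cases u) (auto simp: N_def F_def E_def abs_square_less_1)
    show "F (A t, B t) \<ge> 0 \<and> (F (A t, B t) = 0 \<longleftrightarrow> sin (pi * t) \<le> 0)"
      "E (A t, B t) \<ge> 0 \<and> (E (A t, B t) = 0 \<longleftrightarrow> sin (pi * t) \<ge> 0)" if "t \<in> {0..real 4}" for t
      using sq AB sgn[OF that] by (simp_all add: F_def E_def)
    have "continuous_on UNIV J"
      unfolding J_def case_prod_beta
      by (intro continuous_on_Pair continuous_on_vec2 continuous_on_vec3 continuous_intros)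
    then show "continuous_on {(v, x, u). N u \<le> 1 \<and> (norm v)\<^sup>2 = F u \<and> x\<^sup>2 = E u} J"
      by (rule continuous_on_subset) simp
    show "inj_on J {(v, x, u). N u \<le> 1 \<and> (norm v)\<^sup>2 = F u \<and> x\<^sup>2 = E u}"
    proof (rule inj_onI)
      fix p q assume "J p = J q"
      moreover obtain v x s t v' x' s' t' where pq: "p = (v, x, s, t)" "q = (v', x', s', t')"
        by (metis prod.exhaust)
      ultimately have "(vector [x, s] :: real^2) $ i = (vector [x', s'] :: real^2) $ i"
        "(vector [v$1, v$2, t] :: real^3) $ j = (vector [v'$1, v'$2, t'] :: real^3) $ j" for i j
        by (auto simp: J_def)
      from this(1)[of 1] this(1)[of 2] this(2)[of 1] this(2)[of 2] this(2)[of 3]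
      show "p = q" by (simp add: pq vec_eq_iff forall_2)
    qed
  qed
  moreover have "J ` V = sphere 0 1 \<times> sphere 0 1"
  proof (intro equalityI subsetI)
    fix w assume "w \<in> J ` V"
    then obtain v x s t where w: "w = J (v, x, s, t)" "(norm v)\<^sup>2 = 1 - t\<^sup>2" "x\<^sup>2 = 1 - s\<^sup>2"
      by (auto simp: V_def F_def E_def)
    then have "(norm (fst w))\<^sup>2 = 1" "(norm (snd w))\<^sup>2 = 1"
      by (simp_all add: J_def norm_square_vec2 norm_square_vec3)
    then have "norm (fst w) = 1" "norm (snd w) = 1"
      by (metis norm_ge_zero one_power2 power2_eq_iff_nonneg zero_le_one)+
    then show "w \<in> sphere 0 1 \<times> sphere 0 1" by (cases w) auto
  next
    fix w :: "(real^2) \<times> (real^3)" assume "w \<in> sphere 0 1 \<times> sphere 0 1"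
    then obtain f g where w: "w = (f, g)" "(norm f)\<^sup>2 = 1" "(norm g)\<^sup>2 = 1" by auto
    then have e: "(f$1)\<^sup>2 + (f$2)\<^sup>2 = 1" "(g$1)\<^sup>2 + (g$2)\<^sup>2 + (g$3)\<^sup>2 = 1"
      by (simp_all add: norm_square_vec2 norm_square_vec3)
    then have "(f$2)\<^sup>2 \<le> 1" "(g$3)\<^sup>2 \<le> 1"
      using zero_le_power2[of "f$1"] zero_le_power2[of "g$1"] zero_le_power2[of "g$2"] by linarith+
    then have "(vector [g$1, g$2], f$1, f$2, g$3) \<in> V"
      using e by (simp add: V_def N_def F_def E_def norm_square_vec2 abs_square_le_1)
    moreover have "J (vector [g$1, g$2], f$1, f$2, g$3) = w"
      by (simp add: J_def w vec_eq_iff forall_2 forall_3)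
    ultimately show "w \<in> J ` V" by (metis imageI)
  qed
  ultimately show ?thesis by simp
qed

subsection \<open>Strips with holes\<close>

text \<open>The boundary of the strip is run through from the left tip along the bottom, over
  \<open>n - 1\<close> arcs separated by the zeros of the profile, and back over the roof as one
  last arc. As \<open>n\<close> is even, that arc has an odd number, which is where \<open>F\<close>
  has to vanish, and on the roof it does.\<close>

lemma realizes_handlebody:
  fixes \<beta> :: "nat \<Rightarrow> real"
  assumes n: "even n" "n \<ge> 2" and ab: "a \<le> b"
    and \<beta>: "\<And>i. i < n - 1 \<Longrightarrow> \<beta> i < \<beta> (Suc i)" "\<beta> 0 = a - 1" "\<beta> (n - 1) = b + 1"
    and \<eta>c: "continuous_on UNIV \<eta>"
    and \<eta>tip: "\<eta> (a - 1) > 0" "\<eta> (b + 1) > 0"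
    and \<eta>0: "\<And>i. 0 < i \<Longrightarrow> i < n - 1 \<Longrightarrow> \<eta> (\<beta> i) = 0"
    and \<eta>even: "\<And>i s. i < n - 1 \<Longrightarrow> even i \<Longrightarrow> \<beta> i < s \<Longrightarrow> s < \<beta> (Suc i) \<Longrightarrow> \<eta> s > 0"
    and \<eta>odd: "\<And>i s. i < n - 1 \<Longrightarrow> odd i \<Longrightarrow> \<beta> i < s \<Longrightarrow> s < \<beta> (Suc i) \<Longrightarrow> \<eta> s < 0"
  shows "realizes n (handlebody a b \<eta>)"
proof -
  define m where "m = n - 1"
  have m: "n = Suc m" "odd m" "real n = real m + 1" using n by (auto simp: m_def)
  define h where "h = (b - a) / 2"
  define mid where "mid = (a + b) / 2"
  define T where "T = trapezoid a b"
  \<comment> \<open>The strip is recentred at \<open>(mid, 1/2)\<close>, an interior point. The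
    first term bounded by 1 says that \<open>X = w + 1/2\<close> lies between 0 and 1, the second
    that \<open>X \<le> h + 1 - |s|\<close>, which are the two slanted sides.\<close>
  define N where "N = (\<lambda>(s::real, w::real). max (2 * \<bar>w\<bar>) ((\<bar>s\<bar> + w) / (h + 1/2)))"
  define F where "F = (\<lambda>(s::real, w::real). (T (mid + s) - (w + 1/2)) * min 1 (w + 1/2 + max 0 (\<eta> (mid + s))))"
  define E where "E = (\<lambda>(s::real, w::real). w + 1/2 + max 0 (- \<eta> (mid + s)))"
  define J where "J = (\<lambda>(v::real^2, x::real, s::real, w::real). (vector [v$1, v$2, x] :: real^3, mid + s, w + 1/2))"
  define V where "V = {(v, x, u). N u \<le> 1 \<and> (norm (v::real^2))\<^sup>2 = F u \<and> x\<^sup>2 = E u}"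
  \<comment> \<open>The base coordinate along the circuit. The way back covers the distance
    \<open>b - a + 2\<close> between the tips in one unit of time, so that it arrives at
    \<open>t = n\<close>.\<close>
  define \<sigma> where "\<sigma> = (\<lambda>t. if t \<le> real m then pl \<beta> m t else b + 1 - (t - real m) * (b - a + 2))"
  define X where "X = (\<lambda>t. if t \<le> real m then 0 else T (\<sigma> t))"
  define \<gamma> where "\<gamma> = (\<lambda>t. (\<sigma> t - mid, X t - 1/2))"
  have h: "h \<ge> 0" using ab by (simp add: h_def)
  have T: "T s = min 1 (h + 1 - \<bar>s - mid\<bar>)" for s
    unfolding T_def trapezoid_def h_def mid_def by (auto simp: min_def abs_if field_simps)
  have Nle: "N (s, w) \<le> 1 \<longleftrightarrow> 0 \<le> w + 1/2 \<and> w + 1/2 \<le> T (mid + s)" for s w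
    using h by (auto simp: N_def T divide_le_eq abs_le_iff)
  have Nless: "N (s, w) < 1 \<longleftrightarrow> 0 < w + 1/2 \<and> w + 1/2 < T (mid + s)" for s w
    using h by (auto simp: N_def T divide_less_eq abs_less_iff)
  have Neq: "N (s, w) = 1 \<longleftrightarrow> 0 \<le> w + 1/2 \<and> w + 1/2 \<le> T (mid + s) \<and> (w + 1/2 = 0 \<or> w + 1/2 = T (mid + s))" for s w
    using Nle[of s w] Nless[of s w] by linarith
  have Tpos: "a - 1 < s \<Longrightarrow> s < b + 1 \<Longrightarrow> T s > 0" for s
    by (auto simp: T_def trapezoid_def)
  have Ttip: "T (a - 1) = 0" "T (b + 1) = 0" using ab by (auto simp: T_def trapezoid_def)
  have Tnn: "T s \<ge> 0 \<longleftrightarrow> a - 1 \<le> s \<and> s \<le> b + 1" for s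
    by (auto simp: T_def trapezoid_def)
  have \<beta>m: "\<And>i. i < m \<Longrightarrow> \<beta> i < \<beta> (Suc i)" "\<beta> m = b + 1" using \<beta> by (auto simp: m_def)
  have \<beta>range: "a - 1 \<le> \<beta> i \<and> \<beta> i \<le> b + 1" if "i \<le> m" for i
    using pl_image[where \<alpha> = \<beta> and n = m, OF \<beta>m(1)] pl_at[OF that, of \<beta>] \<beta>(2) \<beta>m(2) that
    by (metis atLeastAtMost_iff image_eqI of_nat_0_le_iff of_nat_mono)
  have \<sigma>im: "\<sigma> ` {0..real m} = {a - 1..b + 1}"
    using pl_image[where \<alpha> = \<beta> and n = m, OF \<beta>m(1)] \<beta>(2) \<beta>m(2) by (simp add: \<sigma>_def)
  have \<sigma>m: "\<sigma> (real m) = b + 1" "\<sigma> 0 = a - 1" "\<sigma> (real n) = a - 1"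
    using pl_at[of m m \<beta>] pl_at[of 0 m \<beta>] \<beta>(2) \<beta>m(2) m(3) by (simp_all add: \<sigma>_def)
  have \<sigma>top: "a - 1 < \<sigma> t \<and> \<sigma> t < b + 1" if "real m < t" "t < real n" for t
  proof -
    have "0 < (t - real m) * (b - a + 2)" "(t - real m) * (b - a + 2) < 1 * (b - a + 2)"
      using that m ab by (auto intro!: mult_pos_pos mult_strict_right_mono)
    then show ?thesis using that by (simp add: \<sigma>_def)
  qed
  have sgn: "F (\<gamma> t) \<ge> 0 \<and> (F (\<gamma> t) = 0 \<longleftrightarrow> sin (pi * t) \<le> 0) \<and> E (\<gamma> t) \<ge> 0 \<and> (E (\<gamma> t) = 0 \<longleftrightarrow> sin (pi * t) \<ge> 0) \<and> N (\<gamma> t) = 1"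
    if "t \<in> {0..real n}" for t
    using that
  proof (cases rule: unit_interval_cases)
    case (1 i)
    have s: "sin (pi * t) = 0" using 1 sin_pi_nat by simp
    consider "i = 0 \<or> i = m \<or> i = n" | "0 < i" "i < m" using 1 m by linarith
    then show ?thesis
    proof cases
      case 1
      then have "(\<sigma> t = a - 1 \<or> \<sigma> t = b + 1) \<and> X t = 0"
        using \<sigma>m \<open>t = real i\<close> m Ttip by (auto simp: X_def)
      then show ?thesis
        using s Ttip \<eta>tip by (auto simp: \<gamma>_def F_def E_def Neq)
    next
      case 2
      then have "\<sigma> t = \<beta> i" "X t = 0" using \<open>t = real i\<close> pl_at[of i m \<beta>] by (auto simp: \<sigma>_def X_def)
      moreover have "\<eta> (\<beta> i) = 0" using \<eta>0 2 by (simp add: m_def)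
      moreover have "T (\<beta> i) \<ge> 0" using \<beta>range[of i] 2 by (simp add: Tnn)
      ultimately show ?thesis using s by (auto simp: \<gamma>_def F_def E_def Neq)
    qed
  next
    case (2 i r)
    show ?thesis
    proof (cases "i < m")
      case True
      then have "real i + r \<le> real m" using 2 by linarith
      then have "\<sigma> t = \<beta> i + r * (\<beta> (Suc i) - \<beta> i)" and X0: "X t = 0"
        using 2 True pl_affine[of i m r \<beta>] by (auto simp: \<sigma>_def X_def)
      moreover have "0 < r * (\<beta> (Suc i) - \<beta> i)" "r * (\<beta> (Suc i) - \<beta> i) < 1 * (\<beta> (Suc i) - \<beta> i)"
        using 2 \<beta>m(1)[OF True] by (auto intro!: mult_pos_pos mult_strict_right_mono)
      ultimately have b: "\<beta> i < \<sigma> t" "\<sigma> t < \<beta> (Suc i)" by auto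
      then have Tp: "T (\<sigma> t) > 0" using \<beta>range[of i] \<beta>range[of "Suc i"] True by (intro Tpos) auto
      show ?thesis
      proof (cases "even i")
        case e: True
        then have "\<eta> (\<sigma> t) > 0" using \<eta>even b True by (auto simp: m_def)
        moreover have "sin (pi * t) > 0" using sin_pi_unit_interval(1)[of r i] 2 e by simp
        ultimately show ?thesis using Tp X0 by (auto simp: \<gamma>_def F_def E_def Neq)
      next
        case o: False
        then have "\<eta> (\<sigma> t) < 0" using \<eta>odd b True by (auto simp: m_def)
        moreover have "sin (pi * t) < 0" using sin_pi_unit_interval(2)[of r i] 2 o by simp
        ultimately show ?thesis using Tp X0 by (auto simp: \<gamma>_def F_def E_def Neq)
      qed
    next
      case False
      then have i: "i = m" using 2 m by auto
      then have s: "sin (pi * t) < 0" using sin_pi_unit_interval(2)[of r i] 2 m by simp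
      have "real m < t" "t < real n" using 2 i m by auto
      from \<sigma>top[OF this] have "T (\<sigma> t) > 0" by (intro Tpos) auto
      moreover have "X t = T (\<sigma> t)" using \<open>real m < t\<close> by (simp add: X_def)
      ultimately show ?thesis using s by (auto simp: \<gamma>_def F_def E_def Neq)
    qed
  qed
  have \<sigma>c: "continuous_on {0..real n} \<sigma>"
  proof -
    have "continuous_on ({0..real m} \<union> {real m..real n}) \<sigma>"
      unfolding \<sigma>_def
      by (rule continuous_on_cases_le[where h = "\<lambda>t. t" and a = "real m", simplified])
         (use pl_at[of m m \<beta>] \<beta>m in \<open>auto intro!: continuous_intros continuous_on_pl\<close>)
    moreover have "{0..real m} \<union> {real m..real n} = {0..real n}" using m by auto
    ultimately show ?thesis by simp
  qed
  have Tc: "continuous_on A T" for A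
    unfolding T_def trapezoid_def by (intro continuous_intros)
  have Xc: "continuous_on {0..real n} X"
  proof -
    have "X = (\<lambda>t. if t \<le> real m then 0 else T (b + 1 - (t - real m) * (b - a + 2)))"
      by (auto simp: X_def \<sigma>_def)
    moreover have "continuous_on ({0..real m} \<union> {real m..real n}) \<dots>"
      by (rule continuous_on_cases_le[where h = "\<lambda>t. t" and a = "real m", simplified])
         (use Ttip in \<open>auto intro!: continuous_intros continuous_on_compose2[OF Tc[of UNIV]]\<close>)
    moreover have "{0..real m} \<union> {real m..real n} = {0..real n}" using m by auto
    ultimately show ?thesis by simp
  qed
  have \<sigma>inj1: "t = t'" if "\<sigma> t = \<sigma> t'" "t \<in> {0..real m}" "t' \<in> {0..real m}" for t t'
    using pl_inj[where \<alpha> = \<beta> and n = m, OF \<beta>m(1)] that by (auto simp: \<sigma>_def)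
  have \<sigma>inj2: "t = t'" if "\<sigma> t = \<sigma> t'" "t > real m" "t' > real m" for t t'
    using that ab by (auto simp: \<sigma>_def)
  \<comment> \<open>Bottom and roof share only the two tips. The right tip, at \<open>t = m\<close>,
    is counted with the bottom, so the left tip remains as the only coincidence.\<close>
  have mixed: "t = 0 \<and> t' = real n" if "\<gamma> t = \<gamma> t'" "t \<in> {0..real m}" "t' > real m" "t' \<le> real n" for t t'
  proof -
    have *: "\<sigma> t = \<sigma> t'" "T (\<sigma> t') = 0" using that by (auto simp: \<gamma>_def X_def)
    then have "t' = real n" using \<sigma>top[of t'] Tpos[of "\<sigma> t'"] that by fastforce
    moreover from this * have "\<sigma> t = \<sigma> 0" using \<sigma>m by simp
    then have "t = 0" using \<sigma>inj1[of t 0] that by simp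
    ultimately show ?thesis by simp
  qed
  have "realizes n (J ` V)"
    unfolding V_def
  proof (rule realizes_gauge[where \<gamma> = \<gamma>])
    show "N u > 0" if "u \<noteq> 0" for u
    proof (cases u)
      case (Pair s w)
      have "N (s, w) > 0"
      proof (cases "w = 0")
        case True
        then have "\<bar>s\<bar> / (h + 1/2) > 0" using that Pair h by (auto simp: zero_prod_def intro!: divide_pos_pos)
        then show ?thesis using True by (simp add: N_def max_def)
      qed (auto simp: N_def less_max_iff_disj)
      then show ?thesis using Pair by simp
    qed
    show "N (r *\<^sub>R u) = r * N u" if "r \<ge> 0" for r u
    proof (cases u)
      case (Pair s w)
      have "(\<bar>r * s\<bar> + r * w) / (h + 1/2) = r * ((\<bar>s\<bar> + w) / (h + 1/2))"
        "2 * \<bar>r * w\<bar> = r * (2 * \<bar>w\<bar>)"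
        using that by (simp_all add: abs_mult distrib_left)
      then show ?thesis using that Pair by (simp only: N_def split_conv scaleR_Pair real_scaleR_def max_mult_distrib_left if_True)
    qed
    show "continuous_on {0..real n} \<gamma>"
      unfolding \<gamma>_def by (intro continuous_intros \<sigma>c Xc)
    show "\<gamma> ` {0..real n} = {u. N u = 1}"
    proof (intro equalityI subsetI)
      fix u assume "u \<in> \<gamma> ` {0..real n}" then show "u \<in> {u. N u = 1}" using sgn by auto
    next
      fix u assume "u \<in> {u. N u = 1}"
      then obtain s w where u: "u = (s, w)" "N (s, w) = 1" by (cases u) auto
      then have s: "a - 1 \<le> mid + s" "mid + s \<le> b + 1" using Neq[of s w] Tnn[of "mid + s"] by auto
      consider "w + 1/2 = 0" | "w + 1/2 = T (mid + s)" "T (mid + s) > 0" using u Neq[of s w] by fastforce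
      then show "u \<in> \<gamma> ` {0..real n}"
      proof cases
        case 1
        obtain t where t: "t \<in> {0..real m}" "\<sigma> t = mid + s" using \<sigma>im s by force
        then have "\<gamma> t = u" using 1 by (simp add: \<gamma>_def X_def u)
        then show ?thesis using t m by force
      next
        case 2
        define t where "t = real m + (b + 1 - (mid + s)) / (b - a + 2)"
        have "mid + s \<noteq> b + 1" using 2 Ttip by auto
        then have "0 < (b + 1 - (mid + s)) / (b - a + 2)" "(b + 1 - (mid + s)) / (b - a + 2) \<le> 1"
          using s ab by (auto simp: divide_simps)
        then have "real m < t" "t \<le> real n" using m by (auto simp: t_def)
        moreover have "\<sigma> t = mid + s" using \<open>real m < t\<close> ab by (simp add: \<sigma>_def t_def)
        ultimately show ?thesis using 2 u by (intro image_eqI[of _ _ t]) (auto simp: \<gamma>_def X_def)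
      qed
    qed
    show "\<gamma> t = \<gamma> t' \<longleftrightarrow> t = t' \<or> {t, t'} = {0, real n}"
      if "t \<in> {0..real n}" "t' \<in> {0..real n}" for t t'
    proof
      assume e: "\<gamma> t = \<gamma> t'"
      then have "\<sigma> t = \<sigma> t'" by (simp add: \<gamma>_def)
      then show "t = t' \<or> {t, t'} = {0, real n}"
        using \<sigma>inj1[of t t'] \<sigma>inj2[of t t'] mixed[of t t'] mixed[of t' t] e that
        by (cases "t \<le> real m"; cases "t' \<le> real m") auto
    next
      assume "t = t' \<or> {t, t'} = {0, real n}"
      then have "t = t' \<or> t = 0 \<and> t' = real n \<or> t = real n \<and> t' = 0" by (auto simp: doubleton_eq_iff)
      moreover have "\<not> real n \<le> real m" using m(3) by linarith
      then have "\<gamma> 0 = \<gamma> (real n)" using \<sigma>m Ttip by (simp add: \<gamma>_def X_def)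
      ultimately show "\<gamma> t = \<gamma> t'" by auto
    qed
    have \<eta>c': "continuous_on A \<eta>" for A using \<eta>c continuous_on_subset by blast
    show "continuous_on {u. N u \<le> 1} F" "continuous_on {u. N u \<le> 1} E"
      unfolding F_def E_def case_prod_beta
      by (intro continuous_intros continuous_on_compose2[OF Tc[of UNIV]] continuous_on_compose2[OF \<eta>c]; simp)+
    show "F u > 0 \<and> E u > 0" if "N u < 1" for u
    proof (cases u)
      case (Pair s w)
      then have "0 < w + 1/2" "w + 1/2 < T (mid + s)" using that Nless by auto
      then show ?thesis using Pair by (auto simp: F_def E_def)
    qed
    show "F (\<gamma> t) \<ge> 0 \<and> (F (\<gamma> t) = 0 \<longleftrightarrow> sin (pi * t) \<le> 0)"
      "E (\<gamma> t) \<ge> 0 \<and> (E (\<gamma> t) = 0 \<longleftrightarrow> sin (pi * t) \<ge> 0)" if "t \<in> {0..real n}" for t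
      using sgn[OF that] by simp_all
    have "continuous_on UNIV J"
      unfolding J_def case_prod_beta
      by (intro continuous_on_Pair continuous_on_vec3 continuous_intros)
    then show "continuous_on {(v, x, u). N u \<le> 1 \<and> (norm v)\<^sup>2 = F u \<and> x\<^sup>2 = E u} J"
      by (rule continuous_on_subset) simp
    show "inj_on J {(v, x, u). N u \<le> 1 \<and> (norm v)\<^sup>2 = F u \<and> x\<^sup>2 = E u}"
    proof (rule inj_onI)
      fix p q assume "J p = J q"
      moreover obtain v x s t v' x' s' t' where pq: "p = (v, x, s, t)" "q = (v', x', s', t')"
        by (metis prod.exhaust)
      ultimately have "(vector [v$1, v$2, x] :: real^3) = (vector [v'$1, v'$2, x'] :: real^3)" "s = s'" "t = t'"
        by (auto simp: J_def)
      then show "p = q" by (simp add: pq vec_eq_iff forall_2 forall_3)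
    qed
  qed
  moreover have "J ` V = handlebody a b \<eta>"
  proof (intro equalityI subsetI)
    fix p assume "p \<in> J ` V"
    then obtain v x s w where p: "p = J (v, x, s, w)" "N (s, w) \<le> 1" "(norm v)\<^sup>2 = F (s, w)" "x\<^sup>2 = E (s, w)"
      by (auto simp: V_def)
    then show "p \<in> handlebody a b \<eta>"
      using Nle[of s w] by (simp add: J_def handlebody_def norm_square_vec2 F_def E_def T_def)
  next
    fix p assume p: "p \<in> handlebody a b \<eta>"
    then obtain u s Y where p': "p = (u, s, Y)" by (metis prod.exhaust)
    have "(vector [u$1, u$2], u$3, s - mid, Y - 1/2) \<in> V"
      using p Nle[of "s - mid" "Y - 1/2"]
      by (simp add: p' V_def handlebody_def norm_square_vec2 F_def E_def T_def)
    moreover have "J (vector [u$1, u$2], u$3, s - mid, Y - 1/2) = p"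
      by (simp add: p' J_def vec_eq_iff forall_3)
    ultimately show "p \<in> J ` V" by (metis imageI)
  qed
  ultimately show ?thesis by simp
qed

text \<open>The profile is negative at distance less than 1/4 from \<open>j\<close> and equal to 1
  from distance 1/2 on. With holes at 0, 2 and 4 this leaves a collar of width 1/2 on both sides of
  the cuts at 1 and 3.\<close>

definition hole :: "real \<Rightarrow> real \<Rightarrow> real" where
  "hole j s = min 1 (4 * \<bar>s - j\<bar> - 1)"

lemma hole_eq_1: "s \<le> j - 1/2 \<or> j + 1/2 \<le> s \<Longrightarrow> hole j s = 1"
  by (auto simp: hole_def)

lemma hole_le_1: "hole j s \<le> 1"
  by (simp add: hole_def)

lemma less_Suc_cases3: "i < 3 \<Longrightarrow> (i = 0 \<or> i = 1 \<or> i = (2::nat))"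
  by linarith

lemma less_Suc_cases7: "i < 7 \<Longrightarrow> (i = 0 \<or> i = 1 \<or> i = 2 \<or> i = 3 \<or> i = 4 \<or> i = 5 \<or> i = (6::nat))"
  by linarith

lemma realizes_one_hole: "realizes 4 (handlebody (j - 1) (j + 1) (hole j))"
proof -
  \<comment> \<open>The tips lie at distance 1 beyond the ends of the flat roof, the edges of the
    hole between them: three bottom arcs, and the roof is the fourth.\<close>
  define \<beta> where "\<beta> i = [j - 2, j - 1/4, j + 1/4, j + 2] ! i" for i :: nat
  show ?thesis
  proof (rule realizes_handlebody[where \<beta> = \<beta>])
    show "continuous_on UNIV (hole j)"
      unfolding hole_def by (intro continuous_intros)
    fix i :: nat and s :: real
    show "\<beta> i < \<beta> (Suc i)" if "i < 4 - 1"
      using that less_Suc_cases3[of i] by (auto simp: \<beta>_def)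
    show "hole j (\<beta> i) = 0" if "0 < i" "i < 4 - 1"
      using that less_Suc_cases3[of i] by (auto simp: \<beta>_def hole_def)
    show "hole j s > 0" if "i < 4 - 1" "even i" "\<beta> i < s" "s < \<beta> (Suc i)"
      using that less_Suc_cases3[of i] by (auto simp: \<beta>_def hole_def abs_if)
    show "hole j s < 0" if "i < 4 - 1" "odd i" "\<beta> i < s" "s < \<beta> (Suc i)"
      using that less_Suc_cases3[of i] by (auto simp: \<beta>_def hole_def abs_if)
  qed (auto simp: \<beta>_def hole_def)
qed

lemma realizes_three_holes:
  "realizes 8 (handlebody (-1) 5 (\<lambda>s. min (min (hole 0 s) (hole 2 s)) (hole 4 s)))"
proof -
  \<comment> \<open>Two tips and six edges of holes: seven bottom arcs, and the roof is the
    eighth.\<close>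
  define \<beta> where "\<beta> i = [-2, - 1/4, 1/4, 7/4, 9/4, 15/4, 17/4, 6 :: real] ! i" for i :: nat
  show ?thesis
  proof (rule realizes_handlebody[where \<beta> = \<beta>])
    show "continuous_on UNIV (\<lambda>s. min (min (hole 0 s) (hole 2 s)) (hole 4 s))"
      unfolding hole_def by (intro continuous_intros)
    fix i :: nat and s :: real
    show "\<beta> i < \<beta> (Suc i)" if "i < 8 - 1"
      using that less_Suc_cases7[of i] by (auto simp: \<beta>_def)
    show "min (min (hole 0 (\<beta> i)) (hole 2 (\<beta> i))) (hole 4 (\<beta> i)) = 0" if "0 < i" "i < 8 - 1"
      using that less_Suc_cases7[of i] by (auto simp: \<beta>_def hole_def)
    show "min (min (hole 0 s) (hole 2 s)) (hole 4 s) > 0" if "i < 8 - 1" "even i" "\<beta> i < s" "s < \<beta> (Suc i)"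
      using that less_Suc_cases7[of i] by (auto simp: \<beta>_def hole_def abs_if)
    show "min (min (hole 0 s) (hole 2 s)) (hole 4 s) < 0" if "i < 8 - 1" "odd i" "\<beta> i < s" "s < \<beta> (Suc i)"
      using that less_Suc_cases7[of i] by (auto simp: \<beta>_def hole_def abs_if min_less_iff_disj)
  qed (auto simp: \<beta>_def hole_def)
qed

text \<open>Around \<open>c\<close> the slices are unit spheres, and both capped halves are shorter
  strips. Compactness of the left half is recorded because the strip with two holes, the
  intermediate summand, inherits it as a capped piece of the strip with three.\<close>

lemma handlebody_sum:
  assumes "\<delta> > 0" "a \<le> c - \<delta>" "c + \<delta> \<le> b" "\<And>s. \<bar>s - c\<bar> < \<delta> \<Longrightarrow> \<eta> s = 1"
    and "\<And>s. s \<le> c \<Longrightarrow> \<eta>\<^sub>1 s = \<eta> s" "\<And>s. s \<ge> c \<Longrightarrow> \<eta>\<^sub>1 s = 1"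
    and "\<And>s. s \<ge> c \<Longrightarrow> \<eta>\<^sub>2 s = \<eta> s" "\<And>s. s \<le> c \<Longrightarrow> \<eta>\<^sub>2 s = 1"
  shows "\<exists>\<phi> \<psi> i j. sum_data (top_of_set (handlebody a c \<eta>\<^sub>1)) (top_of_set (handlebody c b \<eta>\<^sub>2))
           (top_of_set (handlebody a b \<eta>)) \<phi> \<psi> i j"
    and "compact (handlebody a b \<eta>) \<Longrightarrow> compact (handlebody a c \<eta>\<^sub>1)"
proof -
  have c: "a \<le> c" "c \<le> b" "\<eta> c = 1" using assms(1-4) by auto
  have e1: "capped 1 c (handlebody a b \<eta>) = handlebody a c \<eta>\<^sub>1"
    by (rule capped_handlebody(1)[where \<eta> = \<eta>, OF c]) (simp_all add: assms)
  have e2: "capped (-1) c (handlebody a b \<eta>) = handlebody c b \<eta>\<^sub>2"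
    by (rule capped_handlebody(2)[where \<eta> = \<eta>, OF c]) (simp_all add: assms)
  have "(u, s, X) \<in> handlebody a b \<eta> \<longleftrightarrow> norm u = 1 \<and> X = (u$3)\<^sup>2" if "\<bar>s - c\<bar> < \<delta>" for u s X
    using handlebody_neck[where \<eta> = \<eta>, OF that assms(2,3) assms(4)[OF that]] .
  from capped_sum_data[where c = c, OF assms(1) this]
  show "\<exists>\<phi> \<psi> i j. sum_data (top_of_set (handlebody a c \<eta>\<^sub>1)) (top_of_set (handlebody c b \<eta>\<^sub>2))
           (top_of_set (handlebody a b \<eta>)) \<phi> \<psi> i j"
    unfolding e1 e2 .
  show "compact (handlebody a c \<eta>\<^sub>1)" if "compact (handlebody a b \<eta>)"
    using compact_capped[OF that, of 1 c] unfolding e1 by simp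
qed

lemma connected_sum_transfer:
  assumes "sum_data X Y Z \<phi> \<psi> i j"
    and "X homeomorphic_space X'" "Y homeomorphic_space Y'" "Z homeomorphic_space Z'"
    and "compact_space X" "compact_space Y" "Hausdorff_space Z"
  shows "is_connected_sum X' Y' Z'"
proof -
  have "compact_space X'" "compact_space Y'" "Hausdorff_space Z'"
    using assms homeomorphic_compact_space homeomorphic_Hausdorff_space by blast+
  then show ?thesis
    using sum_data_homeomorphic[OF assms(1-4)] is_connected_sumI by blast
qed

text \<open>The strip with three holes has the same pattern of eight arcs, hence is homeomorphic to
  \<open>W\<close>. Cutting it midway between the holes, at 3 and then at 1, leaves three strips
  with one hole, and their four arcs are the pattern of \<open>S1xS2\<close>.\<close>

lemma realizes_8_connected_sum:
  fixes W :: "'w::metric_space set" and Z :: "'z topology"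
  assumes "realizes 8 W" "top_of_set W homeomorphic_space Z"
  shows "\<exists>M :: (((real^2) \<times> (real^3)) + ((real^2) \<times> (real^3))) set topology.
           is_connected_sum S1xS2 S1xS2 M \<and> is_connected_sum M S1xS2 Z"
proof -
  define \<Omega>8 where "\<Omega>8 = handlebody (-1) 5 (\<lambda>s. min (min (hole 0 s) (hole 2 s)) (hole 4 s))"
  define \<Omega>6 where "\<Omega>6 = handlebody (-1) 3 (\<lambda>s. min (hole 0 s) (hole 2 s))"
  define \<eta>8 where "\<eta>8 = (\<lambda>s. min (min (hole 0 s) (hole 2 s)) (hole 4 s))"
  define \<eta>6 where "\<eta>6 = (\<lambda>s. min (hole 0 s) (hole 2 s))"
  have "\<eta>8 s = 1" if "\<bar>s - 3\<bar> < 1/2" for s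
  proof -
    have "5/2 < s" "s < 7/2" using that by linarith+
    then show ?thesis using hole_eq_1[of s 0] hole_eq_1[of s 2] hole_eq_1[of s 4] by (simp add: \<eta>8_def)
  qed
  moreover have "\<eta>6 s = \<eta>8 s" if "s \<le> 3" for s
    using hole_eq_1[of s 4] hole_le_1[of 0 s] that by (simp add: \<eta>8_def \<eta>6_def min_def)
  moreover have "\<eta>6 s = 1" "hole 4 s = \<eta>8 s" if "s \<ge> 3" for s
    using hole_eq_1[of s 0] hole_eq_1[of s 2] hole_le_1[of 4 s] that by (simp_all add: \<eta>8_def \<eta>6_def)
  moreover have "hole 4 s = 1" if "s \<le> 3" for s
    using hole_eq_1[of s 4] that by simp
  ultimately have sum8: "\<exists>\<phi> \<psi> i j. sum_data (top_of_set \<Omega>6) (top_of_set (handlebody 3 5 (hole 4))) (top_of_set \<Omega>8) \<phi> \<psi> i j"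
    and c6: "compact \<Omega>8 \<Longrightarrow> compact \<Omega>6"
    unfolding \<Omega>8_def \<Omega>6_def \<eta>8_def[symmetric] \<eta>6_def[symmetric]
    by (intro handlebody_sum[where \<delta> = "1/2" and c = 3 and b = 5 and \<eta>\<^sub>2 = "hole 4"]; simp)+
  have "\<eta>6 s = 1" if "\<bar>s - 1\<bar> < 1/2" for s
  proof -
    have "1/2 < s" "s < 3/2" using that by linarith+
    then show ?thesis using hole_eq_1[of s 0] hole_eq_1[of s 2] by (simp add: \<eta>6_def)
  qed
  moreover have "hole 0 s = \<eta>6 s" "hole 2 s = 1" if "s \<le> 1" for s
    using hole_eq_1[of s 2] hole_le_1[of 0 s] that by (simp_all add: \<eta>6_def)
  moreover have "hole 0 s = 1" "hole 2 s = \<eta>6 s" if "s \<ge> 1" for s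
    using hole_eq_1[of s 0] hole_le_1[of 2 s] that by (simp_all add: \<eta>6_def)
  ultimately have sum6: "\<exists>\<phi> \<psi> i j. sum_data (top_of_set (handlebody (-1) 1 (hole 0))) (top_of_set (handlebody 1 3 (hole 2))) (top_of_set \<Omega>6) \<phi> \<psi> i j"
    unfolding \<Omega>6_def \<eta>6_def[symmetric]
    by (intro handlebody_sum(1)[where \<delta> = "1/2"]; simp)
  have r8: "realizes 8 \<Omega>8"
    unfolding \<Omega>8_def by (rule realizes_three_holes)
  have one: "top_of_set H homeomorphic_space S1xS2" "compact_space (top_of_set H)" if "realizes 4 H"
    for H :: "((real^3) \<times> real \<times> real) set"
    using realizes_homeomorphic[OF that realizes_S1xS2] realizes_compact[OF that]
    by (simp_all add: S1xS2_def compact_space_subtopology)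
  have r4: "realizes 4 (handlebody 3 5 (hole 4))" "realizes 4 (handlebody (-1) 1 (hole 0))" "realizes 4 (handlebody 1 3 (hole 2))"
    using realizes_one_hole[of 4] realizes_one_hole[of 0] realizes_one_hole[of 2] by simp_all
  have haus: "Hausdorff_space (top_of_set H)" for H :: "((real^3) \<times> real \<times> real) set"
    by (rule Hausdorff_space_subtopology[OF Hausdorff_space_euclidean])
  have cs6: "compact_space (top_of_set \<Omega>6)"
    using c6 realizes_compact[OF r8] by (simp add: compact_space_subtopology)
  \<comment> \<open>Any injection into the prescribed type will do: \<open>s\<close> and
    \<open>X\<close> are packed into a plane vector, and the result is wrapped in a
    singleton.\<close>
  define f :: "(real^3) \<times> real \<times> real \<Rightarrow> (((real^2) \<times> (real^3)) + ((real^2) \<times> (real^3))) set"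
    where "f = (\<lambda>(u, s, X). {Inl (vector [s, X], u)})"
  have "inj f"
  proof (rule injI)
    fix p q assume "f p = f q"
    moreover obtain u s X u' s' X' where pq: "p = (u, s, X)" "q = (u', s', X')" by (metis prod.exhaust)
    ultimately have "u = u'" "(vector [s, X] :: real^2) = vector [s', X']" by (auto simp: f_def)
    then show "p = q" by (simp add: pq vec_eq_iff forall_2)
  qed
  then obtain M :: "(((real^2) \<times> (real^3)) + ((real^2) \<times> (real^3))) set topology"
    where M: "top_of_set \<Omega>6 homeomorphic_space M"
    using homeomorphic_copy by blast
  obtain \<phi> \<psi> i j where "sum_data (top_of_set (handlebody (-1) 1 (hole 0))) (top_of_set (handlebody 1 3 (hole 2))) (top_of_set \<Omega>6) \<phi> \<psi> i j"
    using sum6 by blast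
  then have S: "is_connected_sum S1xS2 S1xS2 M"
    using connected_sum_transfer one[OF r4(2)] one[OF r4(3)] M haus by blast
  obtain \<phi> \<psi> i j where "sum_data (top_of_set \<Omega>6) (top_of_set (handlebody 3 5 (hole 4))) (top_of_set \<Omega>8) \<phi> \<psi> i j"
    using sum8 by blast
  moreover have "top_of_set \<Omega>8 homeomorphic_space Z"
    using realizes_homeomorphic[OF r8 assms(1)] assms(2) by (rule homeomorphic_space_trans)
  ultimately have "is_connected_sum M S1xS2 Z"
    using connected_sum_transfer M one[OF r4(1)] cs6 haus by blast
  with S show ?thesis by blast
qed

subsection \<open>The compactified level as a double\<close>

lemma casimir_sphere_eq: "C > 0 \<Longrightarrow> casimir_sphere C = sphere 0 (sqrt C)"
proof -
  assume C: "C > 0"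
  have "casimir m = (norm m)\<^sup>2" for m by (simp add: casimir_def norm_square_vec3)
  moreover have "norm m = sqrt C \<longleftrightarrow> (norm m)\<^sup>2 = C" for m :: "real^3"
    using C real_sqrt_unique[of "norm m" C] by auto
  ultimately show ?thesis by (auto simp: casimir_sphere_def)
qed

definition discr :: "real \<Rightarrow> real \<Rightarrow> real^3 \<Rightarrow> real" where
  "discr C h m = (1 + m$2 * m$3)\<^sup>2 + (m$1 * m$3)\<^sup>2 - (2 * C - 4 * h) * (m$3)\<^sup>2"

lemma discr_equator: "m$3 = 0 \<Longrightarrow> discr C h m = 1"
  by (simp add: discr_def)

lemma continuous_on_discr: "continuous_on A (discr C h)"
  unfolding discr_def by (intro continuous_intros)

lemma hamiltonian_level:
  assumes "casimir m = C"
  shows "hamiltonian ((\<xi>, p), m) = h \<longleftrightarrow>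
    (2 * p - m$1)\<^sup>2 / 2 - (m$1)\<^sup>2 / 2 + 2 * (m$3)\<^sup>2 * \<xi>\<^sup>2 - 2 * \<xi> * (1 + m$2 * m$3) + (C - 2 * h) = 0"
  using assms by (simp add: hamiltonian_def casimir_def power2_eq_square field_simps) argo

text \<open>This is the equation multiplied by \<open>2 * z^2\<close>. On the equator the factor
  vanishes, so the converse is available only for nonzero \<open>z\<close>, and the parabolas over
  the equator keep requiring a treatment of their own.\<close>

lemma level_completed_square:
  assumes "(2 * p - x)\<^sup>2 / 2 - x\<^sup>2 / 2 + 2 * z\<^sup>2 * \<xi>\<^sup>2 - 2 * \<xi> * (1 + y * z) + (C - 2 * h) = (0::real)"
  shows "z\<^sup>2 * (2 * p - x)\<^sup>2 + (2 * z\<^sup>2 * \<xi> - (1 + y * z))\<^sup>2 = (1 + y * z)\<^sup>2 + (x * z)\<^sup>2 - (2 * C - 4 * h) * z\<^sup>2"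
proof -
  have "z\<^sup>2 * (2 * p - x)\<^sup>2 + (2 * z\<^sup>2 * \<xi> - (1 + y * z))\<^sup>2 - ((1 + y * z)\<^sup>2 + (x * z)\<^sup>2 - (2 * C - 4 * h) * z\<^sup>2)
    = 2 * z\<^sup>2 * ((2 * p - x)\<^sup>2 / 2 - x\<^sup>2 / 2 + 2 * z\<^sup>2 * \<xi>\<^sup>2 - 2 * \<xi> * (1 + y * z) + (C - 2 * h))"
    by (simp add: power2_eq_square field_simps)
  then show ?thesis using assms by simp
qed

lemma level_completed_square_iff:
  assumes "z \<noteq> (0::real)"
  shows "(2 * p - x)\<^sup>2 / 2 - x\<^sup>2 / 2 + 2 * z\<^sup>2 * \<xi>\<^sup>2 - 2 * \<xi> * (1 + y * z) + (C - 2 * h) = 0 \<longleftrightarrow>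
    z\<^sup>2 * (2 * p - x)\<^sup>2 + (2 * z\<^sup>2 * \<xi> - (1 + y * z))\<^sup>2 = (1 + y * z)\<^sup>2 + (x * z)\<^sup>2 - (2 * C - 4 * h) * z\<^sup>2"
proof -
  have "z\<^sup>2 * (2 * p - x)\<^sup>2 + (2 * z\<^sup>2 * \<xi> - (1 + y * z))\<^sup>2 - ((1 + y * z)\<^sup>2 + (x * z)\<^sup>2 - (2 * C - 4 * h) * z\<^sup>2)
    = 2 * z\<^sup>2 * ((2 * p - x)\<^sup>2 / 2 - x\<^sup>2 / 2 + 2 * z\<^sup>2 * \<xi>\<^sup>2 - 2 * \<xi> * (1 + y * z) + (C - 2 * h))"
    by (simp add: power2_eq_square field_simps)
  then show ?thesis using assms by (metis eq_iff_diff_eq_0 mult_eq_0_iff power_eq_0_iff zero_neq_numeral)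
qed

definition inv_stereographic :: "real \<Rightarrow> real \<Rightarrow> real \<Rightarrow> real^3" where
  "inv_stereographic A B D = (let S = A\<^sup>2 + B\<^sup>2 + D\<^sup>2 in
     vector [2 * A * D / S, 2 * B * D / S, (A\<^sup>2 + B\<^sup>2 - D\<^sup>2) / S])"

lemma inv_stereographic_nth:
  "inv_stereographic A B D $ 1 = 2 * A * D / (A\<^sup>2 + B\<^sup>2 + D\<^sup>2)"
  "inv_stereographic A B D $ 2 = 2 * B * D / (A\<^sup>2 + B\<^sup>2 + D\<^sup>2)"
  "inv_stereographic A B D $ 3 = (A\<^sup>2 + B\<^sup>2 - D\<^sup>2) / (A\<^sup>2 + B\<^sup>2 + D\<^sup>2)"
  by (simp_all add: inv_stereographic_def Let_def)

lemma inv_stereographic_sphere: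
  assumes "A\<^sup>2 + B\<^sup>2 + D\<^sup>2 \<noteq> 0"
  shows "inv_stereographic A B D \<in> sphere 0 1"
proof -
  define S where "S = A\<^sup>2 + B\<^sup>2 + D\<^sup>2"
  have "(2 * A * D)\<^sup>2 + (2 * B * D)\<^sup>2 + (A\<^sup>2 + B\<^sup>2 - D\<^sup>2)\<^sup>2 = S\<^sup>2"
    by (simp add: S_def power2_eq_square algebra_simps)
  then have "(norm (inv_stereographic A B D))\<^sup>2 = 1"
    using assms by (simp add: norm_square_vec3 inv_stereographic_nth power_divide add_divide_distrib[symmetric] flip: S_def)
  then show ?thesis
    by (simp add: power2_eq_1_iff) (smt (verit) norm_ge_zero)
qed

lemma inv_stereographic_north: "(A, B) \<noteq> (0, 0) \<Longrightarrow> inv_stereographic A B 0 = north_pole"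
  by (auto simp: vec_eq_iff forall_3 inv_stereographic_nth north_pole_def axis_def sum_power2_eq_zero_iff)

lemma stereographic_inv:
  assumes "D \<noteq> 0"
  shows "stereographic (inv_stereographic A B D) = (A / D, B / D)" "inv_stereographic A B D \<noteq> north_pole"
proof -
  define S where "S = A\<^sup>2 + B\<^sup>2 + D\<^sup>2"
  have "D\<^sup>2 > 0" using assms by simp
  then have S: "S > 0" by (simp add: S_def add_nonneg_pos)
  have e: "1 - (A\<^sup>2 + B\<^sup>2 - D\<^sup>2) / S = 2 * D\<^sup>2 / S"
    using S by (simp add: field_simps S_def)
  have "2 * A * D / S / (2 * D\<^sup>2 / S) = A / D" "2 * B * D / S / (2 * D\<^sup>2 / S) = B / D"
    using S assms by (simp_all add: power2_eq_square)
  then show "stereographic (inv_stereographic A B D) = (A / D, B / D)"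
    unfolding stereographic_def inv_stereographic_nth S_def[symmetric] e by simp
  have "2 * D\<^sup>2 / S > 0" using S \<open>D\<^sup>2 > 0\<close> by simp
  then have "inv_stereographic A B D $ 3 \<noteq> 1"
    unfolding inv_stereographic_nth S_def[symmetric] using e by linarith
  then show "inv_stereographic A B D \<noteq> north_pole"
    by (auto simp: north_pole_def axis_def)
qed

lemma inv_stereographic_scale:
  assumes "D \<noteq> 0"
  shows "inv_stereographic A B D = inv_stereographic (A / D) (B / D) 1"
proof -
  define S where "S = A\<^sup>2 + B\<^sup>2 + D\<^sup>2"
  have "D\<^sup>2 > 0" using assms by simp
  then have S: "S > 0" by (simp add: S_def add_nonneg_pos)
  have e: "(A / D)\<^sup>2 + (B / D)\<^sup>2 + 1 = S / D\<^sup>2" "(A / D)\<^sup>2 + (B / D)\<^sup>2 - 1 = (A\<^sup>2 + B\<^sup>2 - D\<^sup>2) / D\<^sup>2"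
    using assms by (simp_all add: S_def power_divide add_divide_distrib diff_divide_distrib)
  show ?thesis
    unfolding vec_eq_iff forall_3 inv_stereographic_nth one_power2 e S_def[symmetric]
    using S assms by (simp add: power2_eq_square)
qed

lemma inv_stereographic_stereographic:
  assumes "q \<in> sphere 0 1" "q \<noteq> north_pole"
  shows "inv_stereographic (fst (stereographic q)) (snd (stereographic q)) 1 = q"
proof -
  have n: "(q$1)\<^sup>2 + (q$2)\<^sup>2 + (q$3)\<^sup>2 = 1"
    using assms(1) norm_square_vec3[of q] by simp
  have ne: "1 - q$3 \<noteq> 0"
  proof
    assume "1 - q$3 = 0"
    moreover from this n have "(q$1)\<^sup>2 + (q$2)\<^sup>2 = 0" by simp
    ultimately have "q = north_pole"
      by (auto simp: vec_eq_iff forall_3 north_pole_def axis_def sum_power2_eq_zero_iff)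
    then show False using assms by simp
  qed
  define w where "w = 1 - q$3"
  have "(q$1)\<^sup>2 + (q$2)\<^sup>2 = w * (2 - w)"
    using n by (simp add: w_def power2_eq_square algebra_simps)
  then have e: "(q$1 / w)\<^sup>2 + (q$2 / w)\<^sup>2 = (2 - w) / w"
    using ne by (simp add: w_def[symmetric] power_divide add_divide_distrib[symmetric]) (simp add: power2_eq_square)
  have e1: "(q$1 / w)\<^sup>2 + (q$2 / w)\<^sup>2 + 1 = 2 / w" "(q$1 / w)\<^sup>2 + (q$2 / w)\<^sup>2 - 1 = 2 * (1 - w) / w"
    unfolding e using ne by (simp_all add: w_def[symmetric] field_simps)
  show ?thesis
    unfolding stereographic_def fst_conv snd_conv w_def[symmetric] vec_eq_iff forall_3
      inv_stereographic_nth one_power2 e1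
    using ne by (simp add: w_def)
qed

text \<open>The quotient in the last line is 0/0 on the equator. Rationalising its numerator gives
  the other expression, whose denominator is 2 there; where both make sense they agree.\<close>

definition fibre_k :: "real \<Rightarrow> real \<Rightarrow> real^3 \<Rightarrow> real" where
  "fibre_k C h m = (if sqrt (discr C h m) + 1 + m$2 * m$3 > 0
     then ((m$1)\<^sup>2 - (2 * C - 4 * h)) / (sqrt (discr C h m) + 1 + m$2 * m$3)
     else (sqrt (discr C h m) - 1 - m$2 * m$3) / (m$3)\<^sup>2)"

lemma fibre_k:
  assumes "discr C h m \<ge> 0"
  shows "m$3 \<noteq> 0 \<Longrightarrow> fibre_k C h m = (sqrt (discr C h m) - 1 - m$2 * m$3) / (m$3)\<^sup>2"
    and "m$3 = 0 \<Longrightarrow> fibre_k C h m = ((m$1)\<^sup>2 - (2 * C - 4 * h)) / 2"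
proof -
  assume z: "m$3 \<noteq> 0"
  define r where "r = sqrt (discr C h m)"
  have "r\<^sup>2 = discr C h m" using assms by (simp add: r_def)
  then have "(r - 1 - m$2 * m$3) * (r + 1 + m$2 * m$3) = (m$3)\<^sup>2 * ((m$1)\<^sup>2 - (2 * C - 4 * h))"
    by (simp add: discr_def power2_eq_square algebra_simps)
  then show "fibre_k C h m = (sqrt (discr C h m) - 1 - m$2 * m$3) / (m$3)\<^sup>2"
    unfolding fibre_k_def r_def[symmetric] using z by (simp add: frac_eq_eq mult.commute)
qed (simp add: fibre_k_def discr_equator)

text \<open>The two expressions are continuous on the open sets of nonzero \<open>m$3\<close> and of
  positive rationalised denominator, and these cover the domain.\<close>

lemma continuous_on_fibre_k: "continuous_on {m. casimir m = C \<and> discr C h m \<ge> 0} (fibre_k C h)"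
proof -
  define A where "A = {m. casimir m = C \<and> discr C h m \<ge> 0}"
  define U where "U = {m :: real^3. m$3 \<noteq> 0}"
  define V where "V = {m :: real^3. 0 < sqrt (discr C h m) + 1 + m$2 * m$3}"
  have rc: "continuous_on B (\<lambda>m. sqrt (discr C h m))" for B
    by (intro continuous_intros continuous_on_discr)
  have "open U" unfolding U_def by (intro open_Collect_neq continuous_intros)
  have "open V" unfolding V_def by (intro open_Collect_less continuous_intros continuous_on_discr)
  have A: "A = A \<inter> U \<union> A \<inter> V"
    using discr_equator by (auto simp: U_def V_def)
  have "continuous_on (A \<inter> U) (\<lambda>m. (sqrt (discr C h m) - 1 - m$2 * m$3) / (m$3)\<^sup>2)"
    by (intro continuous_intros rc continuous_on_discr) (auto simp: U_def)
  then have 1: "continuous_on (A \<inter> U) (fibre_k C h)"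
    by (rule continuous_on_eq) (use fibre_k(1) in \<open>auto simp: A_def U_def\<close>)
  have "continuous_on (A \<inter> V) (\<lambda>m. ((m$1)\<^sup>2 - (2 * C - 4 * h)) / (sqrt (discr C h m) + 1 + m$2 * m$3))"
    by (intro continuous_intros rc continuous_on_discr) (auto simp: V_def)
  then have 2: "continuous_on (A \<inter> V) (fibre_k C h)"
    by (rule continuous_on_eq) (auto simp: V_def fibre_k_def)
  have "continuous_on (A \<inter> U \<union> A \<inter> V) (fibre_k C h)"
    using 1 2 \<open>open U\<close> \<open>open V\<close> A
    by (intro continuous_on_Un_local_open) (auto simp: openin_open_Int A[symmetric])
  then show ?thesis using A by (simp add: A_def)
qed

text \<open>
  On a fibre circle \<open>z\<^sup>2 P\<^sup>2 + X\<^sup>2 = F\<close> with \<open>P = 2p - x\<close>, \<open>X = 2z\<^sup>2\<xi> - (1 + yz)\<close>, the slope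
  \<open>\<tau> = P / (\<surd>F - X)\<close> is a projective coordinate that stays valid on the equator, where \<open>\<tau> = \<infinity>\<close> is the
  added point \<open>N\<close>. The point \<open>e\<close> of the circle is \<open>\<tau>\<close> in terms of the double angle.
\<close>

definition fibre_D :: "real^2 \<Rightarrow> real^3 \<Rightarrow> real" where
  "fibre_D e m = ((1 + e$1) + (m$3)\<^sup>2 * (1 - e$1)) / 2"

text \<open>Write \<open>r\<close> for the square root of \<open>discr\<close> and let \<tau> be the
  tangent of half the angle of \<open>e\<close>. The circle equation and the slope give
  \<open>X = r * (z^2 \<tau>^2 - 1) / (1 + z^2 \<tau>^2)\<close>; solving for \<xi> leaves the
  numerator \<open>(1 + y z + r) \<tau>^2 - k\<close> over \<open>2 * (1 + z^2 \<tau>^2)\<close>,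
  where the constant term \<open>k\<close> is \<open>fibre_k\<close>. The half-angle formulas for
  \<open>1 + e$1\<close> and \<open>1 - e$1\<close> then clear \<tau> from numerator and
  denominator.\<close>

definition fibre_A :: "real \<Rightarrow> real \<Rightarrow> real^2 \<Rightarrow> real^3 \<Rightarrow> real" where
  "fibre_A C h e m = ((1 - e$1) * (1 + m$2 * m$3 + sqrt (discr C h m)) - fibre_k C h m * (1 + e$1)) / 4"

definition fibre_B :: "real \<Rightarrow> real \<Rightarrow> real^2 \<Rightarrow> real^3 \<Rightarrow> real" where
  "fibre_B C h e m = (m$1 * fibre_D e m + sqrt (discr C h m) * e$2) / 2"

definition fibre_map :: "real \<Rightarrow> real \<Rightarrow> (real^2) \<times> (real^3) \<Rightarrow> (real^3) \<times> (real^3)" where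
  "fibre_map C h = (\<lambda>(e, m). (inv_stereographic (fibre_A C h e m) (fibre_B C h e m) (fibre_D e m), m))"

lemma axis_circle: "norm (axis 1 1 :: real^2) = 1" "(axis 1 1 :: real^2) $ 1 = 1" "(axis 1 1 :: real^2) $ 2 = 0"
  by (simp_all add: norm_axis_1) (simp_all add: axis_def)

lemma circle_coords:
  assumes "norm (e :: real^2) = 1"
  shows "1 + e$1 \<ge> 0" "1 - e$1 \<ge> 0" "(e$2)\<^sup>2 = (1 + e$1) * (1 - e$1)"
proof -
  have e: "(e$1)\<^sup>2 + (e$2)\<^sup>2 = 1" using assms norm_square_vec2[of e] by simp
  then have "(e$1)\<^sup>2 \<le> 1" using zero_le_power2[of "e$2"] by linarith
  then show "1 + e$1 \<ge> 0" "1 - e$1 \<ge> 0" by (auto simp: abs_square_le_1 abs_le_iff)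
  show "(e$2)\<^sup>2 = (1 + e$1) * (1 - e$1)" using e by (simp add: power2_eq_square algebra_simps)
qed

lemma fibre_D_eq_0:
  assumes "norm (e :: real^2) = 1"
  shows "fibre_D e m \<ge> 0" "fibre_D e m = 0 \<longleftrightarrow> e$1 = -1 \<and> m$3 = 0"
proof -
  note c = circle_coords[OF assms]
  have nn: "(m$3)\<^sup>2 * (1 - e$1) \<ge> 0" using c by simp
  then show "fibre_D e m \<ge> 0" using c by (simp add: fibre_D_def)
  have "fibre_D e m = 0 \<longleftrightarrow> 1 + e$1 = 0 \<and> (m$3)\<^sup>2 * (1 - e$1) = 0"
    unfolding fibre_D_def using add_nonneg_eq_0_iff[OF c(1) nn] by simp
  then show "fibre_D e m = 0 \<longleftrightarrow> e$1 = -1 \<and> m$3 = 0" by auto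
qed

text \<open>Where \<open>fibre_D\<close> vanishes the first homogeneous coordinate does not, so the
  projective point is defined everywhere and the added point is reached.\<close>

lemma fibre_A_nonzero: "e$1 = -1 \<Longrightarrow> m$3 = 0 \<Longrightarrow> fibre_A C h e m = 1"
  by (simp add: fibre_A_def discr_equator)

text \<open>The projective coordinate is translated back into \<open>P\<close> and \<open>X\<close>.
  Off the equator the completed square then settles the level equation; on it that form says
  nothing, and the parabola is checked directly.\<close>

lemma fibre_map_circle:
  assumes "norm (e :: real^2) = 1" "casimir m = C" "discr C h m \<ge> 0" "fibre_D e m \<noteq> 0"
  shows "2 * (fibre_B C h e m / fibre_D e m) - m$1 = sqrt (discr C h m) * e$2 / fibre_D e m"
    and "m$3 \<noteq> 0 \<Longrightarrow> 2 * (m$3)\<^sup>2 * (fibre_A C h e m / fibre_D e m) - (1 + m$2 * m$3)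
      = sqrt (discr C h m) * ((m$3)\<^sup>2 * (1 - e$1) - (1 + e$1)) / (2 * fibre_D e m)"
    and "hamiltonian ((fibre_A C h e m / fibre_D e m, fibre_B C h e m / fibre_D e m), m) = h"
proof -
  define r where "r = sqrt (discr C h m)"
  define D where "D = fibre_D e m"
  define \<xi> where "\<xi> = fibre_A C h e m / D"
  define p where "p = fibre_B C h e m / D"
  have D: "D \<noteq> 0" using assms by (simp add: D_def)
  have r2: "r\<^sup>2 = discr C h m" using assms by (simp add: r_def)
  have D2: "2 * D = (1 + e$1) + (m$3)\<^sup>2 * (1 - e$1)" by (simp add: D_def fibre_D_def)
  note c = circle_coords[OF assms(1)]
  have P: "2 * p - m$1 = r * e$2 / D"
    using D by (simp add: p_def fibre_B_def r_def D_def field_simps)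
  then show "2 * (fibre_B C h e m / fibre_D e m) - m$1 = sqrt (discr C h m) * e$2 / fibre_D e m"
    by (simp add: p_def r_def D_def)
  have X: "2 * (m$3)\<^sup>2 * \<xi> - (1 + m$2 * m$3) = r * ((m$3)\<^sup>2 * (1 - e$1) - (1 + e$1)) / (2 * D)" if z: "m$3 \<noteq> 0"
  proof -
    have zk: "(m$3)\<^sup>2 * fibre_k C h m = r - 1 - m$2 * m$3"
      using fibre_k(1)[OF assms(3) z] z by (simp add: r_def)
    have A4: "4 * fibre_A C h e m = (1 - e$1) * (1 + m$2 * m$3 + r) - fibre_k C h m * (1 + e$1)"
      by (simp add: fibre_A_def r_def)
    have "4 * ((m$3)\<^sup>2 * fibre_A C h e m) = (m$3)\<^sup>2 * (4 * fibre_A C h e m)" by simp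
    also have "\<dots> = (m$3)\<^sup>2 * (1 - e$1) * (1 + m$2 * m$3 + r) - ((m$3)\<^sup>2 * fibre_k C h m) * (1 + e$1)"
      unfolding A4 by (simp add: algebra_simps)
    finally have A5: "4 * ((m$3)\<^sup>2 * fibre_A C h e m)
        = (m$3)\<^sup>2 * (1 - e$1) * (1 + m$2 * m$3 + r) - ((m$3)\<^sup>2 * fibre_k C h m) * (1 + e$1)" .
    have "2 * (2 * (m$3)\<^sup>2 * fibre_A C h e m - (1 + m$2 * m$3) * D) = 4 * ((m$3)\<^sup>2 * fibre_A C h e m) - (1 + m$2 * m$3) * (2 * D)"
      by (simp add: algebra_simps)
    also have "\<dots> = r * ((m$3)\<^sup>2 * (1 - e$1) - (1 + e$1))"
      unfolding A5 D2 zk by (simp add: algebra_simps)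
    finally have N: "2 * (2 * (m$3)\<^sup>2 * fibre_A C h e m - (1 + m$2 * m$3) * D) = r * ((m$3)\<^sup>2 * (1 - e$1) - (1 + e$1))" .
    have "2 * (m$3)\<^sup>2 * \<xi> - (1 + m$2 * m$3) = 2 * (2 * (m$3)\<^sup>2 * fibre_A C h e m - (1 + m$2 * m$3) * D) / (2 * D)"
      using D by (simp add: \<xi>_def diff_divide_distrib)
    then show ?thesis unfolding N .
  qed
  then show "2 * (m$3)\<^sup>2 * (fibre_A C h e m / fibre_D e m) - (1 + m$2 * m$3)
      = sqrt (discr C h m) * ((m$3)\<^sup>2 * (1 - e$1) - (1 + e$1)) / (2 * fibre_D e m)" if "m$3 \<noteq> 0"
    using that by (simp add: \<xi>_def r_def D_def)
  have "hamiltonian ((\<xi>, p), m) = h"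
    unfolding hamiltonian_level[OF assms(2)]
  proof (cases "m$3 = 0")
    case z: False
    have "(m$3)\<^sup>2 * (2 * p - m$1)\<^sup>2 + (2 * (m$3)\<^sup>2 * \<xi> - (1 + m$2 * m$3))\<^sup>2
        = r\<^sup>2 * (4 * (m$3)\<^sup>2 * (e$2)\<^sup>2 + ((m$3)\<^sup>2 * (1 - e$1) - (1 + e$1))\<^sup>2) / (2 * D)\<^sup>2"
    proof -
      have "w * (r * s / D)\<^sup>2 + (r * Q / (2 * D))\<^sup>2 = r\<^sup>2 * (4 * w * s\<^sup>2 + Q\<^sup>2) / (2 * D)\<^sup>2" for w s Q
        using D by (simp add: power_divide power_mult_distrib field_simps)
      then show ?thesis unfolding P X[OF z] .
    qed
    \<comment> \<open>With \<open>a = 1 + e$1\<close> and \<open>b = z^2 * (1 - e$1)\<close> this is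
      \<open>4 a b + (b - a)^2 = (a + b)^2\<close>.\<close>
    also have "4 * (m$3)\<^sup>2 * (e$2)\<^sup>2 + ((m$3)\<^sup>2 * (1 - e$1) - (1 + e$1))\<^sup>2 = (2 * D)\<^sup>2"
      unfolding D2 c(3) by (simp add: power2_eq_square algebra_simps)
    finally have "(m$3)\<^sup>2 * (2 * p - m$1)\<^sup>2 + (2 * (m$3)\<^sup>2 * \<xi> - (1 + m$2 * m$3))\<^sup>2 = discr C h m"
      using D r2 by simp
    then show "(2 * p - m$1)\<^sup>2 / 2 - (m$1)\<^sup>2 / 2 + 2 * (m$3)\<^sup>2 * \<xi>\<^sup>2 - 2 * \<xi> * (1 + m$2 * m$3) + (C - 2 * h) = 0"
      unfolding level_completed_square_iff[OF z] discr_def .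
  next
    \<comment> \<open>Here \<open>r = 1\<close>, and the equation is linear in \<xi>.\<close>
    case z: True
    have r1: "r = 1" using z by (simp add: r_def discr_equator)
    have Dz: "2 * D = 1 + e$1" using D2 z by simp
    define w where "w = (1 - e$1) / D"
    have P2: "(2 * p - m$1)\<^sup>2 = 2 * w"
      unfolding w_def
      unfolding P power_divide power_mult_distrib c(3) Dz[symmetric] r1 using D by (simp add: power2_eq_square)
    have k: "fibre_k C h m = ((m$1)\<^sup>2 - (2 * C - 4 * h)) / 2" by (rule fibre_k(2)[OF assms(3) z])
    have "2 * \<xi> = w - fibre_k C h m"
      using D by (simp add: w_def \<xi>_def fibre_A_def r_def[symmetric] r1 z Dz[symmetric] field_simps)
    then show "(2 * p - m$1)\<^sup>2 / 2 - (m$1)\<^sup>2 / 2 + 2 * (m$3)\<^sup>2 * \<xi>\<^sup>2 - 2 * \<xi> * (1 + m$2 * m$3) + (C - 2 * h) = 0"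
      unfolding P2 k using z by simp (simp add: field_simps)
  qed
  then show "hamiltonian ((fibre_A C h e m / fibre_D e m, fibre_B C h e m / fibre_D e m), m) = h"
    by (simp add: \<xi>_def p_def D_def)
qed

lemma level_discr_nonneg:
  assumes "hamiltonian ((\<xi>, p), m) = h" "casimir m = C"
  shows "(m$3)\<^sup>2 * (2 * p - m$1)\<^sup>2 + (2 * (m$3)\<^sup>2 * \<xi> - (1 + m$2 * m$3))\<^sup>2 = discr C h m"
    and "discr C h m \<ge> 0"
proof -
  show *: "(m$3)\<^sup>2 * (2 * p - m$1)\<^sup>2 + (2 * (m$3)\<^sup>2 * \<xi> - (1 + m$2 * m$3))\<^sup>2 = discr C h m"
    using assms level_completed_square unfolding hamiltonian_level[OF assms(2)] discr_def by blast
  show "discr C h m \<ge> 0" unfolding *[symmetric] by (intro add_nonneg_nonneg mult_nonneg_nonneg) auto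
qed

text \<open>Off the equator \<open>X\<close> determines \<xi>; on it the fibre is a parabola, a
  graph over the \<open>p\<close>-axis.\<close>

lemma level_unique:
  assumes "hamiltonian ((\<xi>, p), m) = h" "hamiltonian ((\<xi>', p), m) = h" "casimir m = C"
    and "m$3 \<noteq> 0 \<Longrightarrow> 2 * (m$3)\<^sup>2 * \<xi> - (1 + m$2 * m$3) = 2 * (m$3)\<^sup>2 * \<xi>' - (1 + m$2 * m$3)"
  shows "\<xi> = \<xi>'"
proof (cases "m$3 = 0")
  case True
  then show ?thesis using assms(1,2) unfolding hamiltonian_level[OF assms(3)] by simp
next
  case False
  then show ?thesis using assms(4) by simp
qed

text \<open>The direction \<open>(r - X, P)\<close> has slope \<tau>, and \<open>e\<close> is its
  double angle. A circle of radius 0 and the point \<open>X = r\<close>, where the slope is not a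
  number, are treated apart.\<close>

lemma fibre_map_onto:
  assumes "hamiltonian ((\<xi>, p), m) = h" "casimir m = C"
  shows "\<exists>e. norm e = 1 \<and> fibre_D e m \<noteq> 0 \<and> fibre_A C h e m / fibre_D e m = \<xi> \<and> fibre_B C h e m / fibre_D e m = p"
proof -
  define r where "r = sqrt (discr C h m)"
  define P where "P = 2 * p - m$1"
  define X where "X = 2 * (m$3)\<^sup>2 * \<xi> - (1 + m$2 * m$3)"
  have nn: "discr C h m \<ge> 0" by (rule level_discr_nonneg[OF assms])
  have circ: "(m$3)\<^sup>2 * P\<^sup>2 + X\<^sup>2 = r\<^sup>2" using level_discr_nonneg[OF assms] by (simp add: P_def X_def r_def)
  have r0: "r \<ge> 0" using nn by (simp add: r_def)
  have z0: "m$3 = 0 \<Longrightarrow> X = -1 \<and> r = 1" by (simp add: X_def r_def discr_equator)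
  have *: ?thesis if e: "norm e = 1" "fibre_D e m \<noteq> 0" "r * e$2 / fibre_D e m = P"
    "m$3 \<noteq> 0 \<Longrightarrow> r * ((m$3)\<^sup>2 * (1 - e$1) - (1 + e$1)) / (2 * fibre_D e m) = X" for e
  proof -
    note fc = fibre_map_circle[OF e(1) assms(2) nn e(2)]
    have p: "fibre_B C h e m / fibre_D e m = p"
      using fc(1) e(3) by (simp add: r_def[symmetric] P_def)
    moreover have "fibre_A C h e m / fibre_D e m = \<xi>"
      by (rule level_unique[OF fc(3)[unfolded p] assms]) (use fc(2) e(4) in \<open>simp add: r_def X_def\<close>)
    ultimately show ?thesis using e(1,2) by blast
  qed
  show ?thesis
  proof (cases "r = 0")
    case True
    \<comment> \<open>The circle is a single point here, and any direction serves.\<close>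
    then have "m$3 \<noteq> 0" using z0 by auto
    moreover from this have "P = 0" "X = 0"
      using circ True by (auto simp: sum_power2_eq_zero_iff power_mult_distrib[symmetric])
    ultimately show ?thesis
      using True by (intro *[of "axis 1 1"]) (auto simp: fibre_D_def axis_circle)
  next
    case r: False
    define c where "c = r - X"
    show ?thesis
    proof (cases "c = 0")
      case True
      \<comment> \<open>The slope is infinite, so the direction is
        \<open>e = (-1, 0)\<close>.\<close>
      then have X: "X = r" by (simp add: c_def)
      then have z: "m$3 \<noteq> 0" using z0 by auto
      then have "P = 0" using circ X by simp
      moreover have D: "fibre_D (- axis 1 1) m = (m$3)\<^sup>2" by (simp add: fibre_D_def axis_circle)
      ultimately show ?thesis
        using z X by (intro *[of "- axis 1 1"]) (auto simp: D axis_circle)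
    next
      case c: False
      define n where "n = c\<^sup>2 + P\<^sup>2"
      have n: "n > 0" using c by (simp add: n_def add_pos_nonneg)
      \<comment> \<open>Cosine and sine of twice the angle of \<open>(c, P)\<close>.\<close>
      define e :: "real^2" where "e = vector [(c\<^sup>2 - P\<^sup>2) / n, 2 * c * P / n]"
      have e1: "1 + e$1 = 2 * c\<^sup>2 / n" "1 - e$1 = 2 * P\<^sup>2 / n" "e$2 = 2 * c * P / n"
      proof -
        have "1 + (c\<^sup>2 - P\<^sup>2) / n = (n + (c\<^sup>2 - P\<^sup>2)) / n" "1 - (c\<^sup>2 - P\<^sup>2) / n = (n - (c\<^sup>2 - P\<^sup>2)) / n"
          using n by (simp_all add: add_divide_distrib diff_divide_distrib)
        moreover have "n + (c\<^sup>2 - P\<^sup>2) = 2 * c\<^sup>2" "n - (c\<^sup>2 - P\<^sup>2) = 2 * P\<^sup>2" by (simp_all add: n_def)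
        ultimately show "1 + e$1 = 2 * c\<^sup>2 / n" "1 - e$1 = 2 * P\<^sup>2 / n" "e$2 = 2 * c * P / n"
          by (simp_all add: e_def)
      qed
      have "(c\<^sup>2 - P\<^sup>2)\<^sup>2 + (2 * c * P)\<^sup>2 = n\<^sup>2" by (simp add: n_def power2_eq_square algebra_simps)
      then have "(norm e)\<^sup>2 = 1"
        using n by (simp add: norm_square_vec2 e_def power_divide add_divide_distrib[symmetric])
      then have ne: "norm e = 1" by (simp add: power2_eq_1_iff) (smt (verit) norm_ge_zero)
      have zP: "(m$3)\<^sup>2 * P\<^sup>2 = c * (r + X)" using circ by (simp add: c_def power2_eq_square algebra_simps)
      have "fibre_D e m = (c\<^sup>2 + (m$3)\<^sup>2 * P\<^sup>2) / n"
        unfolding fibre_D_def e1 using n by (simp add: field_simps)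
      also have "c\<^sup>2 + (m$3)\<^sup>2 * P\<^sup>2 = 2 * r * c" unfolding zP by (simp add: c_def power2_eq_square algebra_simps)
      finally have D: "fibre_D e m = 2 * r * c / n" .
      have num: "(m$3)\<^sup>2 * (1 - e$1) - (1 + e$1) = 4 * c * X / n"
      proof -
        have "(m$3)\<^sup>2 * (1 - e$1) - (1 + e$1) = 2 * ((m$3)\<^sup>2 * P\<^sup>2 - c\<^sup>2) / n"
          unfolding e1 using n by (simp add: field_simps)
        also have "(m$3)\<^sup>2 * P\<^sup>2 - c\<^sup>2 = 2 * c * X" unfolding zP by (simp add: c_def power2_eq_square algebra_simps)
        finally show ?thesis by simp
      qed
      show ?thesis
        using n r c by (intro *[OF ne]) (auto simp: D e1(3) num)
    qed
  qed
qed

text \<open>The north pole occurs only for \<open>e = (-1, 0)\<close>. Elsewhere equal images give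
  equal \<open>P\<close> and, off the equator, equal \<open>X\<close>; since \<open>r > 0\<close>,
  these determine \<alpha> and \<beta>, namely \<open>1 + e$1\<close> and \<open>1 - e$1\<close>
  divided by \<open>2 * fibre_D\<close>. On the equator \<alpha> is 1 and \<beta> follows from the
  square of \<open>P\<close>. The sum of both is the reciprocal of \<open>fibre_D\<close>, which
  returns \<open>e\<close>.\<close>

lemma fibre_map_eq:
  assumes "norm e = 1" "norm e' = 1" "casimir m = C" "discr C h m > 0"
    and eq: "fibre_map C h (e, m) = fibre_map C h (e', m)"
  shows "e = e'"
proof -
  define r where "r = sqrt (discr C h m)"
  have r: "r > 0" using assms by (simp add: r_def)
  have nn: "discr C h m \<ge> 0" using assms by simp
  let ?i = "\<lambda>e. inv_stereographic (fibre_A C h e m) (fibre_B C h e m) (fibre_D e m)"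
  have i: "?i e = ?i e'" using eq by (simp add: fibre_map_def)
  have north: "?i f = north_pole \<longleftrightarrow> fibre_D f m = 0" if "norm f = 1" for f :: "real^2"
  proof (cases "fibre_D f m = 0")
    case True
    then have "fibre_A C h f m = 1" using fibre_D_eq_0[OF that] fibre_A_nonzero by blast
    then show ?thesis using True inv_stereographic_north by simp
  next
    case False
    then show ?thesis using stereographic_inv(2) by simp
  qed
  show ?thesis
  proof (cases "fibre_D e m = 0")
    case True
    then have "fibre_D e' m = 0" using north assms(1,2) i by metis
    then have e1: "e$1 = -1" "e'$1 = -1" using True fibre_D_eq_0 assms by auto
    then have "e$2 = 0" "e'$2 = 0"
      using circle_coords(3)[OF assms(1)] circle_coords(3)[OF assms(2)] by auto
    then show ?thesis using e1 by (simp add: vec_eq_iff forall_2)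
  next
    case D: False
    then have D': "fibre_D e' m \<noteq> 0" using north assms(1,2) i by metis
    have AB: "fibre_A C h e m / fibre_D e m = fibre_A C h e' m / fibre_D e' m"
      "fibre_B C h e m / fibre_D e m = fibre_B C h e' m / fibre_D e' m"
      using stereographic_inv(1)[OF D] stereographic_inv(1)[OF D'] i by (metis prod.inject)+
    note fc = fibre_map_circle[OF assms(1,3) nn D] fibre_map_circle[OF assms(2,3) nn D']
    define \<alpha> where "\<alpha> = (1 + e$1) / (2 * fibre_D e m)"
    define \<alpha>' where "\<alpha>' = (1 + e'$1) / (2 * fibre_D e' m)"
    define \<beta> where "\<beta> = (1 - e$1) / (2 * fibre_D e m)"
    define \<beta>' where "\<beta>' = (1 - e'$1) / (2 * fibre_D e' m)"
    have "r * (e$2 / fibre_D e m) = r * (e'$2 / fibre_D e' m)"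
      using fc(1,4) AB(2) by (simp add: r_def[symmetric])
    then have s: "e$2 / fibre_D e m = e'$2 / fibre_D e' m"
      using r by (metis less_irrefl mult_left_cancel)
    have one: "\<alpha> + (m$3)\<^sup>2 * \<beta> = 1" "\<alpha>' + (m$3)\<^sup>2 * \<beta>' = 1"
      unfolding \<alpha>_def \<alpha>'_def \<beta>_def \<beta>'_def
      using D D' by (simp_all add: fibre_D_def add_divide_distrib[symmetric])
    have ab: "4 * (\<alpha> * \<beta>) = (e$2 / fibre_D e m)\<^sup>2" "4 * (\<alpha>' * \<beta>') = (e'$2 / fibre_D e' m)\<^sup>2"
      unfolding power_divide circle_coords(3)[OF assms(1)] circle_coords(3)[OF assms(2)]
      by (simp_all add: \<alpha>_def \<beta>_def \<alpha>'_def \<beta>'_def power2_eq_square)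
    have "\<alpha> = \<alpha>' \<and> \<beta> = \<beta>'"
    proof (cases "m$3 = 0")
      case True
      then show ?thesis using one ab s by auto
    next
      case False
      have "r * ((m$3)\<^sup>2 * (1 - e$1) - (1 + e$1)) / (2 * fibre_D e m) = r * ((m$3)\<^sup>2 * (1 - e'$1) - (1 + e'$1)) / (2 * fibre_D e' m)"
        using fc(2,5)[OF False] AB(1) by (simp add: r_def[symmetric])
      then have "r * ((m$3)\<^sup>2 * \<beta> - \<alpha>) = r * ((m$3)\<^sup>2 * \<beta>' - \<alpha>')"
        by (simp add: \<alpha>_def \<alpha>'_def \<beta>_def \<beta>'_def diff_divide_distrib right_diff_distrib)
      then have "(m$3)\<^sup>2 * \<beta> - \<alpha> = (m$3)\<^sup>2 * \<beta>' - \<alpha>'" using r by simp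
      then have a: "\<alpha> = \<alpha>'" "(m$3)\<^sup>2 * \<beta> = (m$3)\<^sup>2 * \<beta>'" using one by linarith+
      then show ?thesis using False by simp
    qed
    moreover have "\<alpha> + \<beta> = 1 / fibre_D e m" "\<alpha>' + \<beta>' = 1 / fibre_D e' m"
      by (simp_all add: \<alpha>_def \<alpha>'_def \<beta>_def \<beta>'_def add_divide_distrib[symmetric])
    ultimately have DD: "fibre_D e m = fibre_D e' m" and "\<alpha> = \<alpha>'" using D D' by auto
    then have "e$1 = e'$1" "e$2 = e'$2" using s D by (auto simp: \<alpha>_def \<alpha>'_def)
    then show ?thesis by (simp add: vec_eq_iff forall_2)
  qed
qed

text \<open>With radius 0 only the centre of the circle is left, and it does not depend on
  \<open>e\<close>. The equator is avoided, since the discriminant is 1 there.\<close>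

lemma fibre_map_collapse:
  assumes "norm e = 1" "casimir m = C" "discr C h m = 0"
  shows "fibre_map C h (e, m) = (inv_stereographic ((1 + m$2 * m$3) / (2 * (m$3)\<^sup>2)) (m$1 / 2) 1, m)"
proof -
  have z: "m$3 \<noteq> 0" using assms(3) discr_equator[of m C h] by auto
  then have D: "fibre_D e m \<noteq> 0" using fibre_D_eq_0[OF assms(1)] by simp
  note fc = fibre_map_circle[OF assms(1,2) _ D, of h]
  have "2 * (fibre_B C h e m / fibre_D e m) - m$1 = 0" using fc(1) by (simp add: assms(3))
  then have "fibre_B C h e m / fibre_D e m = m$1 / 2" by linarith
  moreover have "fibre_A C h e m / fibre_D e m = (1 + m$2 * m$3) / (2 * (m$3)\<^sup>2)"
    using fc(2) z assms(3) by (simp add: field_simps)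
  ultimately show ?thesis
    by (simp only: fibre_map_def split_conv inv_stereographic_scale[OF D])
qed

text \<open>Both spaces are images of the circle times the region \<open>discr \<ge> 0\<close>, and
  in both the circle is collapsed exactly where \<open>discr\<close> vanishes. That the
  parametrisation also covers the added points makes the description uniform across the
  equator.\<close>

lemma compactified_level_homeomorphic:
  assumes "C > 0"
  shows "top_of_set (compactified_level C h) homeomorphic_space
    top_of_set {(v :: real^2, m :: real^3). casimir m = C \<and> (norm v)\<^sup>2 = discr C h m}"
    and "snd ` compactified_level C h = {m. casimir m = C \<and> discr C h m \<ge> 0}"
proof -
  define A where "A = {m. casimir m = C \<and> discr C h m \<ge> 0}"
  define K where "K = sphere (0 :: real^2) 1 \<times> A"
  define q' where "q' = (\<lambda>(e :: real^2, m). (sqrt (discr C h m) *\<^sub>R e, m))"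
  have ck: "continuous_on A (fibre_k C h)" unfolding A_def by (rule continuous_on_fibre_k)
  have "A = casimir_sphere C \<inter> {m. 0 \<le> discr C h m}" by (auto simp: A_def casimir_sphere_def)
  moreover have "closed {m. 0 \<le> discr C h m}" by (intro closed_Collect_le continuous_intros continuous_on_discr)
  ultimately have "compact A" using assms by (simp add: casimir_sphere_eq compact_Int_closed)
  then have K: "compact K" unfolding K_def by (intro compact_Times) auto
  have S0: "(fibre_A C h e m)\<^sup>2 + (fibre_B C h e m)\<^sup>2 + (fibre_D e m)\<^sup>2 \<noteq> 0" if "(e, m) \<in> K" for e m
  proof
    assume "(fibre_A C h e m)\<^sup>2 + (fibre_B C h e m)\<^sup>2 + (fibre_D e m)\<^sup>2 = 0"
    then have "fibre_D e m = 0" "fibre_A C h e m = 0" by (smt (verit) zero_le_power2 power_eq_0_iff)+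
    moreover have "norm e = 1" using that by (simp add: K_def)
    ultimately show False using fibre_D_eq_0 fibre_A_nonzero by (metis zero_neq_one)
  qed
  have ckK: "continuous_on K (\<lambda>x. fibre_k C h (snd x))"
    by (intro continuous_on_compose2[OF ck] continuous_intros) (auto simp: K_def)
  have cdK: "continuous_on K (\<lambda>x. discr C h (snd x))"
    by (intro continuous_on_compose2[OF continuous_on_discr[of UNIV]] continuous_intros) auto
  have cD: "continuous_on K (\<lambda>x. fibre_D (fst x) (snd x))"
    unfolding fibre_D_def by (intro continuous_intros) auto
  have cA: "continuous_on K (\<lambda>x. fibre_A C h (fst x) (snd x))"
    unfolding fibre_A_def by (intro continuous_intros ckK cdK) auto
  have cB: "continuous_on K (\<lambda>x. fibre_B C h (fst x) (snd x))"
    unfolding fibre_B_def by (intro continuous_intros cD cdK) auto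
  have q: "continuous_on K (fibre_map C h)"
    unfolding fibre_map_def inv_stereographic_def Let_def case_prod_beta
    by (intro continuous_on_Pair continuous_on_vec3 continuous_intros cA cB cD) (use S0 in \<open>auto simp: case_prod_beta\<close>)
  have q': "continuous_on K q'"
    unfolding q'_def case_prod_beta by (intro continuous_intros cdK)
  have eq: "fibre_map C h a = fibre_map C h b \<longleftrightarrow> q' a = q' b" if "a \<in> K" "b \<in> K" for a b
  proof -
    obtain e m e' m' where ab: "a = (e, m)" "b = (e', m')" by (cases a; cases b)
    have m: "norm e = 1" "norm e' = 1" "casimir m = C" "discr C h m \<ge> 0"
      using that by (auto simp: ab K_def A_def)
    show ?thesis
    proof (cases "m = m'")
      case False
      then show ?thesis by (simp add: ab fibre_map_def q'_def)
    next
      case True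
      show ?thesis
      proof (cases "discr C h m = 0")
        case t: True
        then show ?thesis using fibre_map_collapse[of _ m C h] m True by (simp add: ab q'_def)
      next
        case False
        then have "discr C h m > 0" using m by simp
        from fibre_map_eq[OF m(1,2,3) this] this True show ?thesis by (auto simp: ab q'_def)
      qed
    qed
  qed
  have im': "q' ` K = {(v, m). casimir m = C \<and> (norm v)\<^sup>2 = discr C h m}"
  proof (intro equalityI subsetI)
    fix w assume "w \<in> q' ` K"
    then show "w \<in> {(v, m). casimir m = C \<and> (norm v)\<^sup>2 = discr C h m}"
      by (auto simp: q'_def K_def A_def)
  next
    fix w :: "(real^2) \<times> (real^3)" assume "w \<in> {(v, m). casimir m = C \<and> (norm v)\<^sup>2 = discr C h m}"
    then obtain v m where w: "w = (v, m)" "casimir m = C" "(norm v)\<^sup>2 = discr C h m" by auto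
    have "m \<in> A" using w(2) w(3)[symmetric] by (simp add: A_def)
    show "w \<in> q' ` K"
    proof (cases "v = 0")
      case True
      then show ?thesis using w \<open>m \<in> A\<close>
        by (intro image_eqI[of _ _ "(axis 1 1, m)"]) (auto simp: q'_def K_def)
    next
      case False
      then show ?thesis using w(1) w(3)[symmetric] \<open>m \<in> A\<close>
        by (intro image_eqI[of _ _ "(v /\<^sub>R norm v, m)"]) (auto simp: q'_def K_def)
    qed
  qed
  have im: "fibre_map C h ` K = compactified_level C h"
  proof (intro equalityI subsetI)
    fix w assume "w \<in> fibre_map C h ` K"
    then obtain e m where em: "(e, m) \<in> K" "w = fibre_map C h (e, m)" by auto
    then have m: "norm e = 1" "casimir m = C" "discr C h m \<ge> 0" by (auto simp: K_def A_def)
    show "w \<in> compactified_level C h"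
    proof (cases "fibre_D e m = 0")
      case True
      then have "e$1 = -1 \<and> m$3 = 0" using fibre_D_eq_0[OF m(1)] by simp
      moreover from this have "fibre_A C h e m = 1" using fibre_A_nonzero by blast
      ultimately show ?thesis
        using True m inv_stereographic_north[of 1 "fibre_B C h e m"]
        by (simp add: em fibre_map_def compactified_level_def casimir_sphere_def)
    next
      case False
      then show ?thesis
        using fibre_map_circle(3)[OF m False] stereographic_inv[OF False] inv_stereographic_sphere[OF S0[OF em(1)]] m
        by (simp add: em fibre_map_def compactified_level_def level_set_def)
    qed
  next
    fix w assume "w \<in> compactified_level C h"
    then consider Q m where "w = (Q, m)" "Q \<in> sphere 0 1" "Q \<noteq> north_pole" "(stereographic Q, m) \<in> level_set C h"
      | m where "w = (north_pole, m)" "casimir m = C" "m$3 = 0"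
      unfolding compactified_level_def casimir_sphere_def by auto
    then show "w \<in> fibre_map C h ` K"
    proof cases
      case 1
      define \<xi> p where "\<xi> = fst (stereographic Q)" and "p = snd (stereographic Q)"
      have H: "hamiltonian ((\<xi>, p), m) = h" "casimir m = C" using 1(4) by (auto simp: level_set_def \<xi>_def p_def)
      obtain e where e: "norm e = 1" "fibre_D e m \<noteq> 0" "fibre_A C h e m / fibre_D e m = \<xi>" "fibre_B C h e m / fibre_D e m = p"
        using fibre_map_onto[OF H] by blast
      have "(e, m) \<in> K" using e(1) H level_discr_nonneg(2)[OF H] by (simp add: K_def A_def)
      moreover have "fibre_map C h (e, m) = w"
        using inv_stereographic_scale[OF e(2)] inv_stereographic_stereographic[OF 1(2,3)]
        by (simp add: fibre_map_def 1(1) e(3,4) \<xi>_def p_def)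
      ultimately show ?thesis by (metis imageI)
    next
      case 2
      \<comment> \<open>Infinite slope, the parameter of the added point.\<close>
      define e :: "real^2" where "e = - axis 1 1"
      have e: "e$1 = -1" "norm e = 1" by (simp_all add: e_def axis_circle)
      then have "fibre_D e m = 0" using fibre_D_eq_0(2)[OF e(2)] 2 by blast
      moreover have "fibre_A C h e m = 1" using fibre_A_nonzero e 2 by blast
      ultimately have "fibre_map C h (e, m) = w"
        using inv_stereographic_north[of 1 "fibre_B C h e m"] by (simp add: fibre_map_def 2)
      moreover have "(e, m) \<in> K" using e 2 by (simp add: K_def A_def discr_equator)
      ultimately show ?thesis by (metis imageI)
    qed
  qed
  show "top_of_set (compactified_level C h) homeomorphic_space
    top_of_set {(v :: real^2, m :: real^3). casimir m = C \<and> (norm v)\<^sup>2 = discr C h m}"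
    using homeomorphic_space_same_fibres[OF K q q' eq] unfolding im im' .
  have "snd ` K = A" by (simp add: K_def)
  moreover have "snd (fibre_map C h x) = snd x" for x by (simp add: fibre_map_def case_prod_beta)
  ultimately show "snd ` compactified_level C h = {m. casimir m = C \<and> discr C h m \<ge> 0}"
    unfolding im[symmetric] A_def[symmetric] by (simp add: image_image)
qed

subsection \<open>Disks in the complement of the image\<close>

text \<open>An open disk is closed in the union because its compact closed disk meets no other open
  disk; then it is clopen and connected. Separation is asked between a closed and an open disk,
  which also covers disks that touch along their boundaries.\<close>

lemma minus_open_disks_components:
  fixes S A :: "(real^3) set"
  assumes cont: "\<And>i. i < k \<Longrightarrow> continuous_on (cball 0 1) (e i)"
    and inj: "\<And>i. i < k \<Longrightarrow> inj_on (e i) (cball 0 1)"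
    and sep: "\<And>i j. i < k \<Longrightarrow> j < k \<Longrightarrow> i \<noteq> j \<Longrightarrow> e i ` cball 0 1 \<inter> e j ` ball 0 1 = {}"
    and U: "U = (\<Union>i<k. (e i :: real^2 \<Rightarrow> real^3) ` ball 0 1)"
  shows "components U = (\<lambda>i. e i ` ball 0 1) ` {..<k}" "card (components U) = k"
proof -
  define B where "B = (\<lambda>i. e i ` ball 0 1)"
  have ne: "B i \<noteq> {}" for i by (simp add: B_def)
  have sub: "B i \<subseteq> U" if "i < k" for i using that by (auto simp: U B_def)
  have conn: "connected (B i)" if "i < k" for i
    unfolding B_def
    by (intro connected_continuous_image continuous_on_subset[OF cont[OF that]]) auto
  have cl: "closedin (top_of_set U) (B i)" if "i < k" for i
  proof -
    have "compact (e i ` cball 0 1)" using cont[OF that] by (intro compact_continuous_image) auto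
    moreover have "B i = U \<inter> e i ` cball 0 1"
    proof (intro equalityI subsetI)
      fix x assume "x \<in> B i"
      then show "x \<in> U \<inter> e i ` cball 0 1" using sub[OF that] by (auto simp: B_def)
    next
      fix x assume x: "x \<in> U \<inter> e i ` cball 0 1"
      then obtain j where "j < k" "x \<in> B j" by (auto simp: U B_def)
      then show "x \<in> B i" using sep[OF that, of j] x by (cases "j = i") (auto simp: B_def)
    qed
    ultimately show ?thesis by (simp add: closedin_closed_Int compact_imp_closed)
  qed
  have disj: "B i \<inter> B j = {}" if "i < k" "j < k" "i \<noteq> j" for i j
    using sep[OF that] image_mono[OF ball_subset_cball[of 0 1], of "e i"] unfolding B_def by blast
  have op: "openin (top_of_set U) (B i)" if "i < k" for i
  proof -
    have "U - B i = (\<Union>j\<in>{..<k} - {i}. B j)" using disj that by (auto simp: U B_def)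
    moreover have "closedin (top_of_set U) (\<Union>j\<in>{..<k} - {i}. B j)"
      by (intro closedin_Union) (auto intro: cl)
    ultimately show ?thesis using sub[OF that] by (simp add: openin_closedin_eq)
  qed
  have comp: "B i \<in> components U" if "i < k" for i
    unfolding in_components_maximal
  proof (intro conjI allI impI ne sub[OF that] conn[OF that])
    fix T assume T: "T \<noteq> {} \<and> B i \<subseteq> T \<and> T \<subseteq> U \<and> connected T"
    then have "openin (top_of_set T) (T \<inter> B i)" "closedin (top_of_set T) (T \<inter> B i)"
      using op[OF that] cl[OF that] openin_subset_trans closedin_subset_trans
      by (metis inf.absorb_iff2 inf_commute openin_subset_trans, metis inf.absorb_iff2 inf_commute closedin_subset_trans)
    then have "T \<inter> B i = T" using T ne[of i] connected_clopen[of T] by blast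
    then show "T = B i" using T by blast
  qed
  have "components U = B ` {..<k}"
  proof (intro equalityI subsetI)
    fix c assume c: "c \<in> components U"
    then obtain x where "x \<in> c" "x \<in> U" using in_components_nonempty in_components_subset by blast
    then obtain i where "i < k" "x \<in> B i" by (auto simp: U B_def)
    then show "c \<in> B ` {..<k}" using components_nonoverlap[OF c comp] \<open>x \<in> c\<close> by blast
  qed (use comp in auto)
  then show "components U = (\<lambda>i. e i ` ball 0 1) ` {..<k}" by (simp add: B_def)
  have "inj_on B {..<k}" using disj ne by (intro inj_onI) (metis inf.idem lessThan_iff)
  then show "card (components U) = k"
    using \<open>components U = B ` {..<k}\<close> by (simp add: card_image)
qed

text \<open>Two invariants of the image: the first makes the number of disks unambiguous, the second
  excludes a complement whose disks touch.\<close>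

lemma minus_open_disks_imp:
  assumes "minus_open_disks k S A"
  shows "card (components (S - A)) = k"
    and "\<lbrakk>c \<in> components (S - A); c' \<in> components (S - A); c \<noteq> c'\<rbrakk> \<Longrightarrow> closure c \<inter> closure c' = {}"
proof -
  obtain e :: "nat \<Rightarrow> real^2 \<Rightarrow> real^3" where
    e: "\<And>i. i < k \<Longrightarrow> continuous_on (cball 0 1) (e i)" "\<And>i. i < k \<Longrightarrow> inj_on (e i) (cball 0 1)"
      "\<And>i. i < k \<Longrightarrow> e i ` cball 0 1 \<subseteq> S"
    and disj: "disjoint_family_on (\<lambda>i. e i ` cball 0 1) {..<k}"
    and A: "A = S - (\<Union>i<k. e i ` ball 0 1)"
    using assms unfolding minus_open_disks_def by metis
  have sub: "e i ` ball 0 1 \<subseteq> e i ` cball 0 1" for i by auto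
  have "S - A = (\<Union>i<k. e i ` ball 0 1)" using e(3) sub A by blast
  moreover have "e i ` cball 0 1 \<inter> e j ` ball 0 1 = {}" if "i < k" "j < k" "i \<noteq> j" for i j
    using disj that sub[of j] unfolding disjoint_family_on_def by blast
  ultimately have c: "components (S - A) = (\<lambda>i. e i ` ball 0 1) ` {..<k}" "card (components (S - A)) = k"
    using minus_open_disks_components[of k e "S - A", OF e(1,2)] by blast+
  show "card (components (S - A)) = k" by (rule c)
  assume "c \<in> components (S - A)" "c' \<in> components (S - A)" "c \<noteq> c'"
  then obtain i j where ij: "i < k" "j < k" "i \<noteq> j" "c = e i ` ball 0 1" "c' = e j ` ball 0 1"
    unfolding c(1) by blast
  have "closure (e i ` ball 0 1) \<subseteq> e i ` cball 0 1" if "i < k" for i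
    using e(1)[OF that] sub by (intro closure_minimal compact_imp_closed compact_continuous_image) auto
  then have "closure c \<subseteq> e i ` cball 0 1" "closure c' \<subseteq> e j ` cball 0 1" using ij by auto
  then show "closure c \<inter> closure c' = {}" using disj ij unfolding disjoint_family_on_def by blast
qed

text \<open>Every vertical chord of the disk is stretched linearly onto the interval over the same
  base point. At the two ends chord and interval are both single points.\<close>

lemma disc_onto_region:
  fixes w :: "real \<Rightarrow> real"
  assumes wc: "continuous_on {-1..1} w" and w0: "w (-1) = 0" "w 1 = 0"
    and wpos: "\<And>s. -1 < s \<Longrightarrow> s < 1 \<Longrightarrow> w s > 0"
  shows "\<exists>d :: real^2 \<Rightarrow> real \<times> real. continuous_on (cball 0 1) d \<and> inj_on d (cball 0 1) \<and>
    d ` cball 0 1 = {(s, x). -1 \<le> s \<and> s \<le> 1 \<and> \<bar>x\<bar> \<le> w s} \<and>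
    d ` ball 0 1 = {(s, x). -1 < s \<and> s < 1 \<and> \<bar>x\<bar> < w s}"
proof -
  \<comment> \<open>At the ends \<open>v$1 = -1\<close> and \<open>v$1 = 1\<close> the quotient is
    0/0, which is 0 by convention, and the factor \<open>w\<close> vanishes anyway.\<close>
  define d :: "real^2 \<Rightarrow> real \<times> real" where "d = (\<lambda>v. (v$1, w (v$1) * (v$2 / sqrt (1 - (v$1)\<^sup>2))))"
  have cb: "v \<in> cball 0 1 \<longleftrightarrow> (v$2)\<^sup>2 \<le> 1 - (v$1)\<^sup>2" "v \<in> ball 0 1 \<longleftrightarrow> (v$2)\<^sup>2 < 1 - (v$1)\<^sup>2" for v :: "real^2"
    using norm_square_vec2[of v] abs_square_le_1[of "norm v"] abs_square_less_1[of "norm v"] by auto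
  have s1: "1 - s\<^sup>2 > 0 \<longleftrightarrow> -1 < s \<and> s < 1" "1 - s\<^sup>2 \<ge> 0 \<longleftrightarrow> -1 \<le> s \<and> s \<le> 1" for s :: real
    using abs_square_less_1[of s] abs_square_le_1[of s] by auto
  have v1: "-1 \<le> v$1 \<and> v$1 \<le> 1" if "v \<in> cball 0 1" for v :: "real^2"
    using that s1(2)[of "v$1"] zero_le_power2[of "v$2"] unfolding cb by linarith
  have ratio: "\<bar>t / sqrt (1 - s\<^sup>2)\<bar> \<le> 1" if "t\<^sup>2 \<le> 1 - s\<^sup>2" for s t :: real
  proof (cases "1 - s\<^sup>2 > 0")
    case True
    have "\<bar>t\<bar> \<le> sqrt (1 - s\<^sup>2)" using that by (simp add: real_le_rsqrt)
    then show ?thesis using True by (simp add: abs_divide divide_le_eq)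
  next
    case False
    then show ?thesis using that zero_le_power2[of t] by (smt (verit) div_by_0 real_sqrt_zero abs_zero)
  qed
  have dc: "continuous_on (cball 0 1) d"
    unfolding continuous_on_def
  proof
    fix v :: "real^2" assume v: "v \<in> cball 0 1"
    have c1: "continuous_on (cball 0 1) (\<lambda>v::real^2. w (v$1))"
      by (intro continuous_on_compose2[OF wc] continuous_intros) (use v1 in auto)
    have t1: "((\<lambda>v. v$1) \<longlongrightarrow> v$1) (at v within cball 0 1)"
      by (intro tendsto_intros)
    have "((\<lambda>v. w (v$1) * (v$2 / sqrt (1 - (v$1)\<^sup>2))) \<longlongrightarrow> w (v$1) * (v$2 / sqrt (1 - (v$1)\<^sup>2))) (at v within cball 0 1)"
    proof (cases "1 - (v$1)\<^sup>2 > 0")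
      case True
      have "((\<lambda>v. w (v$1)) \<longlongrightarrow> w (v$1)) (at v within cball 0 1)"
        using c1 v by (simp add: continuous_on_def)
      then show ?thesis using True by (intro tendsto_intros) auto
    next
      case False
      then have "v$1 = -1 \<or> v$1 = 1" using s1(1)[of "v$1"] v1[OF v] by linarith
      then have wz: "w (v$1) = 0" using w0 by auto
      have "((\<lambda>v. w (v$1)) \<longlongrightarrow> 0) (at v within cball 0 1)"
        using c1[unfolded continuous_on_def, rule_format, OF v] by (simp only: wz)
      \<comment> \<open>The quotient is bounded by 1 although it has no limit, so the product is
        squeezed by \<open>w\<close>.\<close>
      then have "((\<lambda>v. w (v$1) * (v$2 / sqrt (1 - (v$1)\<^sup>2))) \<longlongrightarrow> 0) (at v within cball 0 1)"
      proof (rule Lim_null_comparison[rotated, OF tendsto_rabs_zero])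
        show "\<forall>\<^sub>F v in at v within cball 0 1. norm (w (v$1) * (v$2 / sqrt (1 - (v$1)\<^sup>2))) \<le> \<bar>w (v$1)\<bar>"
          unfolding eventually_at
        proof (intro exI[of _ 1] conjI ballI impI)
          fix u :: "real^2" assume "u \<in> cball 0 1"
          then have "\<bar>u$2 / sqrt (1 - (u$1)\<^sup>2)\<bar> \<le> 1" using ratio cb(1) by blast
          then show "norm (w (u$1) * (u$2 / sqrt (1 - (u$1)\<^sup>2))) \<le> \<bar>w (u$1)\<bar>"
            using mult_left_mono[of "\<bar>u$2 / sqrt (1 - (u$1)\<^sup>2)\<bar>" 1 "\<bar>w (u$1)\<bar>"] by (simp only: real_norm_def abs_mult abs_ge_zero mult_1_right)
        qed simp
      qed
      then show ?thesis using wz by simp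
    qed
    then show "(d \<longlongrightarrow> d v) (at v within cball 0 1)"
      unfolding d_def by (intro tendsto_Pair t1)
  qed
  have edge: "v$2 = 0 \<and> w (v$1) = 0" if "v \<in> cball 0 1" "\<not> 1 - (v$1)\<^sup>2 > 0" for v :: "real^2"
  proof -
    have "(v$2)\<^sup>2 \<le> 0" using that cb(1)[of v] by linarith
    moreover have "v$1 = -1 \<or> v$1 = 1" using that s1(1)[of "v$1"] v1[OF that(1)] by linarith
    ultimately show ?thesis using w0 by auto
  qed
  have di: "inj_on d (cball 0 1)"
  proof (rule inj_onI)
    fix u v assume u: "u \<in> cball 0 1" and v: "v \<in> cball 0 1" and eq: "d u = d v"
    have e1: "u$1 = v$1" using eq by (simp add: d_def)
    have "u$2 = v$2"
    proof (cases "1 - (v$1)\<^sup>2 > 0")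
      case True
      then have "w (v$1) > 0" using wpos s1(1) by blast
      then show ?thesis using eq e1 True by (simp add: d_def)
    next
      case False
      then show ?thesis using edge[OF u] edge[OF v] e1 by simp
    qed
    then show "u = v" using e1 by (simp add: vec_eq_iff forall_2)
  qed
  have hit: "\<exists>v. v$1 = s \<and> d v = (s, x) \<and> (\<bar>x\<bar> \<le> w s \<longrightarrow> v \<in> cball 0 1) \<and> (\<bar>x\<bar> < w s \<longrightarrow> v \<in> ball 0 1)"
    if "-1 < s" "s < 1" for s x
  proof -
    have pos: "1 - s\<^sup>2 > 0" "w s > 0" using that s1 wpos by auto
    define v :: "real^2" where "v = vector [s, x / w s * sqrt (1 - s\<^sup>2)]"
    have "v$2 = x / w s * sqrt (1 - s\<^sup>2)" by (simp add: v_def)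
    then have "(v$2)\<^sup>2 = (x / w s)\<^sup>2 * (1 - s\<^sup>2)" using pos by (simp only: power_mult_distrib) simp
    moreover have "(x / w s)\<^sup>2 \<le> 1 \<longleftrightarrow> \<bar>x\<bar> \<le> w s" "(x / w s)\<^sup>2 < 1 \<longleftrightarrow> \<bar>x\<bar> < w s"
      unfolding abs_square_le_1 abs_square_less_1 using pos by (simp_all add: abs_divide divide_le_eq divide_less_eq)
    ultimately have "\<bar>x\<bar> \<le> w s \<longrightarrow> v \<in> cball 0 1" "\<bar>x\<bar> < w s \<longrightarrow> v \<in> ball 0 1"
      unfolding cb using pos by (simp_all add: v_def mult_le_cancel_right2 mult_less_cancel_right2)
    moreover have "v$1 = s" "d v = (s, x)" using pos by (simp_all add: v_def d_def)
    ultimately show ?thesis by blast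
  qed
  have dcb: "d ` cball 0 1 = {(s, x). -1 \<le> s \<and> s \<le> 1 \<and> \<bar>x\<bar> \<le> w s}"
  proof (intro equalityI subsetI)
    fix y assume "y \<in> d ` cball 0 1"
    then obtain v where v: "v \<in> cball 0 1" "y = d v" by auto
    have wn: "w (v$1) \<ge> 0" using v1[OF v(1)] wpos[of "v$1"] w0 by (smt (verit))
    have "\<bar>v$2 / sqrt (1 - (v$1)\<^sup>2)\<bar> \<le> 1" using v ratio cb(1) by blast
    then have "\<bar>w (v$1) * (v$2 / sqrt (1 - (v$1)\<^sup>2))\<bar> \<le> w (v$1)"
      using wn mult_left_mono[of "\<bar>v$2 / sqrt (1 - (v$1)\<^sup>2)\<bar>" 1 "w (v$1)"] by (simp only: abs_mult abs_of_nonneg mult_1_right)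
    then show "y \<in> {(s, x). -1 \<le> s \<and> s \<le> 1 \<and> \<bar>x\<bar> \<le> w s}" using v v1 by (simp add: d_def)
  next
    fix y assume "y \<in> {(s, x). -1 \<le> s \<and> s \<le> 1 \<and> \<bar>x\<bar> \<le> w s}"
    then obtain s x where y: "y = (s, x)" "-1 \<le> s" "s \<le> 1" "\<bar>x\<bar> \<le> w s" by auto
    show "y \<in> d ` cball 0 1"
    proof (cases "-1 < s \<and> s < 1")
      case True
      then show ?thesis using hit[of s x] y by (metis image_eqI)
    next
      case False
      then have "s = -1 \<or> s = 1" using y by auto
      then have "x = 0" "s\<^sup>2 = 1" "w s = 0" using y w0 by auto
      then show ?thesis using y(1)
        by (intro image_eqI[of _ _ "vector [s, 0]"]) (simp add: d_def, unfold cb, simp)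
    qed
  qed
  have db: "d ` ball 0 1 = {(s, x). -1 < s \<and> s < 1 \<and> \<bar>x\<bar> < w s}"
  proof (intro equalityI subsetI)
    fix y assume "y \<in> d ` ball 0 1"
    then obtain v where v: "v \<in> ball 0 1" "y = d v" by auto
    have pos: "1 - (v$1)\<^sup>2 > 0" using v(1) zero_le_power2[of "v$2"] unfolding cb by linarith
    then have wp: "w (v$1) > 0" using s1 wpos by blast
    have "\<bar>v$2\<bar> < sqrt (1 - (v$1)\<^sup>2)" using v(1) cb(2) real_less_rsqrt[of "\<bar>v$2\<bar>"] by simp
    then have "\<bar>v$2 / sqrt (1 - (v$1)\<^sup>2)\<bar> < 1" using pos by (simp add: abs_divide divide_less_eq)
    then have "\<bar>w (v$1) * (v$2 / sqrt (1 - (v$1)\<^sup>2))\<bar> < w (v$1)"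
      using wp mult_strict_left_mono[of "\<bar>v$2 / sqrt (1 - (v$1)\<^sup>2)\<bar>" 1 "w (v$1)"] by (simp only: abs_mult abs_of_pos mult_1_right)
    then show "y \<in> {(s, x). -1 < s \<and> s < 1 \<and> \<bar>x\<bar> < w s}" using v pos s1(1)[of "v$1"] by (simp add: d_def)
  next
    fix y assume "y \<in> {(s, x). -1 < s \<and> s < 1 \<and> \<bar>x\<bar> < w s}"
    then show "y \<in> d ` ball 0 1" using hit by (force simp: image_iff)
  qed
  show ?thesis using dc di dcb db by blast
qed

subsection \<open>The region in the plane\<close>

text \<open>
  On the ray through \<open>(y, z)\<close> the discriminant is the concave quadratic \<open>1 + qA - q\<^sup>2z\<^sup>4\<close> in the square \<open>q\<close>
  of the scaling factor, and \<open>nu\<close> is the reciprocal of its positive root (\<open>0\<close> if there is none).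
\<close>

definition nu :: "real \<Rightarrow> real \<Rightarrow> real \<Rightarrow> real" where
  "nu a y z = (sqrt ((a * z\<^sup>2 + 2 * y * z)\<^sup>2 + 4 * z ^ 4) - (a * z\<^sup>2 + 2 * y * z)) / 2"

lemma nu_nonneg: "nu a y z \<ge> 0"
proof -
  have "\<bar>a * z\<^sup>2 + 2 * y * z\<bar> \<le> sqrt ((a * z\<^sup>2 + 2 * y * z)\<^sup>2 + 4 * z ^ 4)"
    by (rule real_le_rsqrt) simp
  then have "a * z\<^sup>2 + 2 * y * z \<le> sqrt ((a * z\<^sup>2 + 2 * y * z)\<^sup>2 + 4 * z ^ 4)"
    by (rule order_trans[OF abs_ge_self])
  then show ?thesis by (simp add: nu_def)
qed

text \<open>\<open>nu\<close> is the reciprocal of a squared scaling factor, hence homogeneous of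
  degree 2, and its square root can enter a gauge.\<close>

lemma nu_scale:
  assumes "r \<ge> 0"
  shows "nu a (r * y) (r * z) = r\<^sup>2 * nu a y z"
proof -
  define A where "A = a * z\<^sup>2 + 2 * y * z"
  have 1: "a * (r * z)\<^sup>2 + 2 * (r * y) * (r * z) = r\<^sup>2 * A"
    by (simp add: A_def power2_eq_square algebra_simps)
  have "(r\<^sup>2 * A)\<^sup>2 + 4 * (r * z) ^ 4 = (r\<^sup>2)\<^sup>2 * (A\<^sup>2 + 4 * z ^ 4)"
    by (simp add: power_mult_distrib algebra_simps flip: power_mult)
  then have "sqrt ((r\<^sup>2 * A)\<^sup>2 + 4 * (r * z) ^ 4) = \<bar>r\<^sup>2\<bar> * sqrt (A\<^sup>2 + 4 * z ^ 4)"
    by (simp only: real_sqrt_mult real_sqrt_abs)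
  then have "sqrt ((r\<^sup>2 * A)\<^sup>2 + 4 * (r * z) ^ 4) = r\<^sup>2 * sqrt (A\<^sup>2 + 4 * z ^ 4)"
    by simp
  then show ?thesis unfolding nu_def 1 A_def[symmetric] by (simp add: right_diff_distrib)
qed

text \<open>The two numbers \<open>(s - A) / 2\<close> and \<open>(s + A) / 2\<close> have
  difference \<open>-A\<close> and product \<open>z^4\<close>, which factors the quadratic. Since
  the second factor is positive, the sign is that of \<open>1 - nu\<close>.\<close>

lemma nu_factor:
  "\<exists>\<mu>\<ge>0. 1 + (a * z\<^sup>2 + 2 * y * z) - z ^ 4 = (1 - nu a y z) * (1 + \<mu>)"
proof -
  define A where "A = a * z\<^sup>2 + 2 * y * z"
  define s where "s = sqrt (A\<^sup>2 + 4 * z ^ 4)"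
  have s2: "s\<^sup>2 = A\<^sup>2 + 4 * z ^ 4" by (simp add: s_def)
  have "\<bar>A\<bar> \<le> s" unfolding s_def by (rule real_le_rsqrt) simp
  then have "- A \<le> s" by (rule order_trans[OF abs_ge_minus_self])
  then have "(s + A) / 2 \<ge> 0" by simp
  moreover have "(1 - (s - A) / 2) * (1 + (s + A) / 2) = 1 + A - (s\<^sup>2 - A\<^sup>2) / 4"
    by (simp add: field_simps power2_eq_square)
  then have "1 + A - z ^ 4 = (1 - nu a y z) * (1 + (s + A) / 2)"
    by (simp add: nu_def s2 flip: A_def s_def)
  ultimately show ?thesis unfolding A_def by blast
qed

lemma nu_sign:
  "1 + (a * z\<^sup>2 + 2 * y * z) - z ^ 4 > 0 \<longleftrightarrow> nu a y z < 1"
  "1 + (a * z\<^sup>2 + 2 * y * z) - z ^ 4 = 0 \<longleftrightarrow> nu a y z = 1"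
proof -
  obtain \<mu> where "\<mu> \<ge> 0" "1 + (a * z\<^sup>2 + 2 * y * z) - z ^ 4 = (1 - nu a y z) * (1 + \<mu>)"
    using nu_factor by blast
  then show "1 + (a * z\<^sup>2 + 2 * y * z) - z ^ 4 > 0 \<longleftrightarrow> nu a y z < 1"
    "1 + (a * z\<^sup>2 + 2 * y * z) - z ^ 4 = 0 \<longleftrightarrow> nu a y z = 1"
    by (simp_all add: zero_less_mult_iff)
qed

lemma continuous_on_nu:
  "continuous_on A f \<Longrightarrow> continuous_on A g \<Longrightarrow> continuous_on A (\<lambda>x. nu a (f x) (g x))"
  unfolding nu_def by (intro continuous_intros) simp_all

text \<open>Eliminating \<open>m$1\<close> by the Casimir cancels the terms \<open>y^2 z^2\<close>.
  Only the degrees 0, 2 and 4 remain, so along a ray the discriminant is a quadratic in the squared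
  scaling factor.\<close>

lemma discr_eq:
  assumes "casimir m = C"
  shows "discr C h m = 1 + ((4 * h - C) * (m$3)\<^sup>2 + 2 * m$2 * m$3) - (m$3) ^ 4"
proof -
  have C: "C = (m$1)\<^sup>2 + (m$2)\<^sup>2 + (m$3)\<^sup>2" using assms by (simp add: casimir_def)
  show ?thesis unfolding discr_def C by (simp add: power2_eq_square power4_eq_xxxx algebra_simps)
qed

lemma discr_nu:
  assumes "casimir m = C"
  shows "discr C h m > 0 \<longleftrightarrow> nu (4 * h - C) (m$2) (m$3) < 1" "discr C h m = 0 \<longleftrightarrow> nu (4 * h - C) (m$2) (m$3) = 1"
    "discr C h m \<ge> 0 \<longleftrightarrow> nu (4 * h - C) (m$2) (m$3) \<le> 1" "discr C h m < 0 \<longleftrightarrow> nu (4 * h - C) (m$2) (m$3) > 1"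
  using nu_sign[of "4 * h - C" "m$3" "m$2"] unfolding discr_eq[OF assms] by linarith+

text \<open>The discriminant at the point
  \<open>(0, sqrt C * cos \<theta>, sqrt C * sin \<theta>)\<close> of the great circle.\<close>

definition gcirc :: "real \<Rightarrow> real \<Rightarrow> real \<Rightarrow> real" where
  "gcirc C h \<theta> = (1 + C * cos \<theta> * sin \<theta>)\<^sup>2 - (2 * C - 4 * h) * C * (sin \<theta>)\<^sup>2"

text \<open>Homogeneity of degree 2 turns the threshold 1 on the circle of radius
  \<open>sqrt C\<close> into \<open>1 / C\<close> on the unit circle.\<close>

lemma gcirc_nu:
  assumes "C > 0"
  shows "gcirc C h \<theta> > 0 \<longleftrightarrow> nu (4 * h - C) (cos \<theta>) (sin \<theta>) < 1 / C"
    "gcirc C h \<theta> = 0 \<longleftrightarrow> nu (4 * h - C) (cos \<theta>) (sin \<theta>) = 1 / C"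
    "gcirc C h \<theta> < 0 \<longleftrightarrow> nu (4 * h - C) (cos \<theta>) (sin \<theta>) > 1 / C"
proof -
  define m :: "real^3" where "m = vector [0, sqrt C * cos \<theta>, sqrt C * sin \<theta>]"
  have cas: "casimir m = C"
    using assms by (simp add: casimir_def m_def power_mult_distrib flip: distrib_left)
  have "m$2 * m$3 = sqrt C * sqrt C * cos \<theta> * sin \<theta>" "(m$3)\<^sup>2 = sqrt C * sqrt C * (sin \<theta>)\<^sup>2" "m$1 = 0"
    by (simp_all add: m_def power2_eq_square)
  then have "m$2 * m$3 = C * cos \<theta> * sin \<theta>" "(m$3)\<^sup>2 = C * (sin \<theta>)\<^sup>2" "m$1 = 0"
    using assms by simp_all
  then have g: "gcirc C h \<theta> = discr C h m"
    by (simp add: gcirc_def discr_def)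
  have "nu (4 * h - C) (m$2) (m$3) = C * nu (4 * h - C) (cos \<theta>) (sin \<theta>)"
    using nu_scale[of "sqrt C"] assms by (simp add: m_def)
  then show "gcirc C h \<theta> > 0 \<longleftrightarrow> nu (4 * h - C) (cos \<theta>) (sin \<theta>) < 1 / C"
    "gcirc C h \<theta> = 0 \<longleftrightarrow> nu (4 * h - C) (cos \<theta>) (sin \<theta>) = 1 / C"
    "gcirc C h \<theta> < 0 \<longleftrightarrow> nu (4 * h - C) (cos \<theta>) (sin \<theta>) > 1 / C"
    unfolding g discr_nu[OF cas] using assms by (simp_all add: field_simps)
qed

section \<open>Polar angles and the arcs of the region\<close>

lemma polar_coordinates:
  fixes y z \<alpha> :: real
  obtains \<theta> where "\<alpha> \<le> \<theta>" "\<theta> < \<alpha> + 2 * pi" "y = sqrt (y\<^sup>2 + z\<^sup>2) * cos \<theta>" "z = sqrt (y\<^sup>2 + z\<^sup>2) * sin \<theta>"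
proof (cases "y = 0 \<and> z = 0")
  case True
  then show ?thesis using that[of \<alpha>] by simp
next
  case False
  define r where "r = sqrt (y\<^sup>2 + z\<^sup>2)"
  have "y\<^sup>2 + z\<^sup>2 > 0" using False by (simp add: sum_power2_gt_zero_iff)
  then have r: "r > 0" "r\<^sup>2 = y\<^sup>2 + z\<^sup>2" by (simp_all add: r_def)
  \<comment> \<open>Rotation by -\<alpha> reduces the window that starts at \<alpha> to the one that
    starts at 0.\<close>
  define y' z' where "y' = (y * cos \<alpha> + z * sin \<alpha>) / r" and "z' = (z * cos \<alpha> - y * sin \<alpha>) / r"
  have "(y * cos \<alpha> + z * sin \<alpha>)\<^sup>2 + (z * cos \<alpha> - y * sin \<alpha>)\<^sup>2 = (y\<^sup>2 + z\<^sup>2) * ((sin \<alpha>)\<^sup>2 + (cos \<alpha>)\<^sup>2)"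
    by (simp only: power2_eq_square) algebra
  then have "(y * cos \<alpha> + z * sin \<alpha>)\<^sup>2 + (z * cos \<alpha> - y * sin \<alpha>)\<^sup>2 = r\<^sup>2"
    using r(2) by simp
  then have "y'\<^sup>2 + z'\<^sup>2 = 1"
    using r(1) by (simp add: y'_def z'_def power_divide add_divide_distrib[symmetric])
  then obtain t where t: "0 \<le> t" "t < 2 * pi" "y' = cos t" "z' = sin t"
    using sincos_total_2pi by metis
  have yz: "r * cos t = y * cos \<alpha> + z * sin \<alpha>" "r * sin t = z * cos \<alpha> - y * sin \<alpha>"
    using r t(3,4) by (simp_all add: y'_def z'_def field_simps)
  have "r * cos (\<alpha> + t) = cos \<alpha> * (r * cos t) - sin \<alpha> * (r * sin t)"
    "r * sin (\<alpha> + t) = sin \<alpha> * (r * cos t) + cos \<alpha> * (r * sin t)"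
    by (simp_all add: cos_add sin_add algebra_simps)
  moreover have "cos \<alpha> * (y * cos \<alpha> + z * sin \<alpha>) - sin \<alpha> * (z * cos \<alpha> - y * sin \<alpha>) = y * ((sin \<alpha>)\<^sup>2 + (cos \<alpha>)\<^sup>2)"
    "sin \<alpha> * (y * cos \<alpha> + z * sin \<alpha>) + cos \<alpha> * (z * cos \<alpha> - y * sin \<alpha>) = z * ((sin \<alpha>)\<^sup>2 + (cos \<alpha>)\<^sup>2)"
    by (simp_all only: power2_eq_square ring_distribs) (simp_all add: algebra_simps)
  ultimately have "r * cos (\<alpha> + t) = y" "r * sin (\<alpha> + t) = z"
    unfolding yz by simp_all
  then show ?thesis using that[of "\<alpha> + t"] t r_def by simp
qed

lemma cos_sin_eq:
  assumes "cos \<theta> = cos \<theta>'" "sin \<theta> = sin \<theta>'" "\<bar>\<theta> - \<theta>'\<bar> < 2 * pi"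
  shows "\<theta> = \<theta>'"
proof -
  obtain n :: int where n: "\<theta> = \<theta>' + 2 * pi * of_int n"
    using assms(1,2) sin_cos_eq_iff by (metis add.commute)
  then have "2 * pi * \<bar>of_int n\<bar> < 2 * pi * 1" using assms(3) by (simp add: abs_mult)
  then have "\<bar>real_of_int n\<bar> < 1" by (simp only: mult_less_cancel_left_pos pi_gt_zero zero_less_mult_iff zero_less_numeral simp_thms if_True)
  then have "n = 0" by linarith
  then show ?thesis using n by simp
qed

text \<open>
  The marked angles \<open>\<alpha>\<close> cut the great circle \<open>m\<^sub>1 = 0\<close> into arcs outside and inside the image of \<open>\<pi>\<close>
  alternately. Arcs outside the image are nondegenerate, the others may shrink to a point.
\<close>

definition marked :: "real \<Rightarrow> real \<Rightarrow> nat \<Rightarrow> (nat \<Rightarrow> real) \<Rightarrow> bool" where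
  "marked C h k \<alpha> \<longleftrightarrow>
     (\<forall>i<2 * k. \<alpha> i \<le> \<alpha> (Suc i) \<and> (odd i \<longrightarrow> \<alpha> i < \<alpha> (Suc i))) \<and> \<alpha> (2 * k) = \<alpha> 0 + 2 * pi \<and>
     (\<forall>i\<le>2 * k. gcirc C h (\<alpha> i) = 0) \<and>
     (\<forall>i<2 * k. \<forall>\<theta>. \<alpha> i < \<theta> \<longrightarrow> \<theta> < \<alpha> (Suc i) \<longrightarrow>
        (even i \<longrightarrow> gcirc C h \<theta> > 0) \<and> (odd i \<longrightarrow> gcirc C h \<theta> < 0))"

lemma marked_mono:
  assumes "marked C h k \<alpha>" "i \<le> j" "j \<le> 2 * k"
  shows "\<alpha> i \<le> \<alpha> j"
  using assms(2,3)
proof (induction j rule: dec_induct)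
  case (step n)
  then have "\<alpha> n \<le> \<alpha> (Suc n)" using assms(1) unfolding marked_def by auto
  then show ?case using step by simp
qed simp

lemma marked_sgn:
  assumes "marked C h k \<alpha>" "t \<in> {0..real (2 * k)}" and strict: "\<And>i. i < 2 * k \<Longrightarrow> \<alpha> i < \<alpha> (Suc i)"
  shows "gcirc C h (pl \<alpha> (2 * k) t) \<ge> 0 \<longleftrightarrow> sin (pi * t) \<ge> 0" "gcirc C h (pl \<alpha> (2 * k) t) \<le> 0 \<longleftrightarrow> sin (pi * t) \<le> 0"
proof -
  have "(gcirc C h (pl \<alpha> (2 * k) t) \<ge> 0 \<longleftrightarrow> sin (pi * t) \<ge> 0) \<and> (gcirc C h (pl \<alpha> (2 * k) t) \<le> 0 \<longleftrightarrow> sin (pi * t) \<le> 0)"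
    using assms(2)
  proof (cases rule: unit_interval_cases)
    case (1 i)
    then show ?thesis using assms(1) sin_pi_nat[of i] pl_at[of i "2 * k" \<alpha>] by (simp add: marked_def)
  next
    case (2 i r)
    define \<theta> where "\<theta> = pl \<alpha> (2 * k) t"
    have p: "\<alpha> i < \<alpha> (Suc i)" using strict 2 by simp
    have "\<theta> = \<alpha> i + r * (\<alpha> (Suc i) - \<alpha> i)" using pl_affine[of i "2 * k" r \<alpha>] 2 by (simp add: \<theta>_def)
    moreover have "0 < r * (\<alpha> (Suc i) - \<alpha> i)" "r * (\<alpha> (Suc i) - \<alpha> i) < 1 * (\<alpha> (Suc i) - \<alpha> i)"
      using 2 p by (auto intro!: mult_pos_pos mult_strict_right_mono)
    ultimately have "\<alpha> i < \<theta>" "\<theta> < \<alpha> (Suc i)" by auto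
    then have "even i \<longrightarrow> gcirc C h \<theta> > 0" "odd i \<longrightarrow> gcirc C h \<theta> < 0"
      using assms(1) 2(1) unfolding marked_def by blast+
    then show ?thesis
      using sin_pi_unit_interval[of r i] 2 unfolding \<theta>_def[symmetric] by (cases "even i") auto
  qed
  then show "gcirc C h (pl \<alpha> (2 * k) t) \<ge> 0 \<longleftrightarrow> sin (pi * t) \<ge> 0" "gcirc C h (pl \<alpha> (2 * k) t) \<le> 0 \<longleftrightarrow> sin (pi * t) \<le> 0"
    by blast+
qed

text \<open>In a given direction the boundary is reached where the larger of the two terms of
  \<open>M\<close> becomes 1. There \<open>E\<close> vanishes if \<open>1 / C\<close> is the larger
  term and \<open>F\<close> vanishes if \<open>nu\<close> is, and comparing \<open>nu\<close> with
  \<open>1 / C\<close> is the sign of \<open>gcirc\<close>. Thus the arcs of the great circle are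
  the arcs of the boundary.\<close>

lemma marked_realizes:
  assumes C: "C > 0" and marked: "marked C h k \<alpha>" and k: "k > 0"
    and strict: "\<And>i. i < 2 * k \<Longrightarrow> \<alpha> i < \<alpha> (Suc i)"
  shows "realizes (2 * k) {(v :: real^2, m :: real^3). casimir m = C \<and> (norm v)\<^sup>2 = discr C h m}"
proof -
  define a where "a = 4 * h - C"
  define F where "F = (\<lambda>(y::real, z::real). 1 + (a * z\<^sup>2 + 2 * y * z) - z ^ 4)"
  define E where "E = (\<lambda>(y::real, z::real). C - (y\<^sup>2 + z\<^sup>2))"
  \<comment> \<open>Both terms are homogeneous of degree 2. The first is at most 1 where
    \<open>E\<close> is nonnegative, the second where \<open>F\<close> is.\<close>
  define M where "M = (\<lambda>(y, z). max ((y\<^sup>2 + z\<^sup>2) / C) (nu a y z))"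
  define N where "N = (\<lambda>u. sqrt (M u))"
  define J where "J = (\<lambda>(v::real^2, x::real, y::real, z::real). (v, vector [x, y, z] :: real^3))"
  define V where "V = {(v, x, u). N u \<le> 1 \<and> (norm (v::real^2))\<^sup>2 = F u \<and> x\<^sup>2 = E u}"
  define dir where "dir = (\<lambda>\<theta>::real. (cos \<theta>, sin \<theta>))"
  define \<theta> where "\<theta> = pl \<alpha> (2 * k)"
  define \<gamma> where "\<gamma> = (\<lambda>t. (1 / N (dir (\<theta> t))) *\<^sub>R dir (\<theta> t))"
  have M0: "M u > 0" if "u \<noteq> 0" for u
  proof (cases u)
    case (Pair y z)
    then have "y\<^sup>2 + z\<^sup>2 > 0" using that by (auto simp: zero_prod_def sum_power2_gt_zero_iff)
    then show ?thesis using C Pair by (simp add: M_def less_max_iff_disj)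
  qed
  have Mscale: "M (r *\<^sub>R u) = r\<^sup>2 * M u" if "r \<ge> 0" for r u
  proof (cases u)
    case (Pair y z)
    have "((r * y)\<^sup>2 + (r * z)\<^sup>2) / C = r\<^sup>2 * ((y\<^sup>2 + z\<^sup>2) / C)"
      by (simp add: power_mult_distrib distrib_left)
    then show ?thesis
      by (simp only: Pair M_def scaleR_Pair real_scaleR_def split_conv nu_scale[OF that]
          max_mult_distrib_left zero_le_power2 if_True)
  qed
  have N0: "N u > 0" if "u \<noteq> 0" for u using M0[OF that] by (simp add: N_def)
  have Nscale: "N (r *\<^sub>R u) = r * N u" if "r \<ge> 0" for r u
    using Mscale[OF that] that by (simp add: N_def real_sqrt_mult)
  have N2: "(N u)\<^sup>2 = M u" for u
  proof (cases "u = 0")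
    case True
    then show ?thesis using nu_scale[of 0 a 0 0] by (simp add: N_def M_def zero_prod_def)
  qed (use M0 in \<open>simp add: N_def less_imp_le\<close>)
  have Nle: "N u \<le> 1 \<longleftrightarrow> E u \<ge> 0 \<and> F u \<ge> 0" "N u < 1 \<longleftrightarrow> E u > 0 \<and> F u > 0" for u
  proof -
    obtain y z where u: "u = (y, z)" by (cases u)
    have "F u \<ge> 0 \<longleftrightarrow> nu a y z \<le> 1" "F u > 0 \<longleftrightarrow> nu a y z < 1"
      unfolding F_def u split_conv using nu_sign[of a z y] by linarith+
    moreover have "E u \<ge> 0 \<longleftrightarrow> (y\<^sup>2 + z\<^sup>2) / C \<le> 1" "E u > 0 \<longleftrightarrow> (y\<^sup>2 + z\<^sup>2) / C < 1"
      using C by (simp_all add: u E_def)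
    ultimately show "N u \<le> 1 \<longleftrightarrow> E u \<ge> 0 \<and> F u \<ge> 0" "N u < 1 \<longleftrightarrow> E u > 0 \<and> F u > 0"
      by (simp_all add: N_def u M_def)
  qed
  have dir0: "dir t \<noteq> 0" for t
    by (auto simp: dir_def zero_prod_def dest: sin_zero_norm_cos_one)
  have Nd: "N (dir t) > 0" for t using N0 dir0 by simp
  have N\<gamma>: "N (\<gamma> t) = 1" for t
    unfolding \<gamma>_def using Nd[of "\<theta> t"] by (subst Nscale) auto
  have Md: "M (dir t) = max (1 / C) (nu a (cos t) (sin t))" for t
    by (simp add: M_def dir_def)
  have range: "\<theta> t \<in> {\<alpha> 0..\<alpha> 0 + 2 * pi}" if "t \<in> {0..real (2 * k)}" for t
    using pl_image[where \<alpha> = \<alpha> and n = "2 * k", OF strict] that marked unfolding marked_def \<theta>_def by auto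
  have ends: "\<theta> 0 = \<alpha> 0" "\<theta> (real (2 * k)) = \<alpha> 0 + 2 * pi"
    using pl_at[of 0 "2 * k" \<alpha>] pl_at[of "2 * k" "2 * k" \<alpha>] marked unfolding marked_def \<theta>_def by simp_all
  have dirc: "dir (x + 2 * pi) = dir x" for x by (simp add: dir_def)
  have \<theta>c: "continuous_on A \<theta>" for A unfolding \<theta>_def by (rule continuous_on_pl)
  have \<theta>inj: "t = t'" if "\<theta> t = \<theta> t'" "t \<in> {0..real (2 * k)}" "t' \<in> {0..real (2 * k)}" for t t'
    using pl_inj[where \<alpha> = \<alpha> and n = "2 * k", OF strict] that unfolding \<theta>_def by blast
  have scale_nth: "fst (r *\<^sub>R dir t) = r * cos t" "snd (r *\<^sub>R dir t) = r * sin t" for r t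
    by (simp_all add: dir_def)
  have "realizes (2 * k) (J ` V)"
    unfolding V_def
  proof (rule realizes_gauge[where \<gamma> = \<gamma>])
    show "N u > 0" if "u \<noteq> 0" for u using N0[OF that] .
    show "N (r *\<^sub>R u) = r * N u" if "r \<ge> 0" for r u using Nscale[OF that] .
    show "continuous_on {0..real (2 * k)} \<gamma>"
      using Nd unfolding \<gamma>_def N_def Md unfolding dir_def
      by (intro continuous_intros continuous_on_nu \<theta>c)
        (metis Md Nd N_def less_irrefl real_sqrt_zero)
    show "\<gamma> ` {0..real (2 * k)} = {u. N u = 1}"
    proof (intro equalityI subsetI)
      fix u assume "u \<in> {u. N u = 1}"
      then have Nu: "N u = 1" by simp
      obtain y z where u: "u = (y, z)" by (cases u)
      obtain t where t: "\<alpha> 0 \<le> t" "t < \<alpha> 0 + 2 * pi" "y = sqrt (y\<^sup>2 + z\<^sup>2) * cos t" "z = sqrt (y\<^sup>2 + z\<^sup>2) * sin t"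
        by (rule polar_coordinates)
      define r where "r = sqrt (y\<^sup>2 + z\<^sup>2)"
      have ur: "u = r *\<^sub>R dir t" using t(3,4) by (simp add: u dir_def r_def)
      then have "r * N (dir t) = 1" using Nscale[of r "dir t"] Nu by (simp add: r_def)
      then have "r = 1 / N (dir t)" using Nd[of t] by (simp add: field_simps)
      moreover have "t \<in> \<theta> ` {0..real (2 * k)}"
        using pl_image[where \<alpha> = \<alpha> and n = "2 * k", OF strict] t(1,2) marked unfolding marked_def \<theta>_def by simp
      ultimately show "u \<in> \<gamma> ` {0..real (2 * k)}" using ur by (auto simp: \<gamma>_def)
    qed (use N\<gamma> in auto)
    show "\<gamma> t = \<gamma> t' \<longleftrightarrow> t = t' \<or> {t, t'} = {0, real (2 * k)}"
      if tt: "t \<in> {0..real (2 * k)}" "t' \<in> {0..real (2 * k)}" for t t'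
    proof
      assume e: "\<gamma> t = \<gamma> t'"
      define r r' where "r = 1 / N (dir (\<theta> t))" and "r' = 1 / N (dir (\<theta> t'))"
      have r: "r > 0" "r' > 0" using Nd by (simp_all add: r_def r'_def)
      have e2: "r * cos (\<theta> t) = r' * cos (\<theta> t')" "r * sin (\<theta> t) = r' * sin (\<theta> t')"
        using e scale_nth unfolding \<gamma>_def r_def[symmetric] r'_def[symmetric] by metis+
      have "(r * cos (\<theta> t))\<^sup>2 + (r * sin (\<theta> t))\<^sup>2 = r\<^sup>2" "(r' * cos (\<theta> t'))\<^sup>2 + (r' * sin (\<theta> t'))\<^sup>2 = r'\<^sup>2"
        by (simp_all add: power_mult_distrib flip: distrib_left)
      then have "r\<^sup>2 = r'\<^sup>2" using e2 by simp
      then have "r = r'" using r by simp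
      then have cs: "cos (\<theta> t) = cos (\<theta> t')" "sin (\<theta> t) = sin (\<theta> t')" using e2 r by auto
      show "t = t' \<or> {t, t'} = {0, real (2 * k)}"
      proof (cases "\<bar>\<theta> t - \<theta> t'\<bar> < 2 * pi")
        case True
        then show ?thesis using cos_sin_eq[OF cs] \<theta>inj tt by blast
      next
        case False
        then have "\<theta> t = \<alpha> 0 \<and> \<theta> t' = \<alpha> 0 + 2 * pi \<or> \<theta> t' = \<alpha> 0 \<and> \<theta> t = \<alpha> 0 + 2 * pi"
          using range[OF tt(1)] range[OF tt(2)] by auto
        moreover have "(0::real) \<in> {0..real (2 * k)}" "real (2 * k) \<in> {0..real (2 * k)}" by auto
        ultimately have "t = 0 \<and> t' = real (2 * k) \<or> t' = 0 \<and> t = real (2 * k)"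
          using ends \<theta>inj tt by metis
        then show ?thesis by auto
      qed
    next
      assume "t = t' \<or> {t, t'} = {0, real (2 * k)}"
      then have "t = t' \<or> t = 0 \<and> t' = real (2 * k) \<or> t = real (2 * k) \<and> t' = 0" by (auto simp: doubleton_eq_iff)
      moreover have "\<gamma> 0 = \<gamma> (real (2 * k))" unfolding \<gamma>_def ends dirc ..
      ultimately show "\<gamma> t = \<gamma> t'" by auto
    qed
    show "continuous_on {u. N u \<le> 1} F" "continuous_on {u. N u \<le> 1} E"
      unfolding F_def E_def case_prod_beta by (intro continuous_intros)+
    show "F u > 0 \<and> E u > 0" if "N u < 1" for u using Nle(2) that by blast
    have FE: "F (\<gamma> t) \<ge> 0 \<and> (F (\<gamma> t) = 0 \<longleftrightarrow> sin (pi * t) \<le> 0) \<and> E (\<gamma> t) \<ge> 0 \<and> (E (\<gamma> t) = 0 \<longleftrightarrow> sin (pi * t) \<ge> 0)"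
      if "t \<in> {0..real (2 * k)}" for t
    proof -
      define r where "r = 1 / N (dir (\<theta> t))"
      define n where "n = nu a (cos (\<theta> t)) (sin (\<theta> t))"
      have "r > 0" "r\<^sup>2 * (N (dir (\<theta> t)))\<^sup>2 = 1"
        using Nd[of "\<theta> t"] by (simp_all add: r_def power_divide)
      then have r: "r > 0" "r\<^sup>2 * max (1 / C) n = 1"
        unfolding N2 Md n_def .
      have \<gamma>e: "\<gamma> t = (r * cos (\<theta> t), r * sin (\<theta> t))" by (simp add: \<gamma>_def r_def dir_def)
      have "E (\<gamma> t) = C - r\<^sup>2" by (simp add: \<gamma>e E_def power_mult_distrib flip: distrib_left)
      then have "E (\<gamma> t) = 0 \<longleftrightarrow> r\<^sup>2 * (1 / C) = r\<^sup>2 * max (1 / C) n"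
        using C r(2) by (auto simp: field_simps)
      then have "E (\<gamma> t) = 0 \<longleftrightarrow> 1 / C = max (1 / C) n" using r(1) by (simp only: mult_cancel_left) simp
      then have E: "E (\<gamma> t) = 0 \<longleftrightarrow> n \<le> 1 / C" by (auto simp: max_def)
      have "F (\<gamma> t) = 0 \<longleftrightarrow> r\<^sup>2 * n = r\<^sup>2 * max (1 / C) n"
        using nu_sign(2)[of a "r * sin (\<theta> t)" "r * cos (\<theta> t)"] nu_scale[of r a] r
        by (simp add: \<gamma>e F_def n_def)
      then have "F (\<gamma> t) = 0 \<longleftrightarrow> n = max (1 / C) n" using r(1) by (simp only: mult_cancel_left) simp
      then have F: "F (\<gamma> t) = 0 \<longleftrightarrow> n \<ge> 1 / C" by (auto simp: max_def)
      have "n \<le> 1 / C \<longleftrightarrow> gcirc C h (\<theta> t) \<ge> 0" "n \<ge> 1 / C \<longleftrightarrow> gcirc C h (\<theta> t) \<le> 0"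
        using gcirc_nu[OF C, of h "\<theta> t"] unfolding n_def a_def by linarith+
      then show ?thesis
        using marked_sgn[OF marked that strict] E F Nle(1)[of "\<gamma> t"] N\<gamma>[of t] unfolding \<theta>_def[symmetric] by simp
    qed
    show "F (\<gamma> t) \<ge> 0 \<and> (F (\<gamma> t) = 0 \<longleftrightarrow> sin (pi * t) \<le> 0)" "E (\<gamma> t) \<ge> 0 \<and> (E (\<gamma> t) = 0 \<longleftrightarrow> sin (pi * t) \<ge> 0)"
      if "t \<in> {0..real (2 * k)}" for t using FE[OF that] by blast+
    have "continuous_on UNIV J"
      unfolding J_def case_prod_beta by (intro continuous_on_Pair continuous_on_vec3 continuous_intros)
    then show "continuous_on {(v, x, u). N u \<le> 1 \<and> (norm v)\<^sup>2 = F u \<and> x\<^sup>2 = E u} J"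
      by (rule continuous_on_subset) simp
    show "inj_on J {(v, x, u). N u \<le> 1 \<and> (norm v)\<^sup>2 = F u \<and> x\<^sup>2 = E u}"
    proof (rule inj_onI)
      fix p q assume "J p = J q"
      moreover obtain v x y z v' x' y' z' where pq: "p = (v, x, y, z)" "q = (v', x', y', z')"
        by (metis prod.exhaust)
      ultimately have "v = v'" "(vector [x, y, z] :: real^3) = vector [x', y', z']"
        by (auto simp: J_def)
      then show "p = q" by (simp add: pq vec_eq_iff forall_3)
    qed
  qed
  moreover have "J ` V = {(v :: real^2, m :: real^3). casimir m = C \<and> (norm v)\<^sup>2 = discr C h m}"
  proof (intro equalityI subsetI)
    fix p assume "p \<in> J ` V"
    then obtain v x y z where p: "p = J (v, x, y, z)" "(norm v)\<^sup>2 = F (y, z)" "x\<^sup>2 = E (y, z)"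
      by (auto simp: V_def)
    define m :: "real^3" where "m = vector [x, y, z]"
    have "casimir m = C" using p(3) by (simp add: casimir_def m_def E_def)
    moreover from discr_eq[OF this, of h] have "discr C h m = F (y, z)" by (simp add: m_def F_def a_def)
    ultimately show "p \<in> {(v, m). casimir m = C \<and> (norm v)\<^sup>2 = discr C h m}"
      using p by (simp add: J_def m_def)
  next
    fix p :: "(real^2) \<times> (real^3)" assume "p \<in> {(v, m). casimir m = C \<and> (norm v)\<^sup>2 = discr C h m}"
    then obtain v m where p: "p = (v, m)" "casimir m = C" "(norm v)\<^sup>2 = discr C h m" by auto
    have "E (m$2, m$3) = (m$1)\<^sup>2" using p(2) by (simp add: E_def casimir_def)
    moreover have "F (m$2, m$3) = (norm v)\<^sup>2" using p(3) discr_eq[OF p(2), of h] by (simp add: F_def a_def)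
    ultimately have "(v, m$1, m$2, m$3) \<in> V" by (simp add: V_def Nle)
    moreover have "J (v, m$1, m$2, m$3) = p" by (simp add: J_def p vec_eq_iff forall_3)
    ultimately show "p \<in> J ` V" by (metis imageI)
  qed
  ultimately show ?thesis by simp
qed

text \<open>The polar angle of the projection to the plane of \<open>m$2\<close> and
  \<open>m$3\<close>. It is a relation because angles are free modulo \<open>2 * pi\<close>, and
  every angle fits when the projection is 0.\<close>

definition has_angle :: "real^3 \<Rightarrow> real \<Rightarrow> bool" where
  "has_angle m \<theta> \<longleftrightarrow> m$2 = sqrt ((m$2)\<^sup>2 + (m$3)\<^sup>2) * cos \<theta> \<and> m$3 = sqrt ((m$2)\<^sup>2 + (m$3)\<^sup>2) * sin \<theta>"

text \<open>A nonpositive discriminant forces \<open>m$3 \<noteq> 0\<close>, as it would be 1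
  otherwise; so the projection is nonzero and has a direction.\<close>

lemma has_angle_unique:
  assumes "has_angle m \<theta>" "has_angle m \<theta>'" "\<bar>\<theta> - \<theta>'\<bar> < 2 * pi" "discr C h m \<le> 0"
  shows "\<theta> = \<theta>'"
proof -
  define r where "r = sqrt ((m$2)\<^sup>2 + (m$3)\<^sup>2)"
  have "m$3 \<noteq> 0" using assms(4) discr_equator[of m C h] by auto
  then have "r \<noteq> 0" by (simp add: r_def sum_power2_eq_zero_iff)
  moreover have "r * cos \<theta> = r * cos \<theta>'" "r * sin \<theta> = r * sin \<theta>'"
    using assms(1,2) unfolding has_angle_def r_def[symmetric] by metis+
  ultimately show ?thesis using cos_sin_eq assms(3) by simp
qed

text \<open>The projection has squared length \<open>C - (m$1)^2\<close>. Along a meridian of fixed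
  angle the sign of the discriminant is therefore a bound on \<open>(m$1)^2\<close>.\<close>

lemma discr_has_angle:
  assumes "C > 0" "casimir m = C" "has_angle m \<theta>"
  shows "nu (4 * h - C) (m$2) (m$3) = (C - (m$1)\<^sup>2) * nu (4 * h - C) (cos \<theta>) (sin \<theta>)"
    and "nu (4 * h - C) (cos \<theta>) (sin \<theta>) > 0 \<Longrightarrow>
      (discr C h m \<le> 0 \<longleftrightarrow> (m$1)\<^sup>2 \<le> C - 1 / nu (4 * h - C) (cos \<theta>) (sin \<theta>)) \<and>
      (discr C h m < 0 \<longleftrightarrow> (m$1)\<^sup>2 < C - 1 / nu (4 * h - C) (cos \<theta>) (sin \<theta>))"
proof -
  define r where "r = sqrt ((m$2)\<^sup>2 + (m$3)\<^sup>2)"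
  have r2: "r\<^sup>2 = C - (m$1)\<^sup>2" using assms(2) by (simp add: r_def casimir_def)
  have "m$2 = r * cos \<theta>" "m$3 = r * sin \<theta>" using assms(3) unfolding has_angle_def r_def by blast+
  then have "nu (4 * h - C) (m$2) (m$3) = nu (4 * h - C) (r * cos \<theta>) (r * sin \<theta>)" by (simp only:)
  also have "\<dots> = r\<^sup>2 * nu (4 * h - C) (cos \<theta>) (sin \<theta>)" by (rule nu_scale) (simp add: r_def)
  finally show *: "nu (4 * h - C) (m$2) (m$3) = (C - (m$1)\<^sup>2) * nu (4 * h - C) (cos \<theta>) (sin \<theta>)"
    unfolding r2 .
  assume n: "nu (4 * h - C) (cos \<theta>) (sin \<theta>) > 0"
  have "discr C h m \<le> 0 \<longleftrightarrow> nu (4 * h - C) (m$2) (m$3) \<ge> 1" using discr_nu[OF assms(2), of h] by linarith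
  then show "(discr C h m \<le> 0 \<longleftrightarrow> (m$1)\<^sup>2 \<le> C - 1 / nu (4 * h - C) (cos \<theta>) (sin \<theta>)) \<and>
      (discr C h m < 0 \<longleftrightarrow> (m$1)\<^sup>2 < C - 1 / nu (4 * h - C) (cos \<theta>) (sin \<theta>))"
    unfolding discr_nu(4)[OF assms(2)] * using n by (simp add: field_simps)
qed

text \<open>In the coordinates angle and \<open>m$1\<close> the closed set is the region
  \<open>|x| \<le> sqrt (C - 1 / n)\<close> over the arc, where \<open>n\<close> is
  \<open>nu\<close> at the angle. At the end points \<open>n = 1 / C\<close>, so the region tapers
  to points there, as \<open>disc_onto_region\<close> requires.\<close>

lemma disc_outside_image:
  assumes C: "C > 0" and t: "t\<^sub>1 < t\<^sub>2" "t\<^sub>2 - t\<^sub>1 < 2 * pi"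
    and g: "gcirc C h t\<^sub>1 = 0" "gcirc C h t\<^sub>2 = 0" "\<And>\<theta>. t\<^sub>1 < \<theta> \<Longrightarrow> \<theta> < t\<^sub>2 \<Longrightarrow> gcirc C h \<theta> < 0"
  shows "\<exists>e :: real^2 \<Rightarrow> real^3. continuous_on (cball 0 1) e \<and> inj_on e (cball 0 1) \<and>
    e ` cball 0 1 = {m. casimir m = C \<and> discr C h m \<le> 0 \<and> (\<exists>\<theta>. t\<^sub>1 \<le> \<theta> \<and> \<theta> \<le> t\<^sub>2 \<and> has_angle m \<theta>)} \<and>
    e ` ball 0 1 = {m. casimir m = C \<and> discr C h m < 0 \<and> (\<exists>\<theta>. t\<^sub>1 < \<theta> \<and> \<theta> < t\<^sub>2 \<and> has_angle m \<theta>)}"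
proof -
  define n where "n = (\<lambda>\<theta>. nu (4 * h - C) (cos \<theta>) (sin \<theta>))"
  define w where "w = (\<lambda>\<theta>. sqrt (C - 1 / n \<theta>))"
  define \<theta> where "\<theta> = (\<lambda>s::real. (t\<^sub>1 + t\<^sub>2) / 2 + s * ((t\<^sub>2 - t\<^sub>1) / 2))"
  have n1: "n t\<^sub>1 = 1 / C" "n t\<^sub>2 = 1 / C" "\<And>\<theta>. t\<^sub>1 < \<theta> \<Longrightarrow> \<theta> < t\<^sub>2 \<Longrightarrow> n \<theta> > 1 / C"
    using g gcirc_nu[OF C] unfolding n_def by blast+
  have nge: "n \<theta> \<ge> 1 / C" if "t\<^sub>1 \<le> \<theta>" "\<theta> \<le> t\<^sub>2" for \<theta>
    using n1 that by (cases "\<theta> = t\<^sub>1"; cases "\<theta> = t\<^sub>2") (auto simp: less_imp_le)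
  have n0: "n \<theta> > 0" if "t\<^sub>1 \<le> \<theta>" "\<theta> \<le> t\<^sub>2" for \<theta>
    using nge[OF that] C by (smt (verit) divide_pos_pos)
  \<comment> \<open>The strict bound keeps \<open>x^2\<close> below \<open>C\<close>, hence the
    points away from the two poles with \<open>m$2 = m$3 = 0\<close>, where the angle would be
    lost.\<close>
  have w2: "C - 1 / n \<theta> \<ge> 0" "C - 1 / n \<theta> < C" if "t\<^sub>1 \<le> \<theta>" "\<theta> \<le> t\<^sub>2" for \<theta>
    using nge[OF that] n0[OF that] C by (simp_all add: field_simps)
  have \<theta>r: "t\<^sub>1 \<le> \<theta> s \<and> \<theta> s \<le> t\<^sub>2 \<longleftrightarrow> -1 \<le> s \<and> s \<le> 1" "t\<^sub>1 < \<theta> s \<and> \<theta> s < t\<^sub>2 \<longleftrightarrow> -1 < s \<and> s < 1" for s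
  proof -
    have "\<theta> s - t\<^sub>1 = (s + 1) * ((t\<^sub>2 - t\<^sub>1) / 2)" "t\<^sub>2 - \<theta> s = (1 - s) * ((t\<^sub>2 - t\<^sub>1) / 2)"
      by (simp_all add: \<theta>_def field_simps)
    moreover have "0 \<le> a * c \<longleftrightarrow> 0 \<le> a" "0 < a * c \<longleftrightarrow> 0 < a" if "c > 0" for a c :: real
      using that by (simp_all add: zero_le_mult_iff zero_less_mult_iff)
    moreover have "(t\<^sub>2 - t\<^sub>1) / 2 > 0" using t by simp
    ultimately have "\<theta> s - t\<^sub>1 \<ge> 0 \<longleftrightarrow> s + 1 \<ge> 0" "t\<^sub>2 - \<theta> s \<ge> 0 \<longleftrightarrow> 1 - s \<ge> 0"
      "\<theta> s - t\<^sub>1 > 0 \<longleftrightarrow> s + 1 > 0" "t\<^sub>2 - \<theta> s > 0 \<longleftrightarrow> 1 - s > 0"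
      by metis+
    then show "t\<^sub>1 \<le> \<theta> s \<and> \<theta> s \<le> t\<^sub>2 \<longleftrightarrow> -1 \<le> s \<and> s \<le> 1" "t\<^sub>1 < \<theta> s \<and> \<theta> s < t\<^sub>2 \<longleftrightarrow> -1 < s \<and> s < 1"
      by linarith+
  qed
  have "\<exists>d :: real^2 \<Rightarrow> real \<times> real. continuous_on (cball 0 1) d \<and> inj_on d (cball 0 1) \<and>
    d ` cball 0 1 = {(s, x). -1 \<le> s \<and> s \<le> 1 \<and> \<bar>x\<bar> \<le> w (\<theta> s)} \<and>
    d ` ball 0 1 = {(s, x). -1 < s \<and> s < 1 \<and> \<bar>x\<bar> < w (\<theta> s)}"
  proof (rule disc_onto_region)
    have nz: "n (\<theta> s) \<noteq> 0" if "s \<in> {-1..1}" for s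
      using n0[of "\<theta> s"] \<theta>r(1)[of s] that by auto
    have "continuous_on {-1..1} (\<lambda>s. n (\<theta> s))"
      unfolding n_def \<theta>_def by (intro continuous_on_nu continuous_intros) auto
    then show "continuous_on {-1..1} (\<lambda>s. w (\<theta> s))"
      unfolding w_def by (intro continuous_intros) (use nz in auto)
    have "\<theta> (-1) = t\<^sub>1" "\<theta> 1 = t\<^sub>2" by (simp_all add: \<theta>_def field_simps)
    then show "w (\<theta> (-1)) = 0" "w (\<theta> 1) = 0" using n1 by (simp_all add: w_def)
    show "w (\<theta> s) > 0" if "-1 < s" "s < 1" for s
    proof -
      have "t\<^sub>1 < \<theta> s" "\<theta> s < t\<^sub>2" using \<theta>r that by blast+
      then have "n (\<theta> s) > 1 / C" "n (\<theta> s) > 0" using n1(3) n0 by auto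
      then show ?thesis using C by (simp add: w_def field_simps)
    qed
  qed
  then obtain d :: "real^2 \<Rightarrow> real \<times> real" where d: "continuous_on (cball 0 1) d" "inj_on d (cball 0 1)"
    "d ` cball 0 1 = {(s, x). -1 \<le> s \<and> s \<le> 1 \<and> \<bar>x\<bar> \<le> w (\<theta> s)}"
    "d ` ball 0 1 = {(s, x). -1 < s \<and> s < 1 \<and> \<bar>x\<bar> < w (\<theta> s)}"
    by blast
  define G :: "real \<times> real \<Rightarrow> real^3" where
    "G = (\<lambda>(s, x). vector [x, sqrt (C - x\<^sup>2) * cos (\<theta> s), sqrt (C - x\<^sup>2) * sin (\<theta> s)])"
  have Gc: "continuous_on UNIV G"
    unfolding G_def \<theta>_def case_prod_beta by (intro continuous_on_vec3 continuous_intros) auto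
  have wabs: "\<bar>x\<bar> \<le> w t \<longleftrightarrow> x\<^sup>2 \<le> C - 1 / n t" "\<bar>x\<bar> < w t \<longleftrightarrow> x\<^sup>2 < C - 1 / n t" if "t\<^sub>1 \<le> t" "t \<le> t\<^sub>2" for x t
  proof -
    have "(w t)\<^sup>2 = C - 1 / n t" "w t \<ge> 0" using w2[OF that] by (simp_all add: w_def)
    then show "\<bar>x\<bar> \<le> w t \<longleftrightarrow> x\<^sup>2 \<le> C - 1 / n t" "\<bar>x\<bar> < w t \<longleftrightarrow> x\<^sup>2 < C - 1 / n t"
      using abs_le_square_iff[of x "w t"] abs_le_square_iff[of "w t" x] by auto
  qed
  have xC: "x\<^sup>2 < C" if "-1 \<le> s" "s \<le> 1" "\<bar>x\<bar> \<le> w (\<theta> s)" for s x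
  proof -
    have "t\<^sub>1 \<le> \<theta> s" "\<theta> s \<le> t\<^sub>2" using \<theta>r that by blast+
    from wabs(1)[OF this, of x] w2(2)[OF this] that(3) show ?thesis by linarith
  qed
  have Gm: "casimir (G (s, x)) = C \<and> has_angle (G (s, x)) (\<theta> s) \<and> G (s, x) $ 1 = x" if "x\<^sup>2 < C" for s x
  proof -
    define r where "r = sqrt (C - x\<^sup>2)"
    have r: "r \<ge> 0" "r\<^sup>2 = C - x\<^sup>2" using that by (simp_all add: r_def)
    have c: "G (s, x) $ 1 = x" "G (s, x) $ 2 = r * cos (\<theta> s)" "G (s, x) $ 3 = r * sin (\<theta> s)"
      by (simp_all add: G_def r_def)
    have e: "(r * cos (\<theta> s))\<^sup>2 + (r * sin (\<theta> s))\<^sup>2 = r\<^sup>2"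
      by (simp add: power_mult_distrib flip: distrib_left)
    then have "casimir (G (s, x)) = C" unfolding casimir_def c using r(2) by linarith
    moreover have "has_angle (G (s, x)) (\<theta> s)" unfolding has_angle_def c e using r(1) by simp
    ultimately show ?thesis using c(1) by blast
  qed
  have onto: "\<exists>s. G (s, m$1) = m \<and> \<theta> s = t" if "casimir m = C" "has_angle m t" for m t
  proof -
    define s where "s = (t - (t\<^sub>1 + t\<^sub>2) / 2) / ((t\<^sub>2 - t\<^sub>1) / 2)"
    have "(t\<^sub>2 - t\<^sub>1) / 2 \<noteq> 0" using t by simp
    note X = nonzero_eq_divide_eq[OF this, THEN iffD1, OF s_def]
    have "a + (t - a) = t" for a :: real by simp
    then have "\<theta> s = t" by (simp only: \<theta>_def X)
    moreover have "C - (m$1)\<^sup>2 = (m$2)\<^sup>2 + (m$3)\<^sup>2" using that by (simp add: casimir_def)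
    ultimately show ?thesis using that(2)
      by (intro exI[of _ s]) (simp add: G_def has_angle_def vec_eq_iff forall_3)
  qed
  have im1: "G ` {(s, x). -1 \<le> s \<and> s \<le> 1 \<and> \<bar>x\<bar> \<le> w (\<theta> s)} =
      {m. casimir m = C \<and> discr C h m \<le> 0 \<and> (\<exists>\<theta>. t\<^sub>1 \<le> \<theta> \<and> \<theta> \<le> t\<^sub>2 \<and> has_angle m \<theta>)}"
  proof (intro equalityI subsetI)
    fix m assume "m \<in> G ` {(s, x). -1 \<le> s \<and> s \<le> 1 \<and> \<bar>x\<bar> \<le> w (\<theta> s)}"
    then obtain s x where sx: "-1 \<le> s" "s \<le> 1" "\<bar>x\<bar> \<le> w (\<theta> s)" "m = G (s, x)" by auto
    note m = Gm[OF xC[OF sx(1-3)], of s, folded sx(4)]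
    have ts: "t\<^sub>1 \<le> \<theta> s" "\<theta> s \<le> t\<^sub>2" using \<theta>r sx by blast+
    have "discr C h m \<le> 0"
      using discr_has_angle(2)[OF C, of m "\<theta> s" h] m n0[OF ts] wabs(1)[OF ts] sx(3) unfolding n_def by simp
    then show "m \<in> {m. casimir m = C \<and> discr C h m \<le> 0 \<and> (\<exists>\<theta>. t\<^sub>1 \<le> \<theta> \<and> \<theta> \<le> t\<^sub>2 \<and> has_angle m \<theta>)}"
      using m ts by blast
  next
    fix m assume "m \<in> {m. casimir m = C \<and> discr C h m \<le> 0 \<and> (\<exists>\<theta>. t\<^sub>1 \<le> \<theta> \<and> \<theta> \<le> t\<^sub>2 \<and> has_angle m \<theta>)}"
    then obtain t where m: "casimir m = C" "discr C h m \<le> 0" "t\<^sub>1 \<le> t" "t \<le> t\<^sub>2" "has_angle m t" by blast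
    obtain s where s: "G (s, m$1) = m" "\<theta> s = t" using onto[OF m(1,5)] by blast
    have "\<bar>m$1\<bar> \<le> w t"
      using discr_has_angle(2)[OF C m(1,5), of h] n0[OF m(3,4)] wabs(1)[OF m(3,4)] m(2) unfolding n_def by simp
    moreover have "-1 \<le> s \<and> s \<le> 1" using \<theta>r s m by blast
    ultimately show "m \<in> G ` {(s, x). -1 \<le> s \<and> s \<le> 1 \<and> \<bar>x\<bar> \<le> w (\<theta> s)}"
      using s by (intro image_eqI[of _ _ "(s, m$1)"]) auto
  qed
  have im2: "G ` {(s, x). -1 < s \<and> s < 1 \<and> \<bar>x\<bar> < w (\<theta> s)} =
      {m. casimir m = C \<and> discr C h m < 0 \<and> (\<exists>\<theta>. t\<^sub>1 < \<theta> \<and> \<theta> < t\<^sub>2 \<and> has_angle m \<theta>)}"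
  proof (intro equalityI subsetI)
    fix m assume "m \<in> G ` {(s, x). -1 < s \<and> s < 1 \<and> \<bar>x\<bar> < w (\<theta> s)}"
    then obtain s x where sx: "-1 < s" "s < 1" "\<bar>x\<bar> < w (\<theta> s)" "m = G (s, x)" by auto
    have "x\<^sup>2 < C" using xC[of s x] sx by simp
    note m = Gm[OF this, of s, folded sx(4)]
    have ts: "t\<^sub>1 < \<theta> s" "\<theta> s < t\<^sub>2" using \<theta>r sx by blast+
    then have ts': "t\<^sub>1 \<le> \<theta> s" "\<theta> s \<le> t\<^sub>2" by auto
    have "discr C h m < 0"
      using discr_has_angle(2)[OF C, of m "\<theta> s" h] m n0[OF ts'] wabs(2)[OF ts'] sx(3) unfolding n_def by simp
    then show "m \<in> {m. casimir m = C \<and> discr C h m < 0 \<and> (\<exists>\<theta>. t\<^sub>1 < \<theta> \<and> \<theta> < t\<^sub>2 \<and> has_angle m \<theta>)}"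
      using m ts by blast
  next
    fix m assume "m \<in> {m. casimir m = C \<and> discr C h m < 0 \<and> (\<exists>\<theta>. t\<^sub>1 < \<theta> \<and> \<theta> < t\<^sub>2 \<and> has_angle m \<theta>)}"
    then obtain t where m: "casimir m = C" "discr C h m < 0" "t\<^sub>1 < t" "t < t\<^sub>2" "has_angle m t" by blast
    then have t': "t\<^sub>1 \<le> t" "t \<le> t\<^sub>2" by auto
    obtain s where s: "G (s, m$1) = m" "\<theta> s = t" using onto[OF m(1,5)] by blast
    have "\<bar>m$1\<bar> < w t"
      using discr_has_angle(2)[OF C m(1,5), of h] n0[OF t'] wabs(2)[OF t'] m(2) unfolding n_def by simp
    moreover have "-1 < s \<and> s < 1" using \<theta>r s m by blast
    ultimately show "m \<in> G ` {(s, x). -1 < s \<and> s < 1 \<and> \<bar>x\<bar> < w (\<theta> s)}"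
      using s by (intro image_eqI[of _ _ "(s, m$1)"]) auto
  qed
  have Gi: "inj_on G {(s, x). -1 \<le> s \<and> s \<le> 1 \<and> \<bar>x\<bar> \<le> w (\<theta> s)}"
  proof (rule inj_onI, clarify)
    fix s x s' x' assume s: "-1 \<le> s" "s \<le> 1" "\<bar>x\<bar> \<le> w (\<theta> s)" and s': "-1 \<le> s'" "s' \<le> 1" "\<bar>x'\<bar> \<le> w (\<theta> s')"
      and eq: "G (s, x) = G (s', x')"
    have "x = x'" using eq Gm[OF xC[OF s], of s] Gm[OF xC[OF s'], of s'] by metis
    moreover have "t\<^sub>1 \<le> \<theta> s" "\<theta> s \<le> t\<^sub>2" "t\<^sub>1 \<le> \<theta> s'" "\<theta> s' \<le> t\<^sub>2" using \<theta>r s s' by blast+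
    then have "\<bar>\<theta> s - \<theta> s'\<bar> < 2 * pi" using t(2) by linarith
    moreover have "G (s, x) \<in> {m. casimir m = C \<and> discr C h m \<le> 0 \<and> (\<exists>\<theta>. t\<^sub>1 \<le> \<theta> \<and> \<theta> \<le> t\<^sub>2 \<and> has_angle m \<theta>)}"
      unfolding im1[symmetric] using s by auto
    moreover have "has_angle (G (s, x)) (\<theta> s)" "has_angle (G (s, x)) (\<theta> s')"
      using Gm[OF xC[OF s], of s] Gm[OF xC[OF s'], of s'] eq by auto
    ultimately have "\<theta> s = \<theta> s'" using has_angle_unique[of "G (s, x)" "\<theta> s" "\<theta> s'" C h] by blast
    then show "s = s' \<and> x = x'" using t \<open>x = x'\<close> by (simp add: \<theta>_def)
  qed
  show ?thesis
  proof (intro exI[of _ "G \<circ> d"] conjI)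
    show "continuous_on (cball 0 1) (G \<circ> d)"
      using d(1) Gc continuous_on_subset by (intro continuous_on_compose) blast+
    show "inj_on (G \<circ> d) (cball 0 1)" using d(2) Gi unfolding d(3)[symmetric] by (rule comp_inj_on)
    show "(G \<circ> d) ` cball 0 1 = {m. casimir m = C \<and> discr C h m \<le> 0 \<and> (\<exists>\<theta>. t\<^sub>1 \<le> \<theta> \<and> \<theta> \<le> t\<^sub>2 \<and> has_angle m \<theta>)}"
      unfolding image_comp[symmetric] d(3) im1 ..
    show "(G \<circ> d) ` ball 0 1 = {m. casimir m = C \<and> discr C h m < 0 \<and> (\<exists>\<theta>. t\<^sub>1 < \<theta> \<and> \<theta> < t\<^sub>2 \<and> has_angle m \<theta>)}"
      unfolding image_comp[symmetric] d(4) im2 ..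
  qed
qed

text \<open>Each odd arc carries one disk of the complement. The arc from \<alpha> 0 to \<alpha> 1
  is nondegenerate, so all disks have their angles in a window shorter than \<open>2 * pi\<close>,
  and a point lies over only one of these angles. Degenerate even arcs still allow the components to
  be counted, but make two closed disks touch.\<close>

lemma marked_image:
  assumes C: "C > 0" and marked: "marked C h k \<alpha>" and \<alpha>01: "\<alpha> 0 < \<alpha> 1"
    and A: "A = {m. casimir m = C \<and> discr C h m \<ge> 0}"
  shows "card (components (casimir_sphere C - A)) = k"
    and "(\<And>i. i < 2 * k \<Longrightarrow> \<alpha> i < \<alpha> (Suc i)) \<Longrightarrow> minus_open_disks k (casimir_sphere C) A"
    and "k \<ge> 2 \<Longrightarrow> \<alpha> 2 = \<alpha> 3 \<Longrightarrow> \<exists>c\<in>components (casimir_sphere C - A). \<exists>c'\<in>components (casimir_sphere C - A).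
      c \<noteq> c' \<and> closure c \<inter> closure c' \<noteq> {}"
proof -
  define lo where "lo i = \<alpha> (2 * i + 1)" for i
  define hi where "hi i = \<alpha> (2 * i + 2)" for i
  have mono: "\<alpha> i \<le> \<alpha> j" if "i \<le> j" "j \<le> 2 * k" for i j using marked_mono[OF marked that] .
  have total: "\<alpha> (2 * k) = \<alpha> 0 + 2 * pi" using marked by (simp add: marked_def)
  have bounds: "\<alpha> 1 \<le> lo i" "hi i \<le> \<alpha> (2 * k)" "lo i < hi i" if "i < k" for i
    using mono[of 1 "2 * i + 1"] mono[of "2 * i + 2" "2 * k"] marked that
    unfolding lo_def hi_def marked_def by auto
  have "\<forall>i\<in>{..<k}. \<exists>e :: real^2 \<Rightarrow> real^3. continuous_on (cball 0 1) e \<and> inj_on e (cball 0 1) \<and>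
    e ` cball 0 1 = {m. casimir m = C \<and> discr C h m \<le> 0 \<and> (\<exists>\<theta>. lo i \<le> \<theta> \<and> \<theta> \<le> hi i \<and> has_angle m \<theta>)} \<and>
    e ` ball 0 1 = {m. casimir m = C \<and> discr C h m < 0 \<and> (\<exists>\<theta>. lo i < \<theta> \<and> \<theta> < hi i \<and> has_angle m \<theta>)}"
  proof
    fix i assume "i \<in> {..<k}"
    then have i: "i < k" "2 * i + 1 < 2 * k" by auto
    show "\<exists>e :: real^2 \<Rightarrow> real^3. continuous_on (cball 0 1) e \<and> inj_on e (cball 0 1) \<and>
    e ` cball 0 1 = {m. casimir m = C \<and> discr C h m \<le> 0 \<and> (\<exists>\<theta>. lo i \<le> \<theta> \<and> \<theta> \<le> hi i \<and> has_angle m \<theta>)} \<and>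
    e ` ball 0 1 = {m. casimir m = C \<and> discr C h m < 0 \<and> (\<exists>\<theta>. lo i < \<theta> \<and> \<theta> < hi i \<and> has_angle m \<theta>)}"
    proof (rule disc_outside_image[OF C])
      show "lo i < hi i" "hi i - lo i < 2 * pi" using bounds[OF i(1)] \<alpha>01 total by linarith+
      show "gcirc C h (lo i) = 0" "gcirc C h (hi i) = 0" using marked i by (auto simp: marked_def lo_def hi_def)
      show "gcirc C h \<theta> < 0" if "lo i < \<theta>" "\<theta> < hi i" for \<theta>
      proof -
        have "odd (2 * i + 1)" "\<alpha> (2 * i + 1) < \<theta>" "\<theta> < \<alpha> (Suc (2 * i + 1))" using that by (simp_all add: lo_def hi_def)
        then show ?thesis using marked i(2) unfolding marked_def by blast
      qed
    qed
  qed
  from bchoice[OF this] obtain e :: "nat \<Rightarrow> real^2 \<Rightarrow> real^3" where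
    E: "\<forall>i\<in>{..<k}. continuous_on (cball 0 1) (e i) \<and> inj_on (e i) (cball 0 1) \<and>
    e i ` cball 0 1 = {m. casimir m = C \<and> discr C h m \<le> 0 \<and> (\<exists>\<theta>. lo i \<le> \<theta> \<and> \<theta> \<le> hi i \<and> has_angle m \<theta>)} \<and>
    e i ` ball 0 1 = {m. casimir m = C \<and> discr C h m < 0 \<and> (\<exists>\<theta>. lo i < \<theta> \<and> \<theta> < hi i \<and> has_angle m \<theta>)}" ..
  have e: "\<And>i. i < k \<Longrightarrow> continuous_on (cball 0 1) (e i)" "\<And>i. i < k \<Longrightarrow> inj_on (e i) (cball 0 1)"
    and ecb: "\<And>i. i < k \<Longrightarrow> e i ` cball 0 1 = {m. casimir m = C \<and> discr C h m \<le> 0 \<and> (\<exists>\<theta>. lo i \<le> \<theta> \<and> \<theta> \<le> hi i \<and> has_angle m \<theta>)}"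
    and eb: "\<And>i. i < k \<Longrightarrow> e i ` ball 0 1 = {m. casimir m = C \<and> discr C h m < 0 \<and> (\<exists>\<theta>. lo i < \<theta> \<and> \<theta> < hi i \<and> has_angle m \<theta>)}"
    using E by blast+
  have order: "hi i \<le> lo j" if "i < j" "j < k" for i j
    using mono[of "2 * i + 2" "2 * j + 1"] that by (simp add: lo_def hi_def)
  have sep: "e i ` cball 0 1 \<inter> e j ` ball 0 1 = {}" if ij: "i < k" "j < k" "i \<noteq> j" for i j
  proof (rule ccontr)
    assume "e i ` cball 0 1 \<inter> e j ` ball 0 1 \<noteq> {}"
    then obtain m \<theta> \<theta>' where m: "discr C h m \<le> 0" "lo i \<le> \<theta>" "\<theta> \<le> hi i" "has_angle m \<theta>" "lo j < \<theta>'" "\<theta>' < hi j" "has_angle m \<theta>'"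
      unfolding ecb[OF ij(1)] eb[OF ij(2)] by blast
    have "\<bar>\<theta> - \<theta>'\<bar> < 2 * pi" using m bounds[OF ij(1)] bounds[OF ij(2)] total \<alpha>01 by linarith
    then have "\<theta> = \<theta>'" using has_angle_unique m by blast
    then show False using m order[of i j] order[of j i] ij by (cases "i < j") force+
  qed
  have locate: "\<exists>i<n. \<alpha> i \<le> \<theta> \<and> \<theta> < \<alpha> (Suc i)" if "\<alpha> 0 \<le> \<theta>" "\<theta> < \<alpha> n" for n \<theta>
    using that
  proof (induction n)
    case (Suc n)
    show ?case
    proof (cases "\<theta> < \<alpha> n")
      case True
      then show ?thesis using Suc by (meson less_SucI)
    next
      case False
      then show ?thesis using Suc by (intro exI[of _ n]) auto
    qed
  qed simp
  have U: "casimir_sphere C - A = (\<Union>i<k. e i ` ball 0 1)"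
  proof (intro equalityI subsetI)
    fix m assume "m \<in> casimir_sphere C - A"
    then have m: "casimir m = C" "discr C h m < 0" by (auto simp: casimir_sphere_def A)
    obtain \<theta> where \<theta>: "\<alpha> 0 \<le> \<theta>" "\<theta> < \<alpha> 0 + 2 * pi" "has_angle m \<theta>"
      unfolding has_angle_def by (rule polar_coordinates[of "\<alpha> 0" "m$2" "m$3"]) blast
    define n where "n = nu (4 * h - C) (cos \<theta>) (sin \<theta>)"
    \<comment> \<open>Moving along the meridian to the great circle only increases
      \<open>nu\<close>, so a point outside the image has an angle with negative
      \<open>gcirc\<close>.\<close>
    have "(C - (m$1)\<^sup>2) * n > 1" using discr_nu(4)[OF m(1)] discr_has_angle(1)[OF C m(1) \<theta>(3)] m(2) by (simp add: n_def)
    moreover have "(C - (m$1)\<^sup>2) * n \<le> C * n"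
      using nu_nonneg by (intro mult_right_mono) (auto simp: n_def)
    ultimately have "n > 1 / C" using C by (simp add: field_simps)
    then have g: "gcirc C h \<theta> < 0" using gcirc_nu(3)[OF C] by (simp add: n_def)
    obtain i where i: "i < 2 * k" "\<alpha> i \<le> \<theta>" "\<theta> < \<alpha> (Suc i)"
      using locate[of \<theta> "2 * k"] \<theta> total by auto
    have ne: "\<alpha> i \<noteq> \<theta>" using g i(1) marked unfolding marked_def by (metis less_imp_le less_irrefl)
    then have "odd i" using i g marked unfolding marked_def by (metis less_asym' order_le_less)
    then obtain j where j: "i = 2 * j + 1" by (rule oddE)
    have "j < k" "lo j < \<theta>" "\<theta> < hi j" using i ne j by (auto simp: lo_def hi_def)
    then show "m \<in> (\<Union>i<k. e i ` ball 0 1)" using eb m \<theta>(3) by blast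
  next
    fix m assume "m \<in> (\<Union>i<k. e i ` ball 0 1)"
    then obtain i where "i < k" "m \<in> e i ` ball 0 1" by blast
    then show "m \<in> casimir_sphere C - A" unfolding eb[OF \<open>i < k\<close>] by (auto simp: casimir_sphere_def A)
  qed
  note comps = minus_open_disks_components[of k e, OF e sep U]
  show "card (components (casimir_sphere C - A)) = k" by (rule comps(2))
  have AS: "A \<subseteq> casimir_sphere C" by (auto simp: A casimir_sphere_def)
  show "minus_open_disks k (casimir_sphere C) A" if strict: "\<And>i. i < 2 * k \<Longrightarrow> \<alpha> i < \<alpha> (Suc i)"
    unfolding minus_open_disks_def
  proof (intro exI[of _ e] conjI allI impI)
    fix i assume i: "i < k"
    show "continuous_on (cball 0 1) (e i)" "inj_on (e i) (cball 0 1)" using e i by auto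
    show "e i ` cball 0 1 \<subseteq> casimir_sphere C" unfolding ecb[OF i] by (auto simp: casimir_sphere_def)
  next
    have sorder: "hi i < lo j" if "i < j" "j < k" for i j
    proof -
      have "hi i < \<alpha> (Suc (2 * i + 2))" using strict[of "2 * i + 2"] that by (simp add: hi_def)
      also have "\<dots> \<le> lo j" unfolding lo_def using that by (intro mono) auto
      finally show ?thesis .
    qed
    show "disjoint_family_on (\<lambda>i. e i ` cball 0 1) {..<k}"
      unfolding disjoint_family_on_def
    proof (intro ballI impI, rule ccontr)
      fix i j assume "i \<in> {..<k}" "j \<in> {..<k}" and ne: "i \<noteq> j" "e i ` cball 0 1 \<inter> e j ` cball 0 1 \<noteq> {}"
      then have ij: "i < k" "j < k" by auto
      then obtain m \<theta> \<theta>' where m: "discr C h m \<le> 0" "lo i \<le> \<theta>" "\<theta> \<le> hi i" "has_angle m \<theta>" "lo j \<le> \<theta>'" "\<theta>' \<le> hi j" "has_angle m \<theta>'"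
        using ne(2) unfolding ecb[OF ij(1)] ecb[OF ij(2)] by blast
      have "\<bar>\<theta> - \<theta>'\<bar> < 2 * pi" using m bounds[OF ij(1)] bounds[OF ij(2)] total \<alpha>01 by linarith
      then have "\<theta> = \<theta>'" using has_angle_unique m by blast
      then show False using m sorder[of i j] sorder[of j i] ij ne(1) by (cases "i < j") force+
    qed
    show "A = casimir_sphere C - (\<Union>i<k. e i ` ball 0 1)" using U AS by blast
  qed
  show "\<exists>c\<in>components (casimir_sphere C - A). \<exists>c'\<in>components (casimir_sphere C - A). c \<noteq> c' \<and> closure c \<inter> closure c' \<noteq> {}"
    if k: "k \<ge> 2" and pinch: "\<alpha> 2 = \<alpha> 3"
  proof -
    \<comment> \<open>The pinch angle ends the first closed disk and starts the second. Their common
      point lies on the great circle and in the closure of both open disks.\<close>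
    define t where "t = \<alpha> 2"
    have "hi 0 = \<alpha> 2" by (simp add: hi_def numeral_2_eq_2)
    moreover have "lo 1 = \<alpha> 3" by (simp add: lo_def numeral_3_eq_3)
    ultimately have hl: "hi 0 = t" "lo 1 = t" by (simp_all add: t_def pinch)
    define m :: "real^3" where "m = vector [0, sqrt C * cos t, sqrt C * sin t]"
    have e2: "(sqrt C * cos t)\<^sup>2 + (sqrt C * sin t)\<^sup>2 = C"
      using C by (simp add: power_mult_distrib flip: distrib_left)
    have m: "casimir m = C" "has_angle m t"
      using e2 by (simp_all add: m_def casimir_def has_angle_def)
    have "gcirc C h t = 0" using marked k by (simp add: marked_def t_def)
    then have "nu (4 * h - C) (cos t) (sin t) = 1 / C" using gcirc_nu[OF C] by blast
    then have "discr C h m \<le> 0"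
      using discr_has_angle(2)[OF C m, of h] C by (simp add: m_def)
    moreover have k01: "0 < k" "1 < k" using k by auto
    moreover have "lo 0 \<le> t" "t \<le> hi 1" using bounds(3)[OF k01(1)] bounds(3)[OF k01(2)] hl by simp_all
    ultimately have in2: "m \<in> e 0 ` cball 0 1" "m \<in> e 1 ` cball 0 1"
      unfolding ecb[OF k01(1)] ecb[OF k01(2)] using m hl by (auto intro!: exI[of _ t])
    have cl: "e i ` cball 0 1 \<subseteq> closure (e i ` ball 0 1)" if "i < k" for i
    proof -
      have "e i ` closure (ball 0 1) \<subseteq> closure (e i ` ball 0 1)"
        by (rule image_closure_subset) (simp_all add: e(1)[OF that] closure_subset)
      then show ?thesis by simp
    qed
    have "e 0 ` ball 0 1 \<noteq> e 1 ` ball 0 1"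
    proof
      assume "e 0 ` ball 0 1 = e 1 ` ball 0 1"
      moreover have "e 0 ` ball 0 1 \<inter> e 1 ` ball 0 1 = {}"
        using sep[OF k01 zero_neq_one] image_mono[OF ball_subset_cball[of 0 1], of "e 0"] by blast
      ultimately have "e 0 ` ball 0 1 = {}" by blast
      then show False by simp
    qed
    moreover have "e 0 ` ball 0 1 \<in> components (casimir_sphere C - A)" "e 1 ` ball 0 1 \<in> components (casimir_sphere C - A)"
      using comps(1) k01 by blast+
    moreover have "m \<in> closure (e 0 ` ball 0 1) \<inter> closure (e 1 ` ball 0 1)" using in2 cl[of 0] cl[of 1] k by auto
    ultimately show ?thesis by blast
  qed
qed

subsection \<open>The great circle\<close>

text \<open>The condition \<open>crit\<close> is a Lagrange condition. At the single point of the
  collapsed fibre the derivatives of the Hamiltonian in \<xi>, \<open>p\<close> and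
  \<open>m$1\<close> vanish, and its gradient in \<open>m$2\<close>, \<open>m$3\<close> is parallel
  to \<open>(y, z)\<close> if \<open>\<xi> * (2 y z \<xi> + z^2 - y^2) = 0\<close>. The factor \<xi>
  is 0 if \<open>1 + y z = 0\<close>, and the other one is 0 if \<open>y = - z^3\<close>.\<close>

lemma nonregular_level:
  fixes y z C h :: real
  assumes z: "z \<noteq> 0" and yz: "y\<^sup>2 + z\<^sup>2 = C" "(1 + y * z)\<^sup>2 = (2 * C - 4 * h) * z\<^sup>2"
    and crit: "y = - (z ^ 3) \<or> 1 + y * z = 0"
  shows "\<not> regular_level C h"
proof
  assume reg: "regular_level C h"
  \<comment> \<open>This makes \<open>X\<close> vanish, and \<open>P\<close> vanishes for
    \<open>p = 0\<close> and \<open>m$1 = 0\<close>.\<close>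
  define \<xi> where "\<xi> = (1 + y * z) / (2 * z\<^sup>2)"
  define m :: "real^3" where "m = vector [0, y, z]"
  have m: "m$1 = 0" "m$2 = y" "m$3 = z" by (simp_all add: m_def)
  have cas: "casimir m = C" using yz(1) by (simp add: casimir_def m)
  have "z\<^sup>2 * (2 * 0 - 0)\<^sup>2 + (2 * z\<^sup>2 * \<xi> - (1 + y * z))\<^sup>2 = (1 + y * z)\<^sup>2 + (0 * z)\<^sup>2 - (2 * C - 4 * h) * z\<^sup>2"
    using z yz(2) by (simp add: \<xi>_def)
  then have "hamiltonian ((\<xi>, 0), m) = h"
    unfolding hamiltonian_level[OF cas] m using level_completed_square_iff[OF z] by blast
  then have "((\<xi>, 0), m) \<in> level_set C h" using cas by (simp add: level_set_def)
  then obtain D where D: "((\<lambda>x. (hamiltonian x, casimir (snd x))) has_derivative D) (at ((\<xi>, 0), m))" "surj D"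
    using reg unfolding regular_level_def by blast
  \<comment> \<open>A direction in which the Hamiltonian changes at unit speed while the Casimir is
    stationary; parallel gradients rule it out.\<close>
  obtain w where w: "D w = (1, 0)" using D(2) by (metis surjD)
  define d\<xi> dp where "d\<xi> = fst (fst w)" and "dp = snd (fst w)"
  define d1 d2 d3 where "d1 = snd w $ 1" and "d2 = snd w $ 2" and "d3 = snd w $ 3"
  have "((\<lambda>t. ((\<xi>, 0), m) + t *\<^sub>R w) has_derivative (\<lambda>t. t *\<^sub>R w)) (at 0)"
    by (auto intro!: derivative_eq_intros)
  from has_derivative_compose[OF this, of "\<lambda>x. (hamiltonian x, casimir (snd x))" D] D(1)
  have "((\<lambda>t. (hamiltonian (((\<xi>, 0), m) + t *\<^sub>R w), casimir (snd (((\<xi>, 0), m) + t *\<^sub>R w)))) has_derivative (\<lambda>t. D (t *\<^sub>R w))) (at 0)"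
    by simp
  moreover have "D (t *\<^sub>R w) = (t, 0)" for t
    using linear_scale[OF has_derivative_linear[OF D(1)], of t w] w by simp
  ultimately have dd: "((\<lambda>t. (hamiltonian (((\<xi>, 0), m) + t *\<^sub>R w), casimir (snd (((\<xi>, 0), m) + t *\<^sub>R w)))) has_derivative (\<lambda>t. (t, 0))) (at 0)"
    by simp
  have times1: "(*) (1::real) = (\<lambda>x. x)" by auto
  have dH: "((\<lambda>t. hamiltonian (((\<xi>, 0), m) + t *\<^sub>R w)) has_real_derivative 1) (at 0)"
    and dC: "((\<lambda>t. casimir (snd (((\<xi>, 0), m) + t *\<^sub>R w))) has_real_derivative 0) (at 0)"
    using has_derivative_fst[OF dd] has_derivative_snd[OF dd]
    by (simp_all add: has_field_derivative_def times1 lambda_zero)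
  have wc: "fst (((\<xi>, 0), m) + t *\<^sub>R w) = (\<xi> + t * d\<xi>, t * dp)" "snd (((\<xi>, 0), m) + t *\<^sub>R w) $ 1 = t * d1"
    "snd (((\<xi>, 0), m) + t *\<^sub>R w) $ 2 = y + t * d2" "snd (((\<xi>, 0), m) + t *\<^sub>R w) $ 3 = z + t * d3" for t
    by (simp_all add: d\<xi>_def dp_def d1_def d2_def d3_def m prod_eq_iff)
  have "((\<lambda>t. casimir (snd (((\<xi>, 0), m) + t *\<^sub>R w))) has_real_derivative 2 * (y * d2 + z * d3)) (at 0)"
    unfolding casimir_def wc by (auto intro!: derivative_eq_intros)
  from DERIV_unique[OF this dC] have C0: "y * d2 + z * d3 = 0" by simp
  have "((\<lambda>t. hamiltonian (((\<xi>, 0), m) + t *\<^sub>R w)) has_real_derivative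
      (y - \<xi> * z) * d2 + (z + 2 * z * \<xi>\<^sup>2 - \<xi> * y) * d3 + (2 * z\<^sup>2 * \<xi> - (1 + y * z)) * d\<xi>) (at 0)"
    unfolding hamiltonian_def case_prod_beta wc fst_conv snd_conv
    by (auto intro!: derivative_eq_intros simp: power2_eq_square algebra_simps)
  from DERIV_unique[OF this dH]
  have H1: "(y - \<xi> * z) * d2 + (z + 2 * z * \<xi>\<^sup>2 - \<xi> * y) * d3 + (2 * z\<^sup>2 * \<xi> - (1 + y * z)) * d\<xi> = 1" .
  have zx: "2 * z\<^sup>2 * \<xi> - (1 + y * z) = 0" using z by (simp add: \<xi>_def)
  have "z * (y - \<xi> * z) = y * (z + 2 * z * \<xi>\<^sup>2 - \<xi> * y)"
  proof -
    have "y * (z + 2 * z * \<xi>\<^sup>2 - \<xi> * y) - z * (y - \<xi> * z) = \<xi> * (2 * y * z * \<xi> + z\<^sup>2 - y\<^sup>2)"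
      by (simp add: power2_eq_square algebra_simps)
    also have "\<dots> = 0"
      using crit
    proof
      assume "1 + y * z = 0"
      then show ?thesis by (simp add: \<xi>_def)
    next
      assume y: "y = - (z ^ 3)"
      have "2 * y * z * \<xi> = - z\<^sup>2 * (2 * z\<^sup>2 * \<xi>)"
        by (simp add: y power2_eq_square power3_eq_cube)
      also have "\<dots> = - z\<^sup>2 * (1 + y * z)" using zx by simp
      also have "\<dots> = y\<^sup>2 - z\<^sup>2" by (simp add: y power2_eq_square power3_eq_cube algebra_simps)
      finally show ?thesis by simp
    qed
    finally show ?thesis by simp
  qed
  then have "y - \<xi> * z = (z + 2 * z * \<xi>\<^sup>2 - \<xi> * y) / z * y" "z + 2 * z * \<xi>\<^sup>2 - \<xi> * y = (z + 2 * z * \<xi>\<^sup>2 - \<xi> * y) / z * z"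
    using z by (simp_all add: field_simps)
  then obtain l where l: "y - \<xi> * z = l * y" "z + 2 * z * \<xi>\<^sup>2 - \<xi> * y = l * z" by blast
  have "(y - \<xi> * z) * d2 + (z + 2 * z * \<xi>\<^sup>2 - \<xi> * y) * d3 = l * (y * d2 + z * d3)"
    unfolding l by (simp add: algebra_simps)
  then show False using H1 C0 zx by simp
qed

text \<open>On the great circle this is \<open>y + 1 / z = (1 + y z) / z\<close>, the function
  \<open_f> of the overview.\<close>

definition fcirc :: "real \<Rightarrow> real \<Rightarrow> real" where
  "fcirc C \<theta> = sqrt C * cos \<theta> + 1 / (sqrt C * sin \<theta>)"

text \<open>The derivative has the sign of \<open>-g\<close> with
  \<open>g = C * sin^3 + cos\<close>. This \<open>g\<close> is positive up to \<open>pi / 2\<close>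
  and strictly decreasing from \<open>C\<close> to -1 afterwards, so it has exactly one zero. In the
  coordinates of the circle the zero reads \<open>y = - z^3\<close>, one of the critical
  conditions.\<close>

lemma fcirc_unimodal:
  assumes C: "C > 0"
  obtains \<theta>\<^sub>0 where "0 < \<theta>\<^sub>0" "\<theta>\<^sub>0 < pi" "C * (sin \<theta>\<^sub>0) ^ 3 + cos \<theta>\<^sub>0 = 0"
    "\<And>s t. 0 < s \<Longrightarrow> s < t \<Longrightarrow> t \<le> \<theta>\<^sub>0 \<Longrightarrow> fcirc C t < fcirc C s"
    "\<And>s t. \<theta>\<^sub>0 \<le> s \<Longrightarrow> s < t \<Longrightarrow> t < pi \<Longrightarrow> fcirc C s < fcirc C t"
proof -
  define g where "g = (\<lambda>\<theta>::real. C * (sin \<theta>) ^ 3 + cos \<theta>)"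
  have gc: "continuous_on A g" for A unfolding g_def by (intro continuous_intros)
  have sin_anti: "sin t \<le> sin s" if "pi / 2 \<le> s" "s \<le> t" "t \<le> pi" for s t
    using sin_monotone_2pi_le[of "pi - t" "pi - s"] that by simp
  have g_dec: "g t < g s" if "pi / 2 \<le> s" "s < t" "t \<le> pi" for s t
  proof -
    have "cos t < cos s" using that by (intro cos_monotone_0_pi) auto
    moreover have "(sin t) ^ 3 \<le> (sin s) ^ 3"
      using that sin_anti[of s t] by (intro power_mono) (auto intro: sin_ge_zero)
    then have "C * (sin t) ^ 3 \<le> C * (sin s) ^ 3" using C by simp
    ultimately show ?thesis by (simp add: g_def)
  qed
  have "g (pi / 2) = C" "g pi = -1" by (simp_all add: g_def)
  then obtain \<theta>\<^sub>0 where \<theta>0: "pi / 2 \<le> \<theta>\<^sub>0" "\<theta>\<^sub>0 \<le> pi" "g \<theta>\<^sub>0 = 0"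
    using IVT2'[of g pi 0 "pi / 2"] gc C by auto
  have ne: "\<theta>\<^sub>0 \<noteq> pi" using \<theta>0(3) \<open>g pi = -1\<close> by auto
  have gpos: "g t > 0" if "0 < t" "t < \<theta>\<^sub>0" for t
  proof (cases "t < pi / 2")
    case True
    then have "cos t > 0" "sin t > 0" using that by (auto intro: cos_gt_zero_pi sin_gt_zero)
    then show ?thesis using C by (simp add: g_def add_pos_pos)
  next
    case False
    then show ?thesis using g_dec[of t \<theta>\<^sub>0] \<theta>0 that by simp
  qed
  have gneg: "g t < 0" if "\<theta>\<^sub>0 < t" "t < pi" for t
    using g_dec[of \<theta>\<^sub>0 t] \<theta>0 that by simp
  have der: "(fcirc C has_real_derivative (- g t / (sqrt C * (sin t)\<^sup>2))) (at t)" if "0 < t" "t < pi" for t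
  proof -
    have s: "sin t \<noteq> 0" using sin_gt_zero[OF that] by simp
    have C2: "sqrt C * sqrt C = C" using C by simp
    have "(fcirc C has_real_derivative (sqrt C * - sin t - sqrt C * cos t / (sqrt C * sin t)\<^sup>2)) (at t)"
      unfolding fcirc_def using s C by (auto intro!: derivative_eq_intros simp: power2_eq_square)
    moreover have "sqrt C * - sin t - sqrt C * cos t / (sqrt C * sin t)\<^sup>2 = - g t / (sqrt C * (sin t)\<^sup>2)"
    proof -
      have "sqrt C * - sin t = - (C * (sin t) ^ 3) / (sqrt C * (sin t)\<^sup>2)"
        using s C C2 by (simp add: field_simps power2_eq_square power3_eq_cube)
      moreover have "sqrt C * cos t / (sqrt C * sin t)\<^sup>2 = cos t / (sqrt C * (sin t)\<^sup>2)"
        using C by (simp add: power_mult_distrib power2_eq_square)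
      ultimately show ?thesis by (simp only: g_def) (simp add: diff_divide_distrib add_divide_distrib)
    qed
    ultimately show ?thesis by simp
  qed
  have fc: "continuous_on {s..t} (fcirc C)" if "0 < s" "t < pi" for s t
    using der that by (intro DERIV_continuous_on[of _ _ "\<lambda>t. - g t / (sqrt C * (sin t)\<^sup>2)"]) (auto intro: has_field_derivative_at_within)
  have s2: "sqrt C * (sin t)\<^sup>2 > 0" if "0 < t" "t < pi" for t
    using C sin_gt_zero[OF that] by simp
  show ?thesis
  proof (rule that[of \<theta>\<^sub>0])
    show "0 < \<theta>\<^sub>0" "\<theta>\<^sub>0 < pi" using \<theta>0 ne by (auto simp: less_le pi_ge_zero intro: order_trans[OF pi_half_ge_zero])
    show "C * (sin \<theta>\<^sub>0) ^ 3 + cos \<theta>\<^sub>0 = 0" using \<theta>0(3) by (simp add: g_def)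
    show "fcirc C t < fcirc C s" if st: "0 < s" "s < t" "t \<le> \<theta>\<^sub>0" for s t
    proof (rule DERIV_neg_imp_decreasing_open[OF st(2)])
      fix x assume x: "s < x" "x < t"
      then have "0 < x" "x < \<theta>\<^sub>0" "x < pi" using st \<theta>0 by auto
      then show "\<exists>d. (fcirc C has_real_derivative d) (at x) \<and> d < 0"
        using der[of x] gpos[of x] s2[of x] by (intro exI[of _ "- g x / (sqrt C * (sin x)\<^sup>2)"]) (auto intro: divide_neg_pos)
    qed (use fc st \<theta>0 ne in auto)
    show "fcirc C s < fcirc C t" if st: "\<theta>\<^sub>0 \<le> s" "s < t" "t < pi" for s t
    proof (rule DERIV_pos_imp_increasing_open[OF st(2)])
      have "0 < \<theta>\<^sub>0" using \<theta>0 pi_gt_zero by linarith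
      then show "continuous_on {s..t} (fcirc C)" using fc st by auto
      fix x assume x: "s < x" "x < t"
      then have "0 < x" "\<theta>\<^sub>0 < x" "x < pi" using st \<open>0 < \<theta>\<^sub>0\<close> by auto
      then show "\<exists>d. (fcirc C has_real_derivative d) (at x) \<and> d > 0"
        using der[of x] gneg[of x] s2[of x] by (intro exI[of _ "- g x / (sqrt C * (sin x)\<^sup>2)"]) (auto intro: divide_neg_pos)
    qed
  qed
qed

lemma continuous_on_fcirc: "C > 0 \<Longrightarrow> A \<subseteq> {0<..<pi} \<Longrightarrow> continuous_on A (fcirc C)"
  unfolding fcirc_def
  by (intro continuous_intros) (use sin_gt_zero in \<open>force+\<close>)

lemma fcirc_large:
  assumes C: "C > 0" and \<delta>: "\<delta> > 0"
  obtains t where "0 < t" "t < \<delta>" "t < pi" "fcirc C t > B" "fcirc C (pi - t) > B"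
proof -
  \<comment> \<open>The cosine term costs at most \<open>sqrt C\<close>, so the reciprocal of the
    sine only has to reach this value. The same works at \<open>pi - t\<close>, where just the
    cosine changes sign.\<close>
  define K where "K = \<bar>B\<bar> + sqrt C + 1"
  have K: "K > 0" using C by (simp add: K_def add_nonneg_pos)
  define t where "t = min (1 / (sqrt C * K)) (min (\<delta> / 2) 1)"
  have t: "0 < t" "t < \<delta>" "t \<le> 1 / (sqrt C * K)" "t < pi"
  proof -
    have "t \<le> 1 / (sqrt C * K)" "t \<le> \<delta> / 2" "t \<le> 1" by (simp_all add: t_def)
    then show "t < \<delta>" "t \<le> 1 / (sqrt C * K)" "t < pi" using \<delta> pi_gt3 by linarith+
    show "0 < t" using C K \<delta> by (simp add: t_def)
  qed
  have s: "0 < sin t" "sin t \<le> t" using sin_gt_zero[OF t(1,4)] sin_x_le_x[of t] t(1) by auto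
  have "sqrt C * sin t * K \<le> sqrt C * (1 / (sqrt C * K)) * K"
    using s t C K by (intro mult_right_mono mult_left_mono) auto
  also have "\<dots> = 1" using C K by simp
  finally have "K \<le> 1 / (sqrt C * sin t)" using s C by (simp add: field_simps)
  moreover have "sqrt C * cos t \<ge> sqrt C * (-1)" "sqrt C * (- cos t) \<ge> sqrt C * (-1)"
    using C by (intro mult_left_mono; simp)+
  ultimately have "fcirc C t > B" "fcirc C (pi - t) > B"
    unfolding fcirc_def by (auto simp: K_def)
  then show ?thesis using that t by blast
qed

lemma fcirc_level:
  assumes C: "C > 0" and \<theta>0: "0 < \<theta>\<^sub>0" "\<theta>\<^sub>0 < pi"
    and dec: "\<And>s t. 0 < s \<Longrightarrow> s < t \<Longrightarrow> t \<le> \<theta>\<^sub>0 \<Longrightarrow> fcirc C t < fcirc C s"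
    and inc: "\<And>s t. \<theta>\<^sub>0 \<le> s \<Longrightarrow> s < t \<Longrightarrow> t < pi \<Longrightarrow> fcirc C s < fcirc C t"
    and B: "B > fcirc C \<theta>\<^sub>0"
  obtains \<theta>\<^sub>1 \<theta>\<^sub>2 where "0 < \<theta>\<^sub>1" "\<theta>\<^sub>1 < \<theta>\<^sub>0" "\<theta>\<^sub>0 < \<theta>\<^sub>2" "\<theta>\<^sub>2 < pi" "fcirc C \<theta>\<^sub>1 = B" "fcirc C \<theta>\<^sub>2 = B"
    "\<And>\<theta>. \<theta>\<^sub>1 < \<theta> \<Longrightarrow> \<theta> < \<theta>\<^sub>2 \<Longrightarrow> fcirc C \<theta> < B"
    "\<And>\<theta>. 0 < \<theta> \<Longrightarrow> \<theta> < \<theta>\<^sub>1 \<Longrightarrow> fcirc C \<theta> > B" "\<And>\<theta>. \<theta>\<^sub>2 < \<theta> \<Longrightarrow> \<theta> < pi \<Longrightarrow> fcirc C \<theta> > B"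
proof -
  obtain t where t: "0 < t" "t < min \<theta>\<^sub>0 (pi - \<theta>\<^sub>0)" "t < pi" "fcirc C t > B" "fcirc C (pi - t) > B"
    using fcirc_large[OF C, of "min \<theta>\<^sub>0 (pi - \<theta>\<^sub>0)" B] \<theta>0 by auto
  have cont: "continuous_on {t..\<theta>\<^sub>0} (fcirc C)" "continuous_on {\<theta>\<^sub>0..pi - t} (fcirc C)"
    using t \<theta>0 by (auto intro!: continuous_on_fcirc C)
  obtain \<theta>\<^sub>1 where 1: "t \<le> \<theta>\<^sub>1" "\<theta>\<^sub>1 \<le> \<theta>\<^sub>0" "fcirc C \<theta>\<^sub>1 = B"
    using IVT2'[of "fcirc C" \<theta>\<^sub>0 B t] B t cont by auto
  obtain \<theta>\<^sub>2 where 2: "\<theta>\<^sub>0 \<le> \<theta>\<^sub>2" "\<theta>\<^sub>2 \<le> pi - t" "fcirc C \<theta>\<^sub>2 = B"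
    using IVT'[of "fcirc C" \<theta>\<^sub>0 B "pi - t"] B t cont by auto
  show ?thesis
  proof (rule that[of \<theta>\<^sub>1 \<theta>\<^sub>2])
    show *: "0 < \<theta>\<^sub>1" "\<theta>\<^sub>1 < \<theta>\<^sub>0" "\<theta>\<^sub>0 < \<theta>\<^sub>2" "\<theta>\<^sub>2 < pi" using 1 2 t B by (auto simp: less_le)
    show "fcirc C \<theta>\<^sub>1 = B" "fcirc C \<theta>\<^sub>2 = B" by fact+
    show "fcirc C \<theta> < B" if "\<theta>\<^sub>1 < \<theta>" "\<theta> < \<theta>\<^sub>2" for \<theta>
      using dec[of \<theta>\<^sub>1 \<theta>] inc[of \<theta> \<theta>\<^sub>2] that 1 2 * by (cases "\<theta> \<le> \<theta>\<^sub>0") auto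
    show "fcirc C \<theta> > B" if "0 < \<theta>" "\<theta> < \<theta>\<^sub>1" for \<theta> using dec[of \<theta> \<theta>\<^sub>1] that 1 by auto
    show "fcirc C \<theta> > B" if "\<theta>\<^sub>2 < \<theta>" "\<theta> < pi" for \<theta> using inc[of \<theta>\<^sub>2 \<theta>] that 2 by auto
  qed
qed

text \<open>Inside the upper half \<open>gcirc\<close> is the positive factor
  \<open>C * (sin \<theta>)^2\<close> times \<open>f^2 - (2 C - 4 h)\<close>.\<close>

lemma gcirc_fcirc:
  assumes C: "C > 0" and \<theta>: "0 < \<theta>" "\<theta> < pi"
  shows "1 + C * cos \<theta> * sin \<theta> = sqrt C * sin \<theta> * fcirc C \<theta>"
    and "gcirc C h \<theta> > 0 \<longleftrightarrow> (fcirc C \<theta>)\<^sup>2 > 2 * C - 4 * h"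
    and "gcirc C h \<theta> = 0 \<longleftrightarrow> (fcirc C \<theta>)\<^sup>2 = 2 * C - 4 * h"
    and "gcirc C h \<theta> < 0 \<longleftrightarrow> (fcirc C \<theta>)\<^sup>2 < 2 * C - 4 * h"
proof -
  have s: "sin \<theta> > 0" using sin_gt_zero[OF \<theta>] .
  have "sqrt C * sin \<theta> * fcirc C \<theta> = sqrt C * sqrt C * cos \<theta> * sin \<theta> + 1"
    using s C by (simp add: fcirc_def distrib_left)
  then show e: "1 + C * cos \<theta> * sin \<theta> = sqrt C * sin \<theta> * fcirc C \<theta>" using C by simp
  have p: "C * (sin \<theta>)\<^sup>2 > 0" using C s by simp
  have "gcirc C h \<theta> = C * (sin \<theta>)\<^sup>2 * ((fcirc C \<theta>)\<^sup>2 - (2 * C - 4 * h))"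
    unfolding gcirc_def e using C by (simp add: power_mult_distrib algebra_simps)
  then show "gcirc C h \<theta> > 0 \<longleftrightarrow> (fcirc C \<theta>)\<^sup>2 > 2 * C - 4 * h"
    "gcirc C h \<theta> = 0 \<longleftrightarrow> (fcirc C \<theta>)\<^sup>2 = 2 * C - 4 * h"
    "gcirc C h \<theta> < 0 \<longleftrightarrow> (fcirc C \<theta>)\<^sup>2 < 2 * C - 4 * h"
    using p by (simp_all only: zero_less_mult_iff mult_less_0_iff mult_eq_0_iff) auto
qed

lemma gcirc_shift: "gcirc C h (\<theta> + pi) = gcirc C h \<theta>" "gcirc C h (\<theta> - pi) = gcirc C h \<theta>"
  by (simp_all add: gcirc_def)

lemma gcirc_0: "gcirc C h 0 = 1"
  by (simp add: gcirc_def)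

text \<open>\<open>gcirc\<close> depends only on \<open>cos * sin\<close> and \<open>sin^2\<close>,
  which agree at antipodal points; flipping the signs of both where the sine is negative moves the
  angle to the upper half.\<close>

lemma gcirc_reduce: "gcirc C h \<theta> = 1 \<or> (\<exists>t. 0 < t \<and> t < pi \<and> gcirc C h \<theta> = gcirc C h t)"
proof (cases "sin \<theta> = 0")
  case True
  then show ?thesis by (simp add: gcirc_def)
next
  case False
  define c where "c = sgn (sin \<theta>) * cos \<theta>"
  define t where "t = arccos c"
  have "(sgn (sin \<theta>))\<^sup>2 = 1" using False by (simp add: sgn_if)
  then have c2: "c\<^sup>2 = 1 - (sin \<theta>)\<^sup>2" by (simp add: c_def power_mult_distrib cos_squared_eq)
  then have "c\<^sup>2 < 1" using False by simp
  then have cb: "-1 < c" "c < 1" by (auto simp: abs_square_less_1 abs_less_iff)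
  have ct: "cos t = c" using cb by (simp add: t_def)
  have t: "0 < t" "t < pi" using arccos_lt_bounded[OF cb] by (simp_all add: t_def)
  have "sin t = sqrt (1 - c\<^sup>2)" using cb by (simp add: t_def sin_arccos)
  then have st: "sin t = \<bar>sin \<theta>\<bar>" by (simp add: c2)
  have "cos t * sin t = cos \<theta> * sin \<theta>" "(sin t)\<^sup>2 = (sin \<theta>)\<^sup>2"
    unfolding ct st c_def by (auto simp: sgn_if abs_if)
  then have "gcirc C h \<theta> = gcirc C h t" by (simp add: gcirc_def mult.assoc)
  then show ?thesis using t by blast
qed

text \<open>The two critical conditions in terms of the angle: a stationary point of
  \<open>f\<close>, or a zero of \<open>f\<close>, where a zero of \<open>gcirc\<close> forces
  \<open>2 C = 4 h\<close>.\<close>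

lemma nonregular_circle:
  assumes C: "C > 0" and \<theta>: "0 < \<theta>" "\<theta> < pi" and g: "gcirc C h \<theta> = 0"
    and crit: "C * (sin \<theta>) ^ 3 + cos \<theta> = 0 \<or> fcirc C \<theta> = 0"
  shows "\<not> regular_level C h"
proof -
  define y z where "y = sqrt C * cos \<theta>" and "z = sqrt C * sin \<theta>"
  have sC: "sqrt C * sqrt C = C" using C by simp
  have "z \<noteq> 0" using sin_gt_zero[OF \<theta>] C by (simp add: z_def)
  moreover have "y\<^sup>2 + z\<^sup>2 = C"
    using C by (simp add: y_def z_def power_mult_distrib flip: distrib_left)
  moreover have yz: "y * z = C * cos \<theta> * sin \<theta>" using sC by (simp add: y_def z_def mult.assoc mult.left_commute)
  moreover have "(1 + y * z)\<^sup>2 = (2 * C - 4 * h) * z\<^sup>2"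
    using g C unfolding yz gcirc_def by (simp add: z_def power_mult_distrib)
  moreover have "y = - (z ^ 3) \<or> 1 + y * z = 0"
    using crit
  proof
    assume "C * (sin \<theta>) ^ 3 + cos \<theta> = 0"
    then have c: "cos \<theta> = - (sqrt C * sqrt C) * (sin \<theta>) ^ 3" using sC by simp
    show ?thesis unfolding y_def z_def c by (simp add: power_mult_distrib power3_eq_cube)
  next
    assume "fcirc C \<theta> = 0"
    then show ?thesis unfolding yz gcirc_fcirc(1)[OF C \<theta>] by simp
  qed
  ultimately show ?thesis by (intro nonregular_level)
qed

section \<open>Counting the arcs of the great circle\<close>

lemma less_Suc_cases4: "i < 4 \<Longrightarrow> i = 0 \<or> i = 1 \<or> i = 2 \<or> i = (3::nat)"
  by linarith

lemma less_Suc_cases8: "i < 8 \<Longrightarrow> i = 0 \<or> i = 1 \<or> i = 2 \<or> i = 3 \<or> i = 4 \<or> i = 5 \<or> i = 6 \<or> i = (7::nat)"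
  by linarith

lemma marked_two_arcs:
  assumes o: "0 < \<theta>\<^sub>1" "\<theta>\<^sub>1 < \<theta>\<^sub>2" "\<theta>\<^sub>2 < pi"
    and z: "gcirc C h \<theta>\<^sub>1 = 0" "gcirc C h \<theta>\<^sub>2 = 0"
    and neg: "\<And>\<theta>. \<theta>\<^sub>1 < \<theta> \<Longrightarrow> \<theta> < \<theta>\<^sub>2 \<Longrightarrow> gcirc C h \<theta> < 0"
    and pos: "\<And>\<theta>. 0 < \<theta> \<Longrightarrow> \<theta> < \<theta>\<^sub>1 \<Longrightarrow> gcirc C h \<theta> > 0" "\<And>\<theta>. \<theta>\<^sub>2 < \<theta> \<Longrightarrow> \<theta> < pi \<Longrightarrow> gcirc C h \<theta> > 0"
  shows "\<exists>\<alpha>. marked C h 2 \<alpha> \<and> (\<forall>i<2 * 2. \<alpha> i < \<alpha> (Suc i))"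
proof -
  \<comment> \<open>The circuit starts at the antipode of the last zero, so that the arc around
    angle 0, where \<open>gcirc\<close> is 1, is not split and arc 0 is positive.\<close>
  define \<alpha> where "\<alpha> i = [\<theta>\<^sub>2 - pi, \<theta>\<^sub>1, \<theta>\<^sub>2, \<theta>\<^sub>1 + pi, \<theta>\<^sub>2 + pi] ! i" for i
  have wrap: "gcirc C h \<theta> > 0" if "\<theta>\<^sub>2 - pi < \<theta>" "\<theta> < \<theta>\<^sub>1" for \<theta>
    using pos(1)[of \<theta>] pos(2)[of "\<theta> + pi"] that gcirc_shift(1)[of C h \<theta>] gcirc_0[of C h]
    by (cases "\<theta> > 0"; cases "\<theta> = 0") auto
  have wrap': "gcirc C h \<theta> > 0" if "\<theta>\<^sub>2 < \<theta>" "\<theta> < \<theta>\<^sub>1 + pi" for \<theta>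
    using wrap[of "\<theta> - pi"] that gcirc_shift(2)[of C h \<theta>] by auto
  have neg': "gcirc C h \<theta> < 0" if "\<theta>\<^sub>1 + pi < \<theta>" "\<theta> < \<theta>\<^sub>2 + pi" for \<theta>
    using neg[of "\<theta> - pi"] that gcirc_shift(2)[of C h \<theta>] by auto
  have strict: "\<alpha> i < \<alpha> (Suc i)" if "i < 4" for i
    using less_Suc_cases4[OF that] o by (auto simp: \<alpha>_def)
  have zero: "gcirc C h (\<alpha> i) = 0" if "i \<le> 4" for i
  proof (cases "i = 4")
    case False
    then have "i < 4" using that by simp
    from less_Suc_cases4[OF this] show ?thesis using z by (auto simp: \<alpha>_def gcirc_shift)
  qed (use z in \<open>simp add: \<alpha>_def gcirc_shift\<close>)
  have sgn: "(even i \<longrightarrow> gcirc C h \<theta> > 0) \<and> (odd i \<longrightarrow> gcirc C h \<theta> < 0)" if "i < 4" "\<alpha> i < \<theta>" "\<theta> < \<alpha> (Suc i)" for i \<theta>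
    using less_Suc_cases4[OF that(1)] that(2,3) wrap[of \<theta>] wrap'[of \<theta>] neg[of \<theta>] neg'[of \<theta>]
    by (elim disjE) (simp_all add: \<alpha>_def)
  have "marked C h 2 \<alpha>"
    unfolding marked_def using strict zero sgn by (auto simp: less_imp_le) (simp add: \<alpha>_def)
  then show ?thesis using strict by (intro exI[of _ \<alpha>]) simp
qed

text \<open>The two middle zeros may coincide; this is the pinched level, in which the positive arc
  between two disks has shrunk to a point.\<close>

lemma marked_four_arcs:
  assumes o: "0 < \<theta>\<^sub>1" "\<theta>\<^sub>1 < \<theta>\<^sub>2" "\<theta>\<^sub>2 \<le> \<theta>\<^sub>3" "\<theta>\<^sub>3 < \<theta>\<^sub>4" "\<theta>\<^sub>4 < pi"
    and z: "gcirc C h \<theta>\<^sub>1 = 0" "gcirc C h \<theta>\<^sub>2 = 0" "gcirc C h \<theta>\<^sub>3 = 0" "gcirc C h \<theta>\<^sub>4 = 0"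
    and neg: "\<And>\<theta>. \<theta>\<^sub>1 < \<theta> \<Longrightarrow> \<theta> < \<theta>\<^sub>2 \<Longrightarrow> gcirc C h \<theta> < 0" "\<And>\<theta>. \<theta>\<^sub>3 < \<theta> \<Longrightarrow> \<theta> < \<theta>\<^sub>4 \<Longrightarrow> gcirc C h \<theta> < 0"
    and pos: "\<And>\<theta>. 0 < \<theta> \<Longrightarrow> \<theta> < \<theta>\<^sub>1 \<Longrightarrow> gcirc C h \<theta> > 0" "\<And>\<theta>. \<theta>\<^sub>2 < \<theta> \<Longrightarrow> \<theta> < \<theta>\<^sub>3 \<Longrightarrow> gcirc C h \<theta> > 0"
      "\<And>\<theta>. \<theta>\<^sub>4 < \<theta> \<Longrightarrow> \<theta> < pi \<Longrightarrow> gcirc C h \<theta> > 0"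
  shows "\<exists>\<alpha>. marked C h 4 \<alpha> \<and> \<alpha> 0 < \<alpha> 1 \<and> \<alpha> 2 = \<theta>\<^sub>2 \<and> \<alpha> 3 = \<theta>\<^sub>3 \<and> (\<theta>\<^sub>2 < \<theta>\<^sub>3 \<longrightarrow> (\<forall>i<2 * 4. \<alpha> i < \<alpha> (Suc i)))"
proof -
  define \<alpha> where "\<alpha> i = [\<theta>\<^sub>4 - pi, \<theta>\<^sub>1, \<theta>\<^sub>2, \<theta>\<^sub>3, \<theta>\<^sub>4, \<theta>\<^sub>1 + pi, \<theta>\<^sub>2 + pi, \<theta>\<^sub>3 + pi, \<theta>\<^sub>4 + pi] ! i" for i
  have wrap: "gcirc C h \<theta> > 0" if "\<theta>\<^sub>4 - pi < \<theta>" "\<theta> < \<theta>\<^sub>1" for \<theta>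
    using pos(1)[of \<theta>] pos(3)[of "\<theta> + pi"] that gcirc_shift(1)[of C h \<theta>] gcirc_0[of C h]
    by (cases "\<theta> > 0"; cases "\<theta> = 0") auto
  have wrap': "gcirc C h \<theta> > 0" if "\<theta>\<^sub>4 < \<theta>" "\<theta> < \<theta>\<^sub>1 + pi" for \<theta>
    using wrap[of "\<theta> - pi"] that gcirc_shift(2)[of C h \<theta>] by auto
  have pos': "gcirc C h \<theta> > 0" if "\<theta>\<^sub>2 + pi < \<theta>" "\<theta> < \<theta>\<^sub>3 + pi" for \<theta>
    using pos(2)[of "\<theta> - pi"] that gcirc_shift(2)[of C h \<theta>] by auto
  have neg': "gcirc C h \<theta> < 0" if "\<theta>\<^sub>1 + pi < \<theta> \<and> \<theta> < \<theta>\<^sub>2 + pi \<or> \<theta>\<^sub>3 + pi < \<theta> \<and> \<theta> < \<theta>\<^sub>4 + pi" for \<theta>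
    using neg(1)[of "\<theta> - pi"] neg(2)[of "\<theta> - pi"] that gcirc_shift(2)[of C h \<theta>] by auto
  have le: "\<alpha> i \<le> \<alpha> (Suc i) \<and> (odd i \<longrightarrow> \<alpha> i < \<alpha> (Suc i)) \<and> (\<theta>\<^sub>2 < \<theta>\<^sub>3 \<longrightarrow> \<alpha> i < \<alpha> (Suc i))" if "i < 8" for i
    using less_Suc_cases8[OF that] o by (elim disjE) (simp_all add: \<alpha>_def)
  have zero: "gcirc C h (\<alpha> i) = 0" if "i \<le> 8" for i
  proof (cases "i = 8")
    case False
    then have "i < 8" using that by simp
    from less_Suc_cases8[OF this] show ?thesis using z by (elim disjE) (simp_all add: \<alpha>_def gcirc_shift)
  qed (use z in \<open>simp add: \<alpha>_def gcirc_shift\<close>)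
  have sgn: "(even i \<longrightarrow> gcirc C h \<theta> > 0) \<and> (odd i \<longrightarrow> gcirc C h \<theta> < 0)" if "i < 8" "\<alpha> i < \<theta>" "\<theta> < \<alpha> (Suc i)" for i \<theta>
    using less_Suc_cases8[OF that(1)] that(2,3) wrap[of \<theta>] wrap'[of \<theta>] neg[of \<theta>] neg'[of \<theta>] pos(2)[of \<theta>] pos'[of \<theta>]
    by (elim disjE) (simp_all add: \<alpha>_def)
  have "marked C h 4 \<alpha>"
    unfolding marked_def using le zero sgn by (auto simp: less_imp_le) (simp add: \<alpha>_def)
  moreover have "\<alpha> 0 < \<alpha> 1" "\<alpha> 2 = \<theta>\<^sub>2" "\<alpha> 3 = \<theta>\<^sub>3" using o by (simp_all add: \<alpha>_def)
  ultimately show ?thesis using le by (intro exI[of _ \<alpha>]) simp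
qed

text \<open>On the upper half \<open>f\<close> decreases from infinity to its minimum \<mu> and
  increases to infinity again; the lower half repeats this. For \<open>b > 0\<close> and \<beta> its
  square root, the set \<open>|f| < \<beta>\<close> is empty if \<open>\<mu> \<ge> \<beta>\<close>,
  one arc if \<mu> lies strictly between -\<beta> and \<beta>, and two arcs if
  \<open>\<mu> \<le> - \<beta>\<close>. The equalities are critical levels.\<close>

lemma circle_cases:
  assumes C: "C > 0"
  obtains (positive) "\<And>\<theta>. gcirc C h \<theta> > 0"
    | (touching) "\<And>\<theta>. gcirc C h \<theta> \<ge> 0" "\<not> regular_level C h"
    | (two) \<alpha> where "marked C h 2 \<alpha>" "\<And>i. i < 2 * 2 \<Longrightarrow> \<alpha> i < \<alpha> (Suc i)"
    | (pinched) \<alpha> where "marked C h 4 \<alpha>" "\<alpha> 0 < \<alpha> 1" "\<alpha> 2 = \<alpha> 3" "\<not> regular_level C h"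
    | (four) \<alpha> where "marked C h 4 \<alpha>" "\<And>i. i < 2 * 4 \<Longrightarrow> \<alpha> i < \<alpha> (Suc i)"
proof -
  obtain \<theta>\<^sub>0 where \<theta>0: "0 < \<theta>\<^sub>0" "\<theta>\<^sub>0 < pi" "C * (sin \<theta>\<^sub>0) ^ 3 + cos \<theta>\<^sub>0 = 0"
    and dec: "\<And>s t. 0 < s \<Longrightarrow> s < t \<Longrightarrow> t \<le> \<theta>\<^sub>0 \<Longrightarrow> fcirc C t < fcirc C s"
    and inc: "\<And>s t. \<theta>\<^sub>0 \<le> s \<Longrightarrow> s < t \<Longrightarrow> t < pi \<Longrightarrow> fcirc C s < fcirc C t"
    using fcirc_unimodal[OF C] by blast
  define f where "f = fcirc C"
  define \<mu> where "\<mu> = f \<theta>\<^sub>0"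
  define b where "b = 2 * C - 4 * h"
  define \<beta> where "\<beta> = sqrt b"
  have min: "f \<theta> \<ge> \<mu>" if "0 < \<theta>" "\<theta> < pi" for \<theta>
    using dec[of \<theta> \<theta>\<^sub>0] inc[of \<theta>\<^sub>0 \<theta>] that by (cases "\<theta> < \<theta>\<^sub>0"; cases "\<theta> = \<theta>\<^sub>0") (auto simp: f_def \<mu>_def)
  have min': "f \<theta> > \<mu>" if "0 < \<theta>" "\<theta> < pi" "\<theta> \<noteq> \<theta>\<^sub>0" for \<theta>
    using dec[of \<theta> \<theta>\<^sub>0] inc[of \<theta>\<^sub>0 \<theta>] that by (cases "\<theta> < \<theta>\<^sub>0") (auto simp: f_def \<mu>_def)
  note g = gcirc_fcirc(2-4)[OF C, of _ h, folded b_def f_def]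
  have all_pos: thesis if "\<And>\<theta>. 0 < \<theta> \<Longrightarrow> \<theta> < pi \<Longrightarrow> (f \<theta>)\<^sup>2 > b"
  proof (rule positive)
    show "gcirc C h \<theta> > 0" for \<theta> using gcirc_reduce[of C h \<theta>] g(1) that by auto
  qed
  have all_nn: thesis if "\<And>\<theta>. 0 < \<theta> \<Longrightarrow> \<theta> < pi \<Longrightarrow> (f \<theta>)\<^sup>2 \<ge> b" "\<not> regular_level C h"
  proof (rule touching[OF _ that(2)])
    show "gcirc C h \<theta> \<ge> 0" for \<theta> using gcirc_reduce[of C h \<theta>] g(3) that(1) by force
  qed
  have level: "\<exists>\<theta>\<^sub>1 \<theta>\<^sub>2. 0 < \<theta>\<^sub>1 \<and> \<theta>\<^sub>1 < \<theta>\<^sub>0 \<and> \<theta>\<^sub>0 < \<theta>\<^sub>2 \<and> \<theta>\<^sub>2 < pi \<and> f \<theta>\<^sub>1 = B \<and> f \<theta>\<^sub>2 = B \<and>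
      (\<forall>\<theta>. \<theta>\<^sub>1 < \<theta> \<longrightarrow> \<theta> < \<theta>\<^sub>2 \<longrightarrow> f \<theta> < B) \<and> (\<forall>\<theta>. 0 < \<theta> \<longrightarrow> \<theta> < \<theta>\<^sub>1 \<longrightarrow> f \<theta> > B) \<and>
      (\<forall>\<theta>. \<theta>\<^sub>2 < \<theta> \<longrightarrow> \<theta> < pi \<longrightarrow> f \<theta> > B)" if B: "f \<theta>\<^sub>0 < B" for B
  proof (rule fcirc_level[OF C \<theta>0(1,2)])
    show "fcirc C t < fcirc C s" if "0 < s" "s < t" "t \<le> \<theta>\<^sub>0" for s t by (rule dec[OF that])
    show "fcirc C s < fcirc C t" if "\<theta>\<^sub>0 \<le> s" "s < t" "t < pi" for s t by (rule inc[OF that])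
    show "fcirc C \<theta>\<^sub>0 < B" using B by (simp add: f_def)
  qed (unfold f_def, blast)
  show thesis
  proof (cases "b \<le> 0")
    case b: True
    show ?thesis
    proof (cases "b < 0 \<or> \<mu> > 0")
      case True
      show ?thesis
      proof (rule all_pos)
        fix \<theta> assume "0 < \<theta>" "\<theta> < pi"
        then have "b < 0 \<or> f \<theta> > 0" using True min by fastforce
        then show "(f \<theta>)\<^sup>2 > b" using b by (smt (verit) zero_le_power2 zero_less_power)
      qed
    next
      case False
      then have b0: "b = 0" and "\<mu> \<le> 0" using b by auto
      \<comment> \<open>Since \<open>f\<close> is unbounded above, a nonpositive minimum forces a
        zero; at \<open>b = 0\<close> such a zero is critical.\<close>
      have "\<exists>\<theta>. 0 < \<theta> \<and> \<theta> < pi \<and> f \<theta> = 0"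
      proof (cases "\<mu> = 0")
        case True
        then show ?thesis using \<theta>0 by (auto simp: \<mu>_def)
      next
        case False
        then have "f \<theta>\<^sub>0 < 0" using \<open>\<mu> \<le> 0\<close> by (simp add: \<mu>_def)
        from level[OF this] obtain \<theta>\<^sub>1 where "0 < \<theta>\<^sub>1" "\<theta>\<^sub>1 < \<theta>\<^sub>0" "f \<theta>\<^sub>1 = 0" by blast
        then show ?thesis using \<theta>0(2) by (intro exI[of _ \<theta>\<^sub>1]) simp
      qed
      then obtain \<theta> where \<theta>: "0 < \<theta>" "\<theta> < pi" "f \<theta> = 0" by blast
      then have "\<not> regular_level C h"
        using nonregular_circle[OF C \<theta>(1,2)] g(2)[OF \<theta>(1,2)] b0 by (simp add: f_def)
      then show ?thesis using all_nn b0 by simp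
    qed
  next
    case False
    then have b: "b > 0" "\<beta> > 0" "\<beta>\<^sup>2 = b" by (simp_all add: \<beta>_def)
    have sq: "f \<theta> > \<beta> \<Longrightarrow> (f \<theta>)\<^sup>2 > b" "f \<theta> < - \<beta> \<Longrightarrow> (f \<theta>)\<^sup>2 > b" "\<lbrakk>- \<beta> < f \<theta>; f \<theta> < \<beta>\<rbrakk> \<Longrightarrow> (f \<theta>)\<^sup>2 < b"
      "f \<theta> = \<beta> \<Longrightarrow> (f \<theta>)\<^sup>2 = b" "f \<theta> = - \<beta> \<Longrightarrow> (f \<theta>)\<^sup>2 = b" for \<theta>
      using b abs_le_square_iff[of "f \<theta>" \<beta>] abs_le_square_iff[of \<beta> "f \<theta>"] by auto
    have nonreg0: "\<not> regular_level C h" if "(f \<theta>\<^sub>0)\<^sup>2 = b"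
      using nonregular_circle[OF C \<theta>0(1,2)] g(2)[OF \<theta>0(1,2)] \<theta>0(3) that by blast
    consider "\<mu> > \<beta>" | "\<mu> = \<beta>" | "\<mu> < \<beta>" "\<mu> > - \<beta>" | "\<mu> = - \<beta>" | "\<mu> < - \<beta>" by linarith
    then show ?thesis
    proof cases
      case 1
      then show ?thesis using all_pos sq(1) min by fastforce
    next
      case 2
      have "(f \<theta>)\<^sup>2 \<ge> b" if "0 < \<theta>" "\<theta> < pi" for \<theta>
        using min[OF that] 2 sq(1)[of \<theta>] sq(4)[of \<theta>] by fastforce
      then show ?thesis using all_nn nonreg0 sq(4)[of \<theta>\<^sub>0] 2 by (simp add: \<mu>_def)
    next
      case 3
      then have "f \<theta>\<^sub>0 < \<beta>" by (simp add: \<mu>_def)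
      from level[OF this] obtain \<theta>\<^sub>1 \<theta>\<^sub>2 where t: "0 < \<theta>\<^sub>1" "\<theta>\<^sub>1 < \<theta>\<^sub>0" "\<theta>\<^sub>0 < \<theta>\<^sub>2" "\<theta>\<^sub>2 < pi" "f \<theta>\<^sub>1 = \<beta>" "f \<theta>\<^sub>2 = \<beta>"
        "\<And>\<theta>. \<theta>\<^sub>1 < \<theta> \<Longrightarrow> \<theta> < \<theta>\<^sub>2 \<Longrightarrow> f \<theta> < \<beta>"
        "\<And>\<theta>. 0 < \<theta> \<Longrightarrow> \<theta> < \<theta>\<^sub>1 \<Longrightarrow> f \<theta> > \<beta>" "\<And>\<theta>. \<theta>\<^sub>2 < \<theta> \<Longrightarrow> \<theta> < pi \<Longrightarrow> f \<theta> > \<beta>" by blast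
      have "\<exists>\<alpha>. marked C h 2 \<alpha> \<and> (\<forall>i<2 * 2. \<alpha> i < \<alpha> (Suc i))"
      proof (rule marked_two_arcs[OF t(1) _ t(4)])
        show "\<theta>\<^sub>1 < \<theta>\<^sub>2" using t by simp
        show "gcirc C h \<theta>\<^sub>1 = 0" "gcirc C h \<theta>\<^sub>2 = 0" using g(2)[of \<theta>\<^sub>1] g(2)[of \<theta>\<^sub>2] t sq(4) by auto
        show "gcirc C h \<theta> < 0" if "\<theta>\<^sub>1 < \<theta>" "\<theta> < \<theta>\<^sub>2" for \<theta>
          using g(3)[of \<theta>] sq(3)[of \<theta>] t(7)[OF that] min[of \<theta>] 3 t(1,4) that by auto
        show "gcirc C h \<theta> > 0" if "0 < \<theta>" "\<theta> < \<theta>\<^sub>1" for \<theta> using g(1)[of \<theta>] sq(1) t that by auto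
        show "gcirc C h \<theta> > 0" if "\<theta>\<^sub>2 < \<theta>" "\<theta> < pi" for \<theta> using g(1)[of \<theta>] sq(1) t that by auto
      qed
      then show ?thesis using two by blast
    next
      case 4
      then have "f \<theta>\<^sub>0 < \<beta>" using b by (simp add: \<mu>_def)
      from level[OF this] obtain \<theta>\<^sub>1 \<theta>\<^sub>4 where t: "0 < \<theta>\<^sub>1" "\<theta>\<^sub>1 < \<theta>\<^sub>0" "\<theta>\<^sub>0 < \<theta>\<^sub>4" "\<theta>\<^sub>4 < pi" "f \<theta>\<^sub>1 = \<beta>" "f \<theta>\<^sub>4 = \<beta>"
        "\<And>\<theta>. \<theta>\<^sub>1 < \<theta> \<Longrightarrow> \<theta> < \<theta>\<^sub>4 \<Longrightarrow> f \<theta> < \<beta>"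
        "\<And>\<theta>. 0 < \<theta> \<Longrightarrow> \<theta> < \<theta>\<^sub>1 \<Longrightarrow> f \<theta> > \<beta>" "\<And>\<theta>. \<theta>\<^sub>4 < \<theta> \<Longrightarrow> \<theta> < pi \<Longrightarrow> f \<theta> > \<beta>" by blast
      have f0: "(f \<theta>\<^sub>0)\<^sup>2 = b" using sq(5) 4 by (simp add: \<mu>_def)
      have "\<exists>\<alpha>. marked C h 4 \<alpha> \<and> \<alpha> 0 < \<alpha> 1 \<and> \<alpha> 2 = \<theta>\<^sub>0 \<and> \<alpha> 3 = \<theta>\<^sub>0 \<and> (\<theta>\<^sub>0 < \<theta>\<^sub>0 \<longrightarrow> (\<forall>i<2 * 4. \<alpha> i < \<alpha> (Suc i)))"
      proof (rule marked_four_arcs[OF t(1,2) order_refl t(3,4)])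
        show "gcirc C h \<theta>\<^sub>1 = 0" "gcirc C h \<theta>\<^sub>4 = 0" using g(2)[of \<theta>\<^sub>1] g(2)[of \<theta>\<^sub>4] t \<theta>0(1,2) sq(4) by auto
        show "gcirc C h \<theta>\<^sub>0 = 0" "gcirc C h \<theta>\<^sub>0 = 0" using g(2)[OF \<theta>0(1,2)] f0 by auto
        show "gcirc C h \<theta> < 0" if "\<theta>\<^sub>1 < \<theta>" "\<theta> < \<theta>\<^sub>0" for \<theta>
          using g(3)[of \<theta>] sq(3)[of \<theta>] t(7)[of \<theta>] min'[of \<theta>] 4 t(1,3,4) that by auto
        show "gcirc C h \<theta> < 0" if "\<theta>\<^sub>0 < \<theta>" "\<theta> < \<theta>\<^sub>4" for \<theta>
          using g(3)[of \<theta>] sq(3)[of \<theta>] t(7)[of \<theta>] min'[of \<theta>] 4 t(1,2,4) that by auto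
        show "gcirc C h \<theta> > 0" if "0 < \<theta>" "\<theta> < \<theta>\<^sub>1" for \<theta> using g(1)[of \<theta>] sq(1) t \<theta>0(2) that by auto
        show "gcirc C h \<theta> > 0" if "\<theta>\<^sub>4 < \<theta>" "\<theta> < pi" for \<theta> using g(1)[of \<theta>] sq(1) t \<theta>0(1) that by auto
      qed auto
      then show ?thesis using pinched nonreg0[OF f0] by metis
    next
      case 5
      then have "f \<theta>\<^sub>0 < \<beta>" using b by (simp add: \<mu>_def)
      from level[OF this] obtain \<theta>\<^sub>1 \<theta>\<^sub>4 where t: "0 < \<theta>\<^sub>1" "\<theta>\<^sub>1 < \<theta>\<^sub>0" "\<theta>\<^sub>0 < \<theta>\<^sub>4" "\<theta>\<^sub>4 < pi" "f \<theta>\<^sub>1 = \<beta>" "f \<theta>\<^sub>4 = \<beta>"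
        "\<And>\<theta>. \<theta>\<^sub>1 < \<theta> \<Longrightarrow> \<theta> < \<theta>\<^sub>4 \<Longrightarrow> f \<theta> < \<beta>"
        "\<And>\<theta>. 0 < \<theta> \<Longrightarrow> \<theta> < \<theta>\<^sub>1 \<Longrightarrow> f \<theta> > \<beta>" "\<And>\<theta>. \<theta>\<^sub>4 < \<theta> \<Longrightarrow> \<theta> < pi \<Longrightarrow> f \<theta> > \<beta>" by blast
      have "f \<theta>\<^sub>0 < - \<beta>" using 5 by (simp add: \<mu>_def)
      from level[OF this] obtain \<theta>\<^sub>2 \<theta>\<^sub>3 where u: "0 < \<theta>\<^sub>2" "\<theta>\<^sub>2 < \<theta>\<^sub>0" "\<theta>\<^sub>0 < \<theta>\<^sub>3" "\<theta>\<^sub>3 < pi" "f \<theta>\<^sub>2 = - \<beta>" "f \<theta>\<^sub>3 = - \<beta>"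
        "\<And>\<theta>. \<theta>\<^sub>2 < \<theta> \<Longrightarrow> \<theta> < \<theta>\<^sub>3 \<Longrightarrow> f \<theta> < - \<beta>"
        "\<And>\<theta>. 0 < \<theta> \<Longrightarrow> \<theta> < \<theta>\<^sub>2 \<Longrightarrow> f \<theta> > - \<beta>" "\<And>\<theta>. \<theta>\<^sub>3 < \<theta> \<Longrightarrow> \<theta> < pi \<Longrightarrow> f \<theta> > - \<beta>" by blast
      have o: "\<theta>\<^sub>1 < \<theta>\<^sub>2"
      proof (rule ccontr)
        assume "\<not> \<theta>\<^sub>1 < \<theta>\<^sub>2"
        then show False using t(5) u(5) b(2) t(8)[OF u(1)] by (cases "\<theta>\<^sub>1 = \<theta>\<^sub>2") auto
      qed
      have o': "\<theta>\<^sub>3 < \<theta>\<^sub>4"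
      proof (rule ccontr)
        assume "\<not> \<theta>\<^sub>3 < \<theta>\<^sub>4"
        then show False using t(6) u(6) b(2) t(9)[OF _ u(4)] by (cases "\<theta>\<^sub>3 = \<theta>\<^sub>4") auto
      qed
      have m: "\<theta>\<^sub>2 < \<theta>\<^sub>3" using u by simp
      have "\<exists>\<alpha>. marked C h 4 \<alpha> \<and> \<alpha> 0 < \<alpha> 1 \<and> \<alpha> 2 = \<theta>\<^sub>2 \<and> \<alpha> 3 = \<theta>\<^sub>3 \<and> (\<theta>\<^sub>2 < \<theta>\<^sub>3 \<longrightarrow> (\<forall>i<2 * 4. \<alpha> i < \<alpha> (Suc i)))"
      proof (rule marked_four_arcs[OF t(1) o less_imp_le[OF m] o' t(4)])
        show "gcirc C h \<theta>\<^sub>1 = 0" "gcirc C h \<theta>\<^sub>4 = 0" using g(2)[of \<theta>\<^sub>1] g(2)[of \<theta>\<^sub>4] t \<theta>0(1,2) sq(4) by auto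
        show "gcirc C h \<theta>\<^sub>2 = 0" "gcirc C h \<theta>\<^sub>3 = 0" using g(2)[of \<theta>\<^sub>2] g(2)[of \<theta>\<^sub>3] u \<theta>0(1,2) sq(5) by auto
        show "gcirc C h \<theta> < 0" if "\<theta>\<^sub>1 < \<theta>" "\<theta> < \<theta>\<^sub>2" for \<theta>
          using g(3)[of \<theta>] sq(3)[of \<theta>] t(7)[of \<theta>] u(8)[of \<theta>] t(1,4) m o' that by auto
        show "gcirc C h \<theta> < 0" if "\<theta>\<^sub>3 < \<theta>" "\<theta> < \<theta>\<^sub>4" for \<theta>
          using g(3)[of \<theta>] sq(3)[of \<theta>] t(7)[of \<theta>] u(9)[of \<theta>] t(1,4) m o that by auto
        show "gcirc C h \<theta> > 0" if "0 < \<theta>" "\<theta> < \<theta>\<^sub>1" for \<theta> using g(1)[of \<theta>] sq(1) t \<theta>0(2) that by auto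
        show "gcirc C h \<theta> > 0" if "\<theta>\<^sub>2 < \<theta>" "\<theta> < \<theta>\<^sub>3" for \<theta> using g(1)[of \<theta>] sq(2) u that by auto
        show "gcirc C h \<theta> > 0" if "\<theta>\<^sub>4 < \<theta>" "\<theta> < pi" for \<theta> using g(1)[of \<theta>] sq(1) t \<theta>0(1) that by auto
      qed
      then show ?thesis using four m by blast
    qed
  qed
qed

text \<open>Along a meridian \<open>nu\<close> is largest on the great circle, because the squared
  projection \<open>C - (m$1)^2\<close> is at most \<open>C\<close>. So the sign there controls the
  whole sphere.\<close>

lemma discr_full:
  assumes C: "C > 0" and cas: "casimir m = C"
  shows "(\<And>\<theta>. gcirc C h \<theta> \<ge> 0) \<Longrightarrow> discr C h m \<ge> 0" "(\<And>\<theta>. gcirc C h \<theta> > 0) \<Longrightarrow> discr C h m > 0"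
proof -
  obtain \<theta> where \<theta>: "has_angle m \<theta>"
    unfolding has_angle_def by (rule polar_coordinates[of 0 "m$2" "m$3"]) blast
  define n where "n = nu (4 * h - C) (cos \<theta>) (sin \<theta>)"
  have n: "nu (4 * h - C) (m$2) (m$3) = (C - (m$1)\<^sup>2) * n" using discr_has_angle(1)[OF C cas \<theta>] by (simp add: n_def)
  have le: "(C - (m$1)\<^sup>2) * n \<le> C * n" using nu_nonneg by (intro mult_right_mono) (auto simp: n_def)
  show "discr C h m \<ge> 0" if "\<And>\<theta>. gcirc C h \<theta> \<ge> 0"
  proof -
    have "n \<le> 1 / C" using gcirc_nu(3)[OF C, of h \<theta>] that[of \<theta>] unfolding n_def by linarith
    then have "C * n \<le> 1" using C by (simp add: field_simps)
    then show ?thesis unfolding discr_nu(3)[OF cas] n using le by linarith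
  qed
  show "discr C h m > 0" if "\<And>\<theta>. gcirc C h \<theta> > 0"
  proof -
    have "n < 1 / C" using gcirc_nu(1)[OF C, of h \<theta>] that[of \<theta>] unfolding n_def by linarith
    then have "C * n < 1" using C by (simp add: field_simps)
    then show ?thesis unfolding discr_nu(1)[OF cas] n using le by linarith
  qed
qed

text \<open>Without zeros on the great circle there are no alternating arcs and hence no pattern.
  Instead no circle collapses, and rescaling every fibre to radius 1 trivialises the bundle over the
  sphere.\<close>

lemma positive_homeomorphic:
  assumes C: "C > 0" and pos: "\<And>m. casimir m = C \<Longrightarrow> discr C h m > 0"
  shows "S1xS2 homeomorphic_space top_of_set {(v :: real^2, m :: real^3). casimir m = C \<and> (norm v)\<^sup>2 = discr C h m}"
proof -
  define K where "K = (sphere 0 1 :: (real^2) set) \<times> (sphere 0 1 :: (real^3) set)"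
  define q where "q = (\<lambda>(e :: real^2, n :: real^3). (sqrt (discr C h (sqrt C *\<^sub>R n)) *\<^sub>R e, sqrt C *\<^sub>R n))"
  have cas: "casimir m = (norm m)\<^sup>2" for m by (simp add: casimir_def norm_square_vec3)
  have casn: "casimir (sqrt C *\<^sub>R n) = C" if "norm n = 1" for n :: "real^3"
    using that C by (simp add: cas power_mult_distrib)
  have "compact K" unfolding K_def by (intro compact_Times) auto
  moreover have "continuous_on K q"
    unfolding q_def case_prod_beta
    by (intro continuous_intros continuous_on_compose2[OF continuous_on_discr[of UNIV]]) auto
  moreover have "id a = id b \<longleftrightarrow> q a = q b" if "a \<in> K" "b \<in> K" for a b
  proof
    assume "q a = q b"
    moreover obtain e n e' n' where ab: "a = (e, n)" "b = (e', n')" by (cases a; cases b)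
    ultimately have n: "n = n'" using C by (simp add: q_def)
    have "discr C h (sqrt C *\<^sub>R n) > 0" using casn pos that by (auto simp: ab K_def)
    then show "id a = id b" using \<open>q a = q b\<close> n by (simp add: ab q_def)
  qed simp
  ultimately have "top_of_set (id ` K) homeomorphic_space top_of_set (q ` K)"
    by (intro homeomorphic_space_same_fibres continuous_on_id') (auto simp: id_def)
  moreover have "q ` K = {(v, m). casimir m = C \<and> (norm v)\<^sup>2 = discr C h m}"
  proof (intro equalityI subsetI)
    fix w assume "w \<in> q ` K"
    then obtain e n where "norm e = 1" "norm n = 1" "w = q (e, n)" by (auto simp: K_def)
    then show "w \<in> {(v, m). casimir m = C \<and> (norm v)\<^sup>2 = discr C h m}"
      using casn[of n] pos[OF casn[of n]] by (simp add: q_def power_mult_distrib less_imp_le)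
  next
    fix w :: "(real^2) \<times> (real^3)" assume "w \<in> {(v, m). casimir m = C \<and> (norm v)\<^sup>2 = discr C h m}"
    then obtain v m where w: "w = (v, m)" "casimir m = C" "(norm v)\<^sup>2 = discr C h m" by auto
    define n where "n = (1 / sqrt C) *\<^sub>R m"
    have m: "m = sqrt C *\<^sub>R n" using C by (simp add: n_def)
    have "norm m = sqrt C" using w(2) by (metis cas norm_ge_zero real_sqrt_unique)
    then have "norm n = 1" using C by (simp add: n_def)
    moreover have v: "norm v = sqrt (discr C h m)" using w(3) by (metis norm_ge_zero real_sqrt_unique)
    moreover have "norm v > 0" unfolding v using pos[OF w(2)] by simp
    ultimately show "w \<in> q ` K"
      unfolding K_def by (intro image_eqI[of _ _ "(v /\<^sub>R norm v, n)"]) (auto simp: q_def w(1) m[symmetric] v)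
  qed
  ultimately show ?thesis by (simp add: S1xS2_def K_def)
qed

theorem theorem3p6:
  fixes C h :: real
  assumes "C > 0"
  shows
    "(regular_level C h \<longrightarrow>
        snd ` compactified_level C h = casimir_sphere C
        \<or> minus_open_disks 2 (casimir_sphere C) (snd ` compactified_level C h)
        \<or> minus_open_disks 4 (casimir_sphere C) (snd ` compactified_level C h))
     \<and> (regular_level C h \<and> snd ` compactified_level C h = casimir_sphere C
          \<or> minus_open_disks 2 (casimir_sphere C) (snd ` compactified_level C h)
        \<longrightarrow> top_of_set (compactified_level C h) homeomorphic_space S1xS2)
     \<and> (minus_open_disks 4 (casimir_sphere C) (snd ` compactified_level C h)
        \<longrightarrow> (\<exists>M :: (((real^2) \<times> (real^3)) + ((real^2) \<times> (real^3))) set topology.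
              is_connected_sum S1xS2 S1xS2 M
              \<and> is_connected_sum M S1xS2 (top_of_set (compactified_level C h))))"
proof -
  define S where "S = compactified_level C h"
  define A where "A = snd ` S"
  define W where "W = {(v :: real^2, m :: real^3). casimir m = C \<and> (norm v)\<^sup>2 = discr C h m}"
  have SW: "top_of_set S homeomorphic_space top_of_set W"
    and A: "A = {m. casimir m = C \<and> discr C h m \<ge> 0}"
    using compactified_level_homeomorphic[OF assms, of h] by (simp_all add: S_def A_def W_def)
  \<comment> \<open>The number of components of the complement decides in each case which of the
    hypotheses on the image can hold at all.\<close>
  have no_disks: "card (components (casimir_sphere C - A)) = 0" if "A = casimir_sphere C" by (simp add: that)
  have "(regular_level C h \<longrightarrow> A = casimir_sphere C
        \<or> minus_open_disks 2 (casimir_sphere C) A \<or> minus_open_disks 4 (casimir_sphere C) A)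
     \<and> (regular_level C h \<and> A = casimir_sphere C \<or> minus_open_disks 2 (casimir_sphere C) A
        \<longrightarrow> top_of_set S homeomorphic_space S1xS2)
     \<and> (minus_open_disks 4 (casimir_sphere C) A
        \<longrightarrow> (\<exists>M :: (((real^2) \<times> (real^3)) + ((real^2) \<times> (real^3))) set topology.
              is_connected_sum S1xS2 S1xS2 M \<and> is_connected_sum M S1xS2 (top_of_set S)))"
  proof (cases rule: circle_cases[OF assms, of h, case_names positive touching two pinched four])
    case positive
    have "A = casimir_sphere C"
      using discr_full(2)[OF assms _ positive] by (auto simp: A casimir_sphere_def less_imp_le)
    moreover have "S1xS2 homeomorphic_space top_of_set W"
      unfolding W_def using positive_homeomorphic[OF assms] discr_full(2)[OF assms _ positive] by blast
    then have "top_of_set S homeomorphic_space S1xS2"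
      using SW homeomorphic_space_sym homeomorphic_space_trans by blast
    ultimately show ?thesis using no_disks minus_open_disks_imp(1) by fastforce
  next
    case touching
    \<comment> \<open>The full image rules out two or four disks, and the remaining hypotheses
      contain regularity, which fails.\<close>
    have "A = casimir_sphere C"
      using discr_full(1)[OF assms _ touching(1)] by (auto simp: A casimir_sphere_def)
    then show ?thesis using no_disks minus_open_disks_imp(1) touching(2) by fastforce
  next
    case (two \<alpha>)
    note m = marked_image[OF assms two(1) _ A]
    have "\<alpha> 0 < \<alpha> 1" using two(2)[of 0] by simp
    then have card: "card (components (casimir_sphere C - A)) = 2" and disks: "minus_open_disks 2 (casimir_sphere C) A"
      using m(1,2) two(2) by blast+
    have "realizes 4 W" using marked_realizes[OF assms two(1)] two(2) by (simp add: W_def)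
    then have "top_of_set W homeomorphic_space S1xS2"
      unfolding S1xS2_def using realizes_homeomorphic realizes_S1xS2 by blast
    then have "top_of_set S homeomorphic_space S1xS2"
      using SW homeomorphic_space_trans by blast
    then show ?thesis using card disks minus_open_disks_imp(1)[of 4] by fastforce
  next
    case (pinched \<alpha>)
    note m = marked_image[OF assms pinched(1,2) A]
    \<comment> \<open>The complement does have four components, but two of them have meeting
      closures.\<close>
    have "\<not> minus_open_disks 4 (casimir_sphere C) A"
      using m(3) pinched(3) minus_open_disks_imp(2) by fastforce
    moreover have "\<not> minus_open_disks 2 (casimir_sphere C) A"
      using m(1) minus_open_disks_imp(1)[of 2] by fastforce
    ultimately show ?thesis using pinched(4) by blast
  next
    case (four \<alpha>)
    note m = marked_image[OF assms four(1) _ A]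
    have "\<alpha> 0 < \<alpha> 1" using four(2)[of 0] by simp
    then have card: "card (components (casimir_sphere C - A)) = 4" and disks: "minus_open_disks 4 (casimir_sphere C) A"
      using m(1,2) four(2) by blast+
    have "realizes 8 W" using marked_realizes[OF assms four(1)] four(2) by (simp add: W_def)
    moreover have "top_of_set W homeomorphic_space top_of_set S"
      using SW by (rule iffD1[OF homeomorphic_space_sym])
    ultimately have "\<exists>M :: (((real^2) \<times> (real^3)) + ((real^2) \<times> (real^3))) set topology.
              is_connected_sum S1xS2 S1xS2 M \<and> is_connected_sum M S1xS2 (top_of_set S)"
      by (rule realizes_8_connected_sum)
    moreover have "A \<noteq> casimir_sphere C" using no_disks card by auto
    moreover have "\<not> minus_open_disks 2 (casimir_sphere C) A"
      using card minus_open_disks_imp(1)[of 2] by fastforce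
    ultimately show ?thesis using disks by blast
  qed
  then show ?thesis by (simp only: A_def S_def)
qed

end
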